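(* Let $T$ be any one of the three sets $\left(-\frac12,-\frac14\right)\cup\left(\frac14,\frac12\right)$, $\left(-\frac14,0\right)\cup\left(\frac14,\frac12\right)$, $\left(-\frac12,-\frac14\right)\cup\left(0,\frac14\right)$. Then $\mathcal{B}(23,7;T)=93150$. Consequently, the code $C_0$ is a tight $T$-avoiding spherical $7$-design for each of these $T$.
   Context: A spherical code is a finite set $C\subset\mathbb{S}^{n-1}$; $I(C)=\{x\cdot y: x,y\in C,\ x\ne y\}$. For $T\subset[-1,1)$, $C$ is $T$-avoiding if $I(C)\cap T=\varnothing$. A spherical $\tau$-design is a spherical code $C$ such that the average over $C$ of every polynomial in $n$ variables of total degree at most $\tau$ equals its average over $\mathbb{S}^{n-1}$ with respect to normalized surface measure. $\mathcal{B}(n,\tau;T)$ is the minimum of $|C|$ over all $T$-avoiding spherical $\tau$-designs $C\subset\mathbb{S}^{n-1}$. Let $P_i^{(n)}$ be the Gegenbauer polynomials: orthogonal on $[-1,1]$ with weight $(1-t^2)^{(n-3)/2}$, $\deg P_i^{(n)}=i$, $P_i^{(n)}(1)=1$; write a real polynomial as $f=\sum_i f_iP_i^{(n)}$. Linear programming gives $\mathcal{B}(n,\tau;T)\ge f(1)/f_0$ for every real polynomial $f$ with $f\ge0$ on $[-1,1]\setminus T$, $f_0>0$, and $f_i\le0$ for all $i\ge\tau+1$. A $T$-avoiding spherical $\tau$-design $C\subset\mathbb{S}^{n-1}$ is called tight if $|C|=f(1)/f_0$ for some such $f$. The code $C_0$: let $L\subset\mathbb{S}^{23}$ be the set of the $196560$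 minimal vectors of the Leech lattice rescaled to unit length. Fix $x\in L$; $C_0=\{y\in L: x\cdot y=0\}$, regarded as a subset of the unit sphere $\mathbb{S}^{22}$ of $x^\perp\cong\mathbb{R}^{23}$. It is an antipodal spherical $7$-design with $93150$ points and inner products $-1,\pm\frac12,\pm\frac14,0$. *)

theory Defs
  imports
    "HOL-Analysis.Analysis"
    "HOL-Probability.Probability"
    "HOL-Computational_Algebra.Polynomial"
begin

section \<open>Spherical designs avoiding a set of inner products\<close>

definition spherical_code :: "'a::euclidean_space set \<Rightarrow> bool" where
  "spherical_code C \<longleftrightarrow> finite C \<and> C \<subseteq> sphere 0 1"

definition inner_products :: "'a::real_inner set \<Rightarrow> real set" where
  "inner_products C = {x \<bullet> y | x y. x \<in> C \<and> y \<in> C \<and> x \<noteq> y}"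

definition avoiding :: "real set \<Rightarrow> 'a::real_inner set \<Rightarrow> bool" where
  "avoiding T C \<longleftrightarrow> inner_products C \<inter> T = {}"

text \<open>
  Normalized surface measure on the unit sphere, as the cone measure: a set \<open>A\<close> of unit vectors has
  measure \<open>vol {r a | a \<in> A, 0 < r < 1} / vol (ball 0 1)\<close>. It is a Borel measure on the whole
  space, concentrated on the sphere; \<open>sgn x = x / |x|\<close>, and the origin is a null set.
\<close>
definition sphere_measure :: "'a::euclidean_space measure" where
  "sphere_measure = distr (uniform_measure lborel (ball 0 1)) borel sgn"

lemma prob_space_sphere_measure: "prob_space (sphere_measure :: 'a::euclidean_space measure)"
proof -
  have "unit_ball_vol (real DIM('a)) \<noteq> 0"
    using unit_ball_vol_pos[of "real DIM('a)"] by linarith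
  then have "prob_space (uniform_measure lborel (ball (0::'a) 1))"
    by (intro prob_space_uniform_measure) (simp_all add: emeasure_ball)
  moreover have "(sgn :: 'a \<Rightarrow> 'a) \<in> borel_measurable borel"
    unfolding sgn_div_norm by measurable
  then have "(sgn :: 'a \<Rightarrow> 'a) \<in> measurable (uniform_measure lborel (ball 0 1)) borel"
    by (simp add: measurable_def)
  ultimately show ?thesis
    unfolding sphere_measure_def by (rule prob_space.prob_space_distr)
qed

definition poly_fun_total_degree_le :: "nat \<Rightarrow> (real ^ 'n::finite \<Rightarrow> real) \<Rightarrow> bool" where
  "poly_fun_total_degree_le d p \<longleftrightarrow>
     (\<exists>c :: ('n \<Rightarrow> nat) \<Rightarrow> real.
        \<forall>x. p x = (\<Sum>a\<in>{a. (\<Sum>i\<in>UNIV. a i) \<le> d}. c a * (\<Prod>i\<in>UNIV. (x $ i) ^ a i)))"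

text \<open>The sum above really ranges over a finite set of exponents.\<close>
lemma finite_exponents: "finite {a :: 'n::finite \<Rightarrow> nat. (\<Sum>i\<in>UNIV. a i) \<le> d}"
proof (rule finite_subset)
  show "{a :: 'n \<Rightarrow> nat. (\<Sum>i\<in>UNIV. a i) \<le> d} \<subseteq> PiE UNIV (\<lambda>_. {..d})"
  proof
    fix a :: "'n \<Rightarrow> nat"
    assume le: "a \<in> {a. (\<Sum>i\<in>UNIV. a i) \<le> d}"
    have "a i \<le> (\<Sum>i\<in>UNIV. a i)" for i
      by (rule member_le_sum) simp_all
    with le have "a i \<le> d" for i
      using le_trans by blast
    then show "a \<in> PiE UNIV (\<lambda>_. {..d})" by (simp add: PiE_UNIV_domain Pi_iff)
  qed
  show "finite (PiE (UNIV :: 'n set) (\<lambda>_. {..d}))" by (rule finite_PiE) simp_all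
qed

text \<open>The empty code is not a design: the constant polynomial 1 would get average \<open>0 / 0 = 0\<close>.\<close>
definition spherical_design :: "nat \<Rightarrow> (real ^ 'n::finite) set \<Rightarrow> bool" where
  "spherical_design \<tau> C \<longleftrightarrow>
     spherical_code C \<and>
     (\<forall>p. poly_fun_total_degree_le \<tau> p \<longrightarrow>
        (\<Sum>x\<in>C. p x) / real (card C) = integral\<^sup>L sphere_measure p)"

text \<open>
  The least cardinality of a \<open>T\<close>-avoiding spherical \<open>\<tau>\<close>-design in dimension \<open>CARD('n)\<close>. It is \<open>\<infinity>\<close> if
  there is no such design, so a finite value asserts that the minimum exists and is attained.
\<close>
definition min_design_size :: "'n::finite itself \<Rightarrow> nat \<Rightarrow> real set \<Rightarrow> enat" where
  "min_design_size _ \<tau> T =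
     (INF C \<in> {C :: (real ^ 'n) set. spherical_design \<tau> C \<and> avoiding T C}. enat (card C))"


section \<open>Gegenbauer polynomials and tight designs\<close>

text \<open>
  For \<open>n \<ge> 2\<close> the weight is integrable and the conditions determine the family uniquely.
\<close>
definition gegenbauer :: "nat \<Rightarrow> nat \<Rightarrow> real poly" where
  "gegenbauer n = (THE P :: nat \<Rightarrow> real poly.
     (\<forall>i. degree (P i) = i \<and> poly (P i) 1 = 1) \<and>
     (\<forall>i j. i \<noteq> j \<longrightarrow>
        integral {-1..1}
          (\<lambda>t. poly (P i) t * poly (P j) t * (1 - t\<^sup>2) powr ((real n - 3) / 2)) = 0))"

definition gegenbauer_expansion :: "nat \<Rightarrow> real poly \<Rightarrow> (nat \<Rightarrow> real) \<Rightarrow> bool" where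
  "gegenbauer_expansion n f c \<longleftrightarrow>
     (\<forall>i > degree f. c i = 0) \<and> f = (\<Sum>i\<le>degree f. smult (c i) (gegenbauer n i))"

definition tight_avoiding_design :: "nat \<Rightarrow> real set \<Rightarrow> (real ^ 'n::finite) set \<Rightarrow> bool" where
  "tight_avoiding_design \<tau> T C \<longleftrightarrow>
     spherical_design \<tau> C \<and> avoiding T C \<and>
     (\<exists>f c. gegenbauer_expansion CARD('n) f c \<and>
        (\<forall>t \<in> {-1..1} - T. 0 \<le> poly f t) \<and> c 0 > 0 \<and> (\<forall>i \<ge> \<tau> + 1. c i \<le> 0) \<and>
        real (card C) = poly f 1 / c 0)"


section \<open>The Leech lattice\<close>

text \<open>
  Coordinates are indexed by the projective line over the field with 23 elements: \<open>None\<close> is the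
  point at infinity, and arithmetic in the type \<open>23\<close> is modulo 23. The extended binary Golay code,
  with words identified with their supports, is the extended quadratic residue code: the binary
  span of the sets \<open>{\<infinity>} \<union> {a + q | q a nonzero square mod 23}\<close>.
\<close>
definition golay_generator :: "23 \<Rightarrow> 23 option set" where
  "golay_generator a = insert None {Some (a + b\<^sup>2) | b. b \<noteq> 0}"

inductive_set golay_code :: "23 option set set" where
  zero: "{} \<in> golay_code"
| add: "W \<in> golay_code \<Longrightarrow> sym_diff W (golay_generator a) \<in> golay_code"

text \<open>
  The standard coordinates of the Leech lattice: \<open>x / sqrt 8\<close> with \<open>x\<close> integral, all \<open>x\<^sub>i\<close>
  congruent to some \<open>m\<close> modulo 2, those \<open>i\<close> for which \<open>x\<^sub>i\<close> is not congruent to \<open>m\<close> modulo 4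
  forming a Golay codeword, and the coordinate sum congruent to \<open>4 m\<close> modulo 8.
\<close>
definition leech_lattice :: "(real ^ 23 option) set" where
  "leech_lattice =
     {(1 / sqrt 8) *\<^sub>R (\<chi> i. of_int (x i)) | (x :: 23 option \<Rightarrow> int) (m :: int).
        (\<forall>i. x i mod 2 = m mod 2) \<and>
        {i. x i mod 4 \<noteq> m mod 4} \<in> golay_code \<and>
        (\<Sum>i\<in>UNIV. x i) mod 8 = (4 * m) mod 8}"

definition minimal_vectors :: "'a::real_normed_vector set \<Rightarrow> 'a set" where
  "minimal_vectors \<Lambda> = {v \<in> \<Lambda>. v \<noteq> 0 \<and> (\<forall>w \<in> \<Lambda>. w \<noteq> 0 \<longrightarrow> norm v \<le> norm w)}"

definition leech_code :: "(real ^ 23 option) set" where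
  "leech_code = sgn ` minimal_vectors leech_lattice"

definition leech_section :: "real ^ 23 option \<Rightarrow> (real ^ 23 option) set" where
  "leech_section x = {y \<in> leech_code. x \<bullet> y = 0}"

text \<open>
  Identifications of the hyperplane orthogonal to \<open>x\<close> with 23-dimensional Euclidean space; only the
  restriction of \<open>\<phi>\<close> to the hyperplane matters.
\<close>
definition hyperplane_identification ::
    "real ^ 23 option \<Rightarrow> (real ^ 23 option \<Rightarrow> real ^ 23) \<Rightarrow> bool" where
  "hyperplane_identification x \<phi> \<longleftrightarrow>
     linear \<phi> \<and> \<phi> ` {v. x \<bullet> v = 0} = UNIV \<and> (\<forall>v. x \<bullet> v = 0 \<longrightarrow> norm (\<phi> v) = norm v)"

lemma hyperplane_identification_exists:
  assumes "x \<noteq> 0"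
  shows "\<exists>\<phi>. hyperplane_identification x \<phi>"
proof -
  have "dim {v. x \<bullet> v = 0} = dim (UNIV :: (real ^ 23) set)"
    unfolding dim_hyperplane[OF assms] dim_UNIV by (simp add: card_UNIV_option)
  then obtain \<phi> :: "real ^ 23 option \<Rightarrow> real ^ 23"
    where "linear \<phi>" "\<phi> ` {v. x \<bullet> v = 0} = UNIV"
      and "\<And>v. v \<in> {v. x \<bullet> v = 0} \<Longrightarrow> norm (\<phi> v) = norm v"
    by (rule isometry_subspaces[OF subspace_hyperplane subspace_UNIV]) (rule that)
  then have "hyperplane_identification x \<phi>"
    unfolding hyperplane_identification_def by simp
  then show ?thesis by auto
qed

end

theory Submission
  imports Defs "HOL-Library.Option_ord"
begin

text \<open>
  Lower bound: each of the three sets admits a polynomial \<open>f\<close> of degree 7 that vanishes at the inner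
  products of the code, is nonnegative outside \<open>T\<close> and has \<open>f 1 = 93150 f\<^sub>0\<close>. Averaging \<open>f (x \<bullet> z)\<close> over a
  7-design containing \<open>x\<close> gives \<open>|C| f\<^sub>0 \<ge> f 1\<close>.

  Attainment: the minimal vectors of the Leech lattice have inner products \<open>\<plusminus>1, \<plusminus>1/2, \<plusminus>1/4, 0\<close> after
  rescaling, and there are at least 196560 of them. For an antipodal code with these inner products the
  linear programming bound for the kissing number in dimension 24 gives at most 196560 points, and
  equality forces all harmonic moments of degrees 1 to 10 to vanish, so that the code is an 11-design.
  Fixing \<open>x\<close> and multiplying by a polynomial of degree 4 in \<open>x \<bullet> z\<close> that vanishes at \<open>\<plusminus>1/2, \<plusminus>1/4\<close> isolates
  the section orthogonal to \<open>x\<close>, which is therefore a 7-design; its size is read off from the moments.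

  A code or measure enters only through its averaging functional \<open>E\<close>. Knowing \<open>E ((u \<bullet> z)\<^sup>k)\<close> for all
  \<open>u\<close> determines \<open>E\<close> on all polynomials of degree \<open>k\<close>, by comparing coefficients in \<open>u + w v\<close>.
\<close>

section \<open>Surface measure\<close>

text \<open>Let N be the number of points of the Leech code. \<open>kissing_poly\<close> vanishes at
  0, +-1/4 and +-1/2, so its double sum over the code is known exactly, and its expansion turns this
  into an equation: a positive combination of the energies \<open>S cs\<close> equals a positive
  multiple of N (196560 - N). An energy is a positive multiple of the integral of a square, so N <=
  196560. At equality these integrals vanish, and full support of the surface measure makes the
  summed polynomials vanish at every unit vector. Antipodality disposes of all odd degrees, so only
  even polynomials appear and degree 10 already yields strength 11. For tightness,
  \<open>gegenbauer\<close> is a definite description, so existence and uniqueness come before any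
  coefficient can be computed. In dimension 23 the weight is (1 - t^2)^10, and its moments obey the
  same recursion as those of the sphere; this identifies f_0 with the spherical average of f. The
  equality f(1) = 93150 f_0 has a conceptual reason: f vanishes at every inner product of the
  7-design C_0, so averaging f(x . z) over C_0 leaves only z = x.\<close>

lemma lborel_distr_orthogonal:
  fixes f :: "real ^ 'n::{finite,wellorder} \<Rightarrow> real ^ 'n::_"
  assumes f: "orthogonal_transformation f"
  shows "distr lborel borel f = lborel"
proof (rule lborel_eqI[symmetric])
  have lin: "linear f" using f by (rule orthogonal_transformation_linear)
  then have meas: "f \<in> borel_measurable borel"
    by (intro borel_measurable_continuous_onI linear_continuous_on linear_conv_bounded_linear[THEN iffD1])
  have g: "orthogonal_transformation (inv f)" and bij: "bij f"
    using f orthogonal_transformation_inv orthogonal_transformation_bij by auto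
  fix l u :: "real ^ 'n::_"
  assume le: "\<And>b. b \<in> Basis \<Longrightarrow> l \<bullet> b \<le> u \<bullet> b"
  \<comment> \<open>Preimages of boxes become images under the inverse map, which is again
    orthogonal and so preserves Lebesgue measure.\<close>
  have vim: "f -` box l u = inv f ` box l u"
    using bij by (simp add: bij_vimage_eq_inv_image)
  have sets: "f -` box l u \<in> sets borel"
    using measurable_sets[OF meas, of "box l u"] by simp
  have "emeasure (distr lborel borel f) (box l u) = emeasure lborel (f -` box l u)"
    using meas by (subst emeasure_distr) auto
  also have "\<dots> = emeasure lebesgue (inv f ` box l u)"
    using sets vim by simp
  also have "\<dots> = ennreal (measure lebesgue (inv f ` box l u))"
    using measurable_orthogonal_image[OF g, of "box l u"]
    by (intro emeasure_eq_measure2) auto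
  also have "\<dots> = ennreal (measure lebesgue (box l u))"
    using measure_orthogonal_image[OF g, of "box l u"] by simp
  also have "\<dots> = ennreal (\<Prod>b\<in>Basis. (u - l) \<bullet> b)"
    using le by (simp add: measure_lborel_box_eq)
  finally show "emeasure (distr lborel borel f) (box l u) = (\<Prod>b\<in>Basis. (u - l) \<bullet> b)" .
qed simp

lemma emeasure_unit_ball_pos_finite:
  "emeasure lborel (ball (0::'a::euclidean_space) 1) \<noteq> 0"
  "emeasure lborel (ball (0::'a::euclidean_space) 1) \<noteq> \<infinity>"
  using unit_ball_vol_pos[of "real DIM('a)"] by (simp_all add: emeasure_ball less_imp_neq[symmetric])

text \<open>A norm-preserving linear map keeps the unit ball and commutes with \<open>sgn\<close>,
  so the cone construction inherits the invariance of Lebesgue measure.\<close>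

lemma sphere_measure_orthogonal:
  fixes f :: "real ^ 'n::{finite,wellorder} \<Rightarrow> real ^ 'n::_"
  assumes f: "orthogonal_transformation f"
  shows "distr sphere_measure borel f = sphere_measure"
proof -
  let ?U = "uniform_measure lborel (ball (0 :: real ^ 'n::_) 1)"
  have lin: "linear f" using f by (rule orthogonal_transformation_linear)
  then have f_meas [measurable]: "f \<in> borel_measurable borel"
    by (intro borel_measurable_continuous_onI linear_continuous_on linear_conv_bounded_linear[THEN iffD1])
  have sgn_meas [measurable]: "(sgn :: real ^ 'n::_ \<Rightarrow> _) \<in> borel_measurable borel"
    unfolding sgn_div_norm by measurable
  have U: "distr ?U borel f = ?U"
  proof (rule measure_eqI)
    fix A assume "A \<in> sets (distr ?U borel f)"
    then have [measurable]: "A \<in> sets borel" by simp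
    have fA: "f -` A \<in> sets borel"
      using measurable_sets[of f borel borel A] by simp
    have ball: "f -` ball 0 1 = ball 0 1"
      using f by (auto simp: orthogonal_transformation_norm)
    have "emeasure (distr ?U borel f) A = emeasure ?U (f -` A)"
      using f_meas by (subst emeasure_distr) (auto simp: measurable_def)
    also have "\<dots> = emeasure lborel (ball 0 1 \<inter> f -` A) / emeasure lborel (ball (0 :: real ^ 'n::_) 1)"
      using fA by (subst emeasure_uniform_measure) auto
    also have "ball 0 1 \<inter> f -` A = f -` (ball 0 1 \<inter> A)"
      using ball by auto
    also have "emeasure lborel (f -` (ball 0 1 \<inter> A)) = emeasure (distr lborel borel f) (ball 0 1 \<inter> A)"
      by (subst emeasure_distr) auto
    also have "\<dots> = emeasure lborel (ball 0 1 \<inter> A)"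
      by (simp add: lborel_distr_orthogonal[OF f])
    also have "\<dots> / emeasure lborel (ball (0 :: real ^ 'n::_) 1) = emeasure ?U A"
      by (subst emeasure_uniform_measure) auto
    finally show "emeasure (distr ?U borel f) A = emeasure ?U A" .
  qed simp
  have fm: "f \<in> measurable ?U borel" and sm: "sgn \<in> measurable ?U borel"
    using f_meas sgn_meas by (simp_all add: measurable_def)
  have "distr sphere_measure borel f = distr ?U borel (f \<circ> sgn)"
    unfolding sphere_measure_def using sm f_meas by (intro distr_distr)
  also have "f \<circ> sgn = sgn \<circ> f"
    using f by (auto simp: sgn_div_norm orthogonal_transformation_norm linear_cmul[OF lin])
  also have "distr ?U borel (sgn \<circ> f) = distr (distr ?U borel f) borel sgn"
    using fm sgn_meas by (intro distr_distr[symmetric])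
  also have "\<dots> = sphere_measure"
    by (simp add: U sphere_measure_def)
  finally show ?thesis .
qed

lemma AE_sphere_measure_iff:
  assumes [measurable]: "Measurable.pred borel P"
  shows "(AE z in sphere_measure. P z) \<longleftrightarrow> (AE z::'a::euclidean_space in lborel. norm z < 1 \<longrightarrow> P (sgn z))"
proof -
  let ?U = "uniform_measure lborel (ball (0 :: 'a) 1)"
  have "(sgn :: 'a \<Rightarrow> _) \<in> borel_measurable borel"
    unfolding sgn_div_norm by measurable
  then have sm: "sgn \<in> measurable ?U borel"
    by (simp add: measurable_def)
  have "(AE z in sphere_measure. P z) \<longleftrightarrow> (AE z in ?U. P (sgn z))"
    unfolding sphere_measure_def using sm by (subst AE_distr_iff) auto
  also have "\<dots> \<longleftrightarrow> (AE z in lborel. z \<in> ball 0 1 \<longrightarrow> P (sgn z))"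
    using emeasure_unit_ball_pos_finite by (intro AE_uniform_measure) (auto simp: less_top)
  finally show ?thesis by simp
qed

text \<open>The only exception is the origin, which \<open>sgn\<close> fixes and which is a null
  set.\<close>

lemma AE_sphere_measure_norm: "AE z::'a::euclidean_space in sphere_measure. norm z = 1"
proof -
  have "AE z::'a in lborel. z \<noteq> 0"
    by (rule AE_lborel_singleton)
  then show ?thesis
    by (subst AE_sphere_measure_iff) (auto simp: norm_sgn elim: eventually_mono)
qed

lemma sets_sphere_measure [simp, measurable_cong]: "sets sphere_measure = sets borel"
  by (simp add: sphere_measure_def)

lemma space_sphere_measure [simp]: "space sphere_measure = UNIV"
  by (simp add: sphere_measure_def)

lemma integrable_sphere_measure:
  fixes h :: "'a::euclidean_space \<Rightarrow> real"
  assumes h: "continuous_on UNIV h"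
  shows "integrable sphere_measure h"
proof -
  interpret prob_space "sphere_measure :: 'a measure" by (rule prob_space_sphere_measure)
  have "compact (h ` sphere 0 1)"
    using h continuous_on_subset by (intro compact_continuous_image) auto
  then obtain B where B: "\<And>z. norm z = 1 \<Longrightarrow> norm (h z) \<le> B"
    using compact_imp_bounded bounded_iff[of "h ` sphere 0 1"] by (metis imageI mem_sphere_0)
  show ?thesis
  proof (rule integrable_const_bound)
    show "AE z in sphere_measure. norm (h z) \<le> B"
      using AE_sphere_measure_norm by eventually_elim (rule B)
    show "h \<in> borel_measurable sphere_measure"
      using borel_measurable_continuous_onI[OF h] by (simp add: measurable_def)
  qed
qed

lemma sphere_measure_integral_cong:
  fixes g h :: "'a::euclidean_space \<Rightarrow> real"
  assumes "continuous_on UNIV g" "continuous_on UNIV h" "\<And>z. norm z = 1 \<Longrightarrow> g z = h z"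
  shows "integral\<^sup>L sphere_measure g = integral\<^sup>L sphere_measure h"
proof (rule integral_cong_AE)
  show "AE z in sphere_measure. g z = h z"
    using AE_sphere_measure_norm by eventually_elim (rule assms)
qed (use assms integrable_sphere_measure in blast)+

text \<open>Full support: if \<open>h u\<close> were nonzero, the points \<open>z\<close> of the
  punctured ball with \<open>h (sgn z)\<close> nonzero would form a nonempty open null set.\<close>

lemma sphere_measure_integral_eq_0_imp:
  fixes h :: "'a::euclidean_space \<Rightarrow> real"
  assumes h: "continuous_on UNIV h" "\<And>z. 0 \<le> h z" and int: "integral\<^sup>L sphere_measure h = 0"
    and u: "norm u = 1"
  shows "h u = 0"
proof (rule ccontr)
  assume nz: "h u \<noteq> 0"
  have [measurable]: "h \<in> borel_measurable borel"
    using h(1) by (rule borel_measurable_continuous_onI)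
  have "AE z in sphere_measure. h z = 0"
    using integral_nonneg_eq_0_iff_AE[OF integrable_sphere_measure[OF h(1)]] h(2) int by simp
  then have ae: "AE z::'a in lborel. norm z < 1 \<longrightarrow> h (sgn z) = 0"
    by (subst (asm) AE_sphere_measure_iff) auto
  define S :: "'a set" where "S = {z \<in> ball 0 1 - {0}. h (sgn z) \<noteq> 0}"
  have "continuous_on (ball 0 1 - {0}) (\<lambda>z::'a. h (sgn z))"
    unfolding sgn_div_norm
    by (rule continuous_on_compose2[OF h(1)]) (auto intro!: continuous_intros)
  then have "open ((\<lambda>z::'a. h (sgn z)) -` (- {0}) \<inter> (ball 0 1 - {0}))"
    by (subst (asm) continuous_on_open_vimage) (auto intro: open_delete)
  also have "((\<lambda>z::'a. h (sgn z)) -` (- {0}) \<inter> (ball 0 1 - {0})) = S"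
    by (auto simp: S_def)
  finally have "open S" .
  moreover have "(1/2) *\<^sub>R u \<in> S"
    using nz u by (auto simp: S_def sgn_div_norm)
  moreover have "AE z in lborel. z \<notin> S"
    using ae by eventually_elim (auto simp: S_def)
  then have "emeasure lborel S = 0"
    using \<open>open S\<close> by (subst (asm) AE_iff_measurable[of S]) auto
  then have "negligible S"
    using \<open>open S\<close> by (auto simp: negligible_iff_null_sets null_sets_def)
  ultimately show False
    using open_not_negligible by blast
qed


section \<open>Designs as linear functionals\<close>

text \<open>The laws are restricted to continuous functions so that the integral is an instance: the
  Bochner integral is not additive on functions that fail to be integrable.\<close>

locale continuous_functional =
  fixes E :: "('a::euclidean_space \<Rightarrow> real) \<Rightarrow> real"
  assumes add: "\<lbrakk>continuous_on UNIV f; continuous_on UNIV g\<rbrakk> \<Longrightarrow> E (\<lambda>z. f z + g z) = E f + E g"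
    and cmult: "continuous_on UNIV f \<Longrightarrow> E (\<lambda>z. c * f z) = c * E f"
begin

lemma zero: "E (\<lambda>z. 0) = 0"
  using cmult[of "\<lambda>_. 0" 0] by simp

lemma sum:
  assumes "\<And>i. i \<in> A \<Longrightarrow> continuous_on UNIV (f i)"
  shows "E (\<lambda>z. \<Sum>i\<in>A. f i z) = (\<Sum>i\<in>A. E (f i))"
  using assms
proof (induction A rule: infinite_finite_induct)
  case (insert i A)
  then show ?case by (simp add: add continuous_on_sum)
qed (simp_all add: zero)

text \<open>The passive factor \<open>h\<close> allows the expansion to be repeated one variable at
  a time.\<close>

lemma poly_expand:
  assumes h: "continuous_on UNIV h"
  shows "E (\<lambda>z. (u \<bullet> z + w * (v \<bullet> z)) ^ k * h z) =
    poly (\<Sum>b\<le>k. monom (real (k choose b) * E (\<lambda>z. (u \<bullet> z) ^ (k - b) * (v \<bullet> z) ^ b * h z)) b) w"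
proof -
  have cont: "continuous_on UNIV (\<lambda>z. (u \<bullet> z) ^ (k - b) * (v \<bullet> z) ^ b * h z)" for b
    by (intro continuous_intros h)
  have "E (\<lambda>z. (u \<bullet> z + w * (v \<bullet> z)) ^ k * h z) =
      E (\<lambda>z. \<Sum>b\<le>k. (real (k choose b) * w ^ b) * ((u \<bullet> z) ^ (k - b) * (v \<bullet> z) ^ b * h z))"
    by (rule arg_cong[of _ _ E])
       (simp add: add.commute[of "u \<bullet> _"] binomial_ring sum_distrib_left sum_distrib_right power_mult_distrib mult_ac)
  also have "\<dots> = (\<Sum>b\<le>k. (real (k choose b) * w ^ b) * E (\<lambda>z. (u \<bullet> z) ^ (k - b) * (v \<bullet> z) ^ b * h z))"
    by (subst sum) (auto intro!: continuous_intros h sum.cong cmult cont)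
  finally show ?thesis
    by (simp add: poly_sum poly_monom mult_ac)
qed

lemma coeff_functional:
  assumes h: "continuous_on UNIV h"
    and p: "\<And>w. E (\<lambda>z. (u \<bullet> z + w * (v \<bullet> z)) ^ k * h z) = poly p w"
    and b: "b \<le> k"
  shows "real (k choose b) * E (\<lambda>z. (u \<bullet> z) ^ (k - b) * (v \<bullet> z) ^ b * h z) = coeff p b"
proof -
  have "p = (\<Sum>b\<le>k. monom (real (k choose b) * E (\<lambda>z. (u \<bullet> z) ^ (k - b) * (v \<bullet> z) ^ b * h z)) b)"
    using p poly_expand[OF h] by (intro poly_eq_poly_eq_iff[THEN iffD1] ext) simp
  then show ?thesis
    using b by (simp add: coeff_sum)
qed

text \<open>Homogeneity reduces to unit vectors. Degree 0 has its own hypothesis because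
  \<open>0 ^ 0 = 1\<close> at \<open>u = 0\<close>.\<close>

lemma scale_power:
  assumes "\<And>u. norm u = 1 \<Longrightarrow> E (\<lambda>z. (u \<bullet> z) ^ k) = c" and "k = 0 \<Longrightarrow> E (\<lambda>z. 1) = c"
  shows "E (\<lambda>z. (u \<bullet> z) ^ k) = c * norm u ^ k"
proof (cases "u = 0")
  case True
  with assms(2) show ?thesis by (cases k) (simp_all add: zero)
next
  case False
  have "(u \<bullet> z) ^ k = norm u ^ k * (sgn u \<bullet> z) ^ k" for z
    using False by (simp add: sgn_div_norm power_mult_distrib field_simps)
  then have "E (\<lambda>z. (u \<bullet> z) ^ k) = norm u ^ k * E (\<lambda>z. (sgn u \<bullet> z) ^ k)"
    by (simp add: cmult continuous_intros)
  then show ?thesis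
    using False assms(1)[of "sgn u"] by (simp add: norm_sgn)
qed

end

text \<open>The average of the k-th power of a coordinate on the unit sphere of
  \<open>r\<close>-dimensional space. At \<open>k = 0\<close> in the second equation the factor 0
  absorbs the truncated \<open>k - 1\<close>, so the first moment is 0.\<close>

fun sphere_moment :: "real \<Rightarrow> nat \<Rightarrow> real" where
  "sphere_moment r 0 = 1"
| "sphere_moment r (Suc k) = real k / (r + real k - 1) * sphere_moment r (k - 1)"

text \<open>The spherical average of \<open>(x \<bullet> z)\<^sup>a (y \<bullet> z)\<^sup>b\<close> in dimension \<open>r\<close>, for unit vectors with \<open>x \<bullet> y = s\<close>.
  Where the subtractions are truncated, the factor in front is 0.\<close>
fun zonal_moment :: "real \<Rightarrow> real \<Rightarrow> nat \<Rightarrow> nat \<Rightarrow> real" where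
  "zonal_moment r s 0 b = sphere_moment r b"
| "zonal_moment r s (Suc a) b =
     (real a * zonal_moment r s (a - 1) b + real b * s * zonal_moment r s a (b - 1)) / (r + real a + real b - 1)"

lemma sphere_moment_odd: "odd k \<Longrightarrow> sphere_moment r k = 0"
proof (induction k rule: less_induct)
  case (less k)
  then obtain j where k: "k = Suc j" "even j" by (cases k) auto
  then show ?case using less.IH[of "j - 1"] by (cases j) auto
qed

text \<open>No normalization is imposed, so plain sums over a code and averages both
  qualify.\<close>

locale design_functional = continuous_functional E
  for E :: "('a::euclidean_space \<Rightarrow> real) \<Rightarrow> real" +
  fixes K :: nat
  assumes moment: "\<lbrakk>k \<le> K; norm u = 1\<rbrakk> \<Longrightarrow>
    E (\<lambda>z. (u \<bullet> z) ^ k) = sphere_moment (real DIM('a)) k * E (\<lambda>z. 1)"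
begin

lemma moment_general:
  assumes "k \<le> K"
  shows "E (\<lambda>z. (u \<bullet> z) ^ k) = sphere_moment (real DIM('a)) k * E (\<lambda>z. 1) * norm u ^ k"
  by (rule scale_power) (use moment assms in auto)

text \<open>For even \<open>n\<close> the moment of degree \<open>n + 2\<close> is a constant times
  a power of \<open>u \<bullet> u\<close>, and the linear coefficient along u + w x is its
  directional derivative. The vector \<open>u\<close> stays arbitrary so that it can be polarized
  again.\<close>

lemma first_order:
  assumes n: "n + 2 \<le> K"
  shows "(real DIM('a) + real n) * E (\<lambda>z. (u \<bullet> z) ^ Suc n * (x \<bullet> z)) = real (Suc n) * (x \<bullet> u) * E (\<lambda>z. (u \<bullet> z) ^ n)"
proof (cases "even n")
  case False
  have "E (\<lambda>z. (u \<bullet> z + w * (x \<bullet> z)) ^ (n + 2) * 1) = poly 0 w" for w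
    using moment_general[OF n, of "u + w *\<^sub>R x"] False
    by (simp add: inner_left_distrib sphere_moment_odd)
  from coeff_functional[OF _ this, of 1]
  have "E (\<lambda>z. (u \<bullet> z) ^ Suc n * (x \<bullet> z)) = 0" by simp
  moreover have "E (\<lambda>z. (u \<bullet> z) ^ n) = 0"
    using moment_general[of n u] n False by (simp add: sphere_moment_odd)
  ultimately show ?thesis by simp
next
  case True
  then obtain j where j: "n = 2 * j" by blast
  have nrm: "norm v ^ (2 * i) = (v \<bullet> v) ^ i" for v :: 'a and i
    by (simp add: power_mult power2_norm_eq_inner)
  define c where "c = sphere_moment (real DIM('a)) (n + 2) * E (\<lambda>z. 1)"
  let ?q = "[:u \<bullet> u, 2 * (x \<bullet> u), x \<bullet> x:]"
  have "E (\<lambda>z. (u \<bullet> z + w * (x \<bullet> z)) ^ (n + 2) * 1) = poly (smult c (?q ^ Suc j)) w" for w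
  proof -
    have "E (\<lambda>z. (u \<bullet> z + w * (x \<bullet> z)) ^ (n + 2) * 1) = c * norm (u + w *\<^sub>R x) ^ (n + 2)"
      using moment_general[OF n, of "u + w *\<^sub>R x"] by (simp add: inner_left_distrib c_def)
    also have "norm (u + w *\<^sub>R x) ^ (n + 2) = poly ?q w ^ Suc j"
      using nrm[of "u + w *\<^sub>R x" "Suc j"]
      by (simp add: j inner_left_distrib inner_right_distrib inner_commute algebra_simps)
    finally show ?thesis by (simp only: poly_smult poly_power)
  qed
  from coeff_functional[OF _ this, of 1]
  have "real (n + 2) * E (\<lambda>z. (u \<bullet> z) ^ Suc n * (x \<bullet> z)) = c * coeff (?q ^ Suc j) 1"
    by simp
  also have "coeff (?q ^ Suc j) 1 = poly (pderiv (?q ^ Suc j)) 0"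
    by (simp only: poly_0_coeff_0 coeff_pderiv) simp
  also have "\<dots> = real (Suc j) * (u \<bullet> u) ^ j * (2 * (x \<bullet> u))"
    by (simp only: pderiv_power_Suc) (simp add: pderiv_pCons poly_power)
  finally have "real (n + 2) * E (\<lambda>z. (u \<bullet> z) ^ Suc n * (x \<bullet> z)) = real (n + 2) * (c * (u \<bullet> u) ^ j * (x \<bullet> u))"
    by (simp add: j algebra_simps)
  then have "E (\<lambda>z. (u \<bullet> z) ^ Suc n * (x \<bullet> z)) = c * (u \<bullet> u) ^ j * (x \<bullet> u)"
    by (simp only: mult_cancel_left of_nat_eq_0_iff) simp
  moreover have "(real DIM('a) + real n) * sphere_moment (real DIM('a)) (n + 2) = real (Suc n) * sphere_moment (real DIM('a)) n"
  proof -
    have "sphere_moment (real DIM('a)) (n + 2) = real (Suc n) / (real DIM('a) + real n) * sphere_moment (real DIM('a)) n"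
      by simp
    moreover have "real DIM('a) + real n > 0" using DIM_positive[where 'a='a] by linarith
    ultimately show ?thesis by simp
  qed
  ultimately have "(real DIM('a) + real n) * E (\<lambda>z. (u \<bullet> z) ^ Suc n * (x \<bullet> z)) =
      (real (Suc n) * sphere_moment (real DIM('a)) n) * E (\<lambda>z. 1) * (u \<bullet> u) ^ j * (x \<bullet> u)"
    by (simp only: c_def mult.assoc[symmetric])
  then show ?thesis
    using moment_general[of n u] n nrm[of u j] by (simp add: j mult_ac)
qed

text \<open>Putting x + w y for \<open>u\<close> in \<open>first_order\<close> and extracting the
  coefficient of \<open>w ^ b\<close> lowers the total degree by 2, as integration by parts on the
  sphere would.\<close>

lemma moment_step:
  assumes ab: "0 < a + b" "a + b < K"
  shows "(real DIM('a) + real a + real b - 1) * E (\<lambda>z. (x \<bullet> z) ^ Suc a * (y \<bullet> z) ^ b) =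
    real a * (x \<bullet> x) * E (\<lambda>z. (x \<bullet> z) ^ (a - 1) * (y \<bullet> z) ^ b) +
    real b * (x \<bullet> y) * E (\<lambda>z. (x \<bullet> z) ^ a * (y \<bullet> z) ^ (b - 1))"
proof -
  from ab(1) obtain n where n: "a + b = Suc n"
    by (metis not0_implies_Suc less_numeral_extra(3))
  have rn: "real DIM('a) + real n > 0" using DIM_positive[where 'a='a] by linarith
  define M where "M i j = E (\<lambda>z. (x \<bullet> z) ^ i * (y \<bullet> z) ^ j)" for i j
  define q where "q = (\<Sum>b\<le>n. monom (real (n choose b) * M (n - b) b) b)"
  have q: "coeff q b = real (n choose b) * M (n - b) b" for b
    by (auto simp: q_def coeff_sum)
  have "E (\<lambda>z. (x \<bullet> z + w * (y \<bullet> z)) ^ Suc n * (x \<bullet> z)) =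
      poly (smult (real (Suc n) / (real DIM('a) + real n)) ([:x \<bullet> x, x \<bullet> y:] * q)) w" for w
  proof -
    have "(real DIM('a) + real n) * E (\<lambda>z. (x \<bullet> z + w * (y \<bullet> z)) ^ Suc n * (x \<bullet> z)) =
        real (Suc n) * (x \<bullet> x + w * (x \<bullet> y)) * E (\<lambda>z. (x \<bullet> z + w * (y \<bullet> z)) ^ n)"
      using first_order[of n "x + w *\<^sub>R y" x] n ab by (simp add: inner_left_distrib inner_right_distrib)
    also have "E (\<lambda>z. (x \<bullet> z + w * (y \<bullet> z)) ^ n) = poly q w"
      using poly_expand[of "\<lambda>_. 1" x w y n] by (simp add: q_def M_def)
    finally show ?thesis
      using rn by (simp add: field_simps)
  qed
  from coeff_functional[OF _ this, of b] n
  have "real (Suc n choose b) * E (\<lambda>z. (x \<bullet> z) ^ (Suc n - b) * (y \<bullet> z) ^ b * (x \<bullet> z)) =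
      real (Suc n) / (real DIM('a) + real n) * coeff ([:x \<bullet> x, x \<bullet> y:] * q) b"
    by (simp add: continuous_intros del: binomial_Suc_Suc)
  moreover have "Suc n - b = a" using n by simp
  ultimately have "real (Suc n choose b) * M (Suc a) b =
      real (Suc n) / (real DIM('a) + real n) * coeff ([:x \<bullet> x, x \<bullet> y:] * q) b"
    by (simp add: M_def mult_ac del: binomial_Suc_Suc)
  then have "real (Suc n choose b) * ((real DIM('a) + real n) * M (Suc a) b) =
      real (Suc n) * coeff ([:x \<bullet> x, x \<bullet> y:] * q) b"
    using rn by (simp add: field_simps del: binomial_Suc_Suc)
  \<comment> \<open>The linear factor combines two neighbouring coefficients; absorption identities
    for binomials then pull out the common factor \<open>Suc n choose b\<close>.\<close>
  also have "coeff ([:x \<bullet> x, x \<bullet> y:] * q) b = (x \<bullet> x) * coeff q b + (x \<bullet> y) * (case b of 0 \<Rightarrow> 0 | Suc i \<Rightarrow> coeff q i)"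
    by (simp add: coeff_pCons split: nat.splits)
  also have "real (Suc n) * \<dots> = (x \<bullet> x) * (real (Suc n) * coeff q b) +
      (x \<bullet> y) * (case b of 0 \<Rightarrow> 0 | Suc i \<Rightarrow> real (Suc n) * coeff q i)"
    by (simp add: algebra_simps split: nat.splits)
  also have "real (Suc n) * coeff q b = real (Suc n choose b) * (real a * M (a - 1) b)"
  proof -
    have "Suc n * (n choose b) = (Suc n - b) * (Suc n choose b)"
      using binomial_absorb_comp[of "Suc n" b] by simp
    then have "real (Suc n) * real (n choose b) = real a * real (Suc n choose b)"
      using n by (metis \<open>Suc n - b = a\<close> of_nat_mult)
    moreover have "n - b = a - 1" using n by simp
    ultimately show ?thesis by (simp add: q)
  qed
  also have "(case b of 0 \<Rightarrow> 0 | Suc i \<Rightarrow> real (Suc n) * coeff q i) = real (Suc n choose b) * (real b * M a (b - 1))"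
  proof (cases b)
    case (Suc i)
    have "Suc i * (Suc n choose Suc i) = Suc n * (n choose i)"
      by (rule Suc_times_binomial)
    then have "real (Suc n) * real (n choose i) = real (Suc i) * real (Suc n choose Suc i)"
      by (metis of_nat_mult)
    moreover have "n - i = a" using n Suc by simp
    ultimately show ?thesis by (simp add: q Suc)
  qed simp
  finally have "real (Suc n choose b) * ((real DIM('a) + real n) * M (Suc a) b) =
      real (Suc n choose b) * (real a * (x \<bullet> x) * M (a - 1) b + real b * (x \<bullet> y) * M a (b - 1))"
    by (simp add: algebra_simps)
  moreover have "Suc n choose b \<noteq> 0" using n by simp
  moreover have "real DIM('a) + real n = real DIM('a) + real a + real b - 1" using n by linarith
  ultimately show ?thesis
    unfolding M_def by simp
qed

lemma zonal_moment:
  assumes "norm x = 1" "norm y = 1" "a + b \<le> K"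
  shows "E (\<lambda>z. (x \<bullet> z) ^ a * (y \<bullet> z) ^ b) = zonal_moment (real DIM('a)) (x \<bullet> y) a b * E (\<lambda>z. 1)"
proof -
  define s where "s = x \<bullet> y"
  have "E (\<lambda>z. (x \<bullet> z) ^ a * (y \<bullet> z) ^ b) = zonal_moment (real DIM('a)) s a b * E (\<lambda>z. 1)"
    using assms(3)
  proof (induction a arbitrary: b rule: less_induct)
    case (less a b)
    show ?case
    proof (cases a)
      case 0
      then show ?thesis using moment[of b y] less.prems assms by simp
    next
      case (Suc i)
      show ?thesis
      proof (cases "i + b = 0")
        \<comment> \<open>Total degree 1, which \<open>moment_step\<close> excludes; both sides are
          0.\<close>
        case True
        then show ?thesis using moment[of 1 x] less.prems assms by (simp add: Suc)
      next
        case False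
        have "x \<bullet> x = 1" using assms by (simp add: norm_eq_1)
        then have "(real DIM('a) + real i + real b - 1) * E (\<lambda>z. (x \<bullet> z) ^ a * (y \<bullet> z) ^ b) =
            real i * (zonal_moment (real DIM('a)) s (i - 1) b * E (\<lambda>z. 1)) +
            real b * s * (zonal_moment (real DIM('a)) s i (b - 1) * E (\<lambda>z. 1))"
          using moment_step[of i b x y] less.IH[of "i - 1" b] less.IH[of i "b - 1"] less.prems False
          by (simp add: Suc s_def)
        moreover have "real DIM('a) + real i + real b - 1 > 0"
          using False DIM_positive[where 'a='a] by linarith
        ultimately show ?thesis by (simp add: Suc field_simps)
      qed
    qed
  qed
  then show ?thesis by (simp add: s_def)
qed

end

text \<open>Coordinates are peeled off one at a time: \<open>u\<close> moves along an axis and one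
  coefficient in \<open>w\<close> is taken, while the remaining power of the linear form is carried
  through the induction.\<close>

lemma monomial_functional_eq_0:
  fixes E :: "(real ^ 'n \<Rightarrow> real) \<Rightarrow> real"
  assumes "continuous_functional E"
    and powers: "\<And>k u. k \<le> K \<Longrightarrow> E (\<lambda>z. (u \<bullet> z) ^ k) = 0"
    and a: "(\<Sum>i\<in>UNIV. a i) \<le> K"
  shows "E (\<lambda>z. \<Prod>i\<in>UNIV. (z $ i) ^ a i) = 0"
proof -
  interpret continuous_functional E by fact
  have "j + sum a I \<le> K \<Longrightarrow> E (\<lambda>z. (u \<bullet> z) ^ j * (\<Prod>i\<in>I. (z $ i) ^ a i)) = 0" if "finite I" for I j u
    using that
  proof (induction I arbitrary: j u rule: finite_induct)
    case empty
    then show ?case using powers by simp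
  next
    case (insert i I)
    let ?h = "\<lambda>z::real ^ 'n. \<Prod>i\<in>I. (z $ i) ^ a i"
    have h: "continuous_on UNIV ?h" by (intro continuous_intros)
    have "E (\<lambda>z. (u \<bullet> z + w * (axis i 1 \<bullet> z)) ^ (j + a i) * ?h z) = poly 0 w" for w
      using insert.IH[of "j + a i" "u + w *\<^sub>R axis i 1"] insert.hyps insert.prems
      by (simp add: inner_left_distrib add.assoc)
    from coeff_functional[OF h this, of "a i"]
    have "E (\<lambda>z. (u \<bullet> z) ^ j * (z $ i) ^ a i * ?h z) = 0"
      by (simp add: inner_axis')
    then show ?case
      using insert.hyps by (simp add: mult.assoc)
  qed
  from this[of UNIV 0 0] a show ?thesis by simp
qed

lemma continuous_functional_diff:
  assumes "continuous_functional E" "continuous_functional F"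
  shows "continuous_functional (\<lambda>f. E f - F f)"
proof -
  interpret E: continuous_functional E by fact
  interpret F: continuous_functional F by fact
  show ?thesis by unfold_locales (simp_all add: E.add F.add E.cmult F.cmult algebra_simps)
qed

lemma continuous_functional_scaled_sum: "continuous_functional (\<lambda>f. (\<Sum>z\<in>C. f z) / c)"
  by unfold_locales (simp_all add: sum.distrib add_divide_distrib sum_distrib_left mult.commute)

lemma continuous_functional_sphere_measure:
  "continuous_functional (integral\<^sup>L (sphere_measure :: 'a::euclidean_space measure))"
  by unfold_locales (simp_all add: integrable_sphere_measure)

lemma design_functionals_agree:
  fixes E F :: "(real ^ 'n \<Rightarrow> real) \<Rightarrow> real"
  assumes "design_functional E K" "design_functional F K" "E (\<lambda>z. 1) = F (\<lambda>z. 1)"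
    and p: "poly_fun_total_degree_le K p"
  shows "E p = F p"
proof -
  interpret E: design_functional E K by fact
  interpret F: design_functional F K by fact
  let ?D = "\<lambda>f. E f - F f"
  interpret D: continuous_functional ?D
    by (intro continuous_functional_diff E.continuous_functional_axioms F.continuous_functional_axioms)
  obtain c where "\<And>x. p x = (\<Sum>a\<in>{a. (\<Sum>i\<in>UNIV. a i) \<le> K}. c a * (\<Prod>i\<in>UNIV. (x $ i) ^ a i))"
    using p unfolding poly_fun_total_degree_le_def by blast
  then have p_eq: "p = (\<lambda>x. \<Sum>a\<in>{a. (\<Sum>i\<in>UNIV. a i) \<le> K}. c a * (\<Prod>i\<in>UNIV. (x $ i) ^ a i))" ..
  have "?D p = (\<Sum>a\<in>{a. (\<Sum>i\<in>UNIV. a i) \<le> K}. ?D (\<lambda>x. c a * (\<Prod>i\<in>UNIV. (x $ i) ^ a i)))"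
    unfolding p_eq by (intro D.sum) (auto intro!: continuous_intros)
  also have "\<dots> = 0"
  proof (rule sum.neutral, rule ballI)
    fix a :: "'n \<Rightarrow> nat" assume "a \<in> {a. (\<Sum>i\<in>UNIV. a i) \<le> K}"
    then have "?D (\<lambda>x. \<Prod>i\<in>UNIV. (x $ i) ^ a i) = 0"
      using E.moment_general F.moment_general assms(3)
      by (intro monomial_functional_eq_0[OF D.continuous_functional_axioms]) auto
    then show "?D (\<lambda>x. c a * (\<Prod>i\<in>UNIV. (x $ i) ^ a i)) = 0"
      by (subst D.cmult) (auto intro!: continuous_intros)
  qed
  finally show ?thesis by simp
qed

lemma coeff_even_quadratic_power: "coeff ([:1, 0, 1::real:] ^ j) 2 = real j"
proof (induction j)
  case (Suc j)
  have "coeff ([:1, 0, 1::real:] ^ j) 0 = 1" for j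
    by (simp add: poly_0_coeff_0[symmetric] poly_power)
  with Suc show ?case
    by (simp add: coeff_pCons numeral_2_eq_2)
qed simp

text \<open>Rotation invariance makes the moments independent of the unit vector. Their values
  follow by inserting 1 = |z|^2, as a sum of squared coordinates, into the moment two degrees
  lower.\<close>

lemma design_functional_sphere_measure:
  "design_functional (integral\<^sup>L (sphere_measure :: (real ^ 'n::{finite,wellorder}) measure)) K"
proof -
  let ?S = "sphere_measure :: (real ^ 'n::_) measure"
  let ?r = "real DIM((real, 'n) vec)"
  interpret continuous_functional "integral\<^sup>L ?S" by (rule continuous_functional_sphere_measure)
  interpret prob_space ?S by (rule prob_space_sphere_measure)
  have total: "integral\<^sup>L ?S (\<lambda>z. 1 :: real) = 1"
    using prob_space by simp
  have rot: "integral\<^sup>L ?S (\<lambda>z. h (f z)) = integral\<^sup>L ?S h"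
    if f: "orthogonal_transformation f" and h: "continuous_on UNIV h" for f and h :: "real ^ 'n::_ \<Rightarrow> real"
  proof -
    have "f \<in> borel_measurable borel"
      using orthogonal_transformation_linear[OF f]
      by (intro borel_measurable_continuous_onI linear_continuous_on linear_conv_bounded_linear[THEN iffD1])
    then have "f \<in> measurable ?S borel" by (simp add: measurable_def)
    then have "integral\<^sup>L (distr ?S borel f) h = integral\<^sup>L ?S (\<lambda>z. h (f z))"
      using h by (intro integral_distr) (auto intro: borel_measurable_continuous_onI)
    then show ?thesis by (simp add: sphere_measure_orthogonal[OF f])
  qed
  have unit: "integral\<^sup>L ?S (\<lambda>z. (u \<bullet> z) ^ k) = integral\<^sup>L ?S (\<lambda>z. (v \<bullet> z) ^ k)"
    if uv: "norm u = 1" "norm v = 1" for u v :: "real ^ 'n::_" and k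
  proof -
    obtain f where f: "orthogonal_transformation f" "f u = v"
      using orthogonal_transformation_exists_1[OF uv] .
    have "integral\<^sup>L ?S (\<lambda>z. (v \<bullet> z) ^ k) = integral\<^sup>L ?S (\<lambda>z. (f u \<bullet> f z) ^ k)"
      using rot[OF f(1), of "\<lambda>z. (v \<bullet> z) ^ k"] f(2) by (simp add: continuous_intros)
    also have "\<dots> = integral\<^sup>L ?S (\<lambda>z. (u \<bullet> z) ^ k)"
      using f(1) by (simp add: orthogonal_transformation_def)
    finally show ?thesis ..
  qed
  have "integral\<^sup>L ?S (\<lambda>z. (u \<bullet> z) ^ k) = sphere_moment ?r k" if u: "norm u = 1" for u :: "real ^ 'n::_" and k
    using u
  proof (induction k arbitrary: u rule: less_induct)
    case (less k u)
    show ?case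
    proof (cases "odd k")
      case True
      have "orthogonal_transformation (\<lambda>z::real ^ 'n::_. - z)"
        by (simp add: orthogonal_transformation_neg)
      from rot[OF this, of "\<lambda>z. (u \<bullet> z) ^ k"] True
      have "integral\<^sup>L ?S (\<lambda>z. (u \<bullet> z) ^ k) = 0"
        by (simp add: continuous_intros)
      with True show ?thesis by (simp add: sphere_moment_odd)
    next
      case even: False
      show ?thesis
      proof (cases "k = 0")
        case True
        with total show ?thesis by simp
      next
        case False
        with even obtain j where k: "k = 2 * Suc j"
          by (metis dvd_def mult_0_right not0_implies_Suc)
        define c where "c = integral\<^sup>L ?S (\<lambda>z. (u \<bullet> z) ^ k)"
        obtain b0 :: "real ^ 'n::_" where b0: "b0 \<in> Basis"
          using nonempty_Basis by blast
        have general: "integral\<^sup>L ?S (\<lambda>z. (v \<bullet> z) ^ k) = c * (v \<bullet> v) ^ Suc j" for v :: "real ^ 'n::_"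
        proof -
          have "integral\<^sup>L ?S (\<lambda>z. (w \<bullet> z) ^ k) = c" if "norm w = 1" for w :: "real ^ 'n::_"
            unfolding c_def using that less.prems by (rule unit)
          then have "integral\<^sup>L ?S (\<lambda>z. (v \<bullet> z) ^ k) = c * norm v ^ k"
            by (rule scale_power) (simp_all add: k)
          then show ?thesis
            by (simp only: k power_mult power2_norm_eq_inner)
        qed
        \<comment> \<open>For orthonormal \<open>b0\<close> and \<open>b\<close> the squared norm of
          b0 + w b is 1 + w^2, so the mixed moment comes from the coefficient of w^2.\<close>
        have summand: "integral\<^sup>L ?S (\<lambda>z. (b0 \<bullet> z) ^ (2 * j) * (b \<bullet> z)\<^sup>2) = (if b = b0 then c else c / (2 * real j + 1))"
          if b: "b \<in> Basis" for b
        proof (cases "b = b0")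
          case True
          have "(b0 \<bullet> z) ^ (2 * j) * (b0 \<bullet> z)\<^sup>2 = (b0 \<bullet> z) ^ k" for z
            by (simp only: k power_add[symmetric]) simp
          with True general[of b0] b0 show ?thesis by (simp add: inner_same_Basis)
        next
          case False
          have "integral\<^sup>L ?S (\<lambda>z. (b0 \<bullet> z + w * (b \<bullet> z)) ^ k * 1) = poly (smult c ([:1, 0, 1:] ^ Suc j)) w" for w
            using general[of "b0 + w *\<^sub>R b"] b0 b False
            by (simp add: inner_left_distrib inner_right_distrib inner_Basis poly_power power2_eq_square
                     del: power_Suc)
          from coeff_functional[OF _ this, of 2]
          have "real (k choose 2) * integral\<^sup>L ?S (\<lambda>z. (b0 \<bullet> z) ^ (2 * j) * (b \<bullet> z)\<^sup>2) = c * real (Suc j)"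
            using coeff_even_quadratic_power[of "Suc j"] by (simp add: k del: power_Suc)
          moreover have "real (k choose 2) = real (Suc j) * (2 * real j + 1)"
            by (simp add: k choose_two field_simps)
          ultimately have "real (Suc j) * ((2 * real j + 1) * integral\<^sup>L ?S (\<lambda>z. (b0 \<bullet> z) ^ (2 * j) * (b \<bullet> z)\<^sup>2)) =
              real (Suc j) * c"
            by (simp only: mult_ac)
          then have "(2 * real j + 1) * integral\<^sup>L ?S (\<lambda>z. (b0 \<bullet> z) ^ (2 * j) * (b \<bullet> z)\<^sup>2) = c"
            by (simp only: mult_cancel_left of_nat_eq_0_iff) simp
          then show ?thesis using False by (simp add: field_simps)
        qed
        have "sphere_moment ?r (2 * j) = integral\<^sup>L ?S (\<lambda>z. (b0 \<bullet> z) ^ (2 * j))"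
          using less.IH[of "2 * j" b0] b0 k by simp
        also have "\<dots> = integral\<^sup>L ?S (\<lambda>z. \<Sum>b\<in>Basis. (b0 \<bullet> z) ^ (2 * j) * (b \<bullet> z)\<^sup>2)"
        proof (rule sphere_measure_integral_cong)
          fix z :: "real ^ 'n::_" assume "norm z = 1"
          then have "(\<Sum>b\<in>Basis. (b \<bullet> z)\<^sup>2) = 1"
            using euclidean_inner[of z z] by (simp add: norm_eq_1 power2_eq_square inner_commute)
          then show "(b0 \<bullet> z) ^ (2 * j) = (\<Sum>b\<in>Basis. (b0 \<bullet> z) ^ (2 * j) * (b \<bullet> z)\<^sup>2)"
            by (simp add: sum_distrib_left[symmetric])
        qed (intro continuous_intros)+
        also have "\<dots> = (\<Sum>b\<in>Basis. integral\<^sup>L ?S (\<lambda>z. (b0 \<bullet> z) ^ (2 * j) * (b \<bullet> z)\<^sup>2))"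
          by (intro sum continuous_intros)
        also have "\<dots> = (\<Sum>b\<in>Basis. if b = b0 then c else c / (2 * real j + 1))"
          by (intro sum.cong summand refl)
        \<comment> \<open>The basis vectors other than \<open>b0\<close> contribute equally, one
          less than the dimension of them; solving for \<open>c\<close> gives the recursion.\<close>
        also have "\<dots> = c + (\<Sum>b\<in>Basis - {b0}. c / (2 * real j + 1))"
          using b0 by (subst sum.remove[of _ b0]) auto
        also have "\<dots> = c * (?r + 2 * real j) / (2 * real j + 1)"
          using b0 DIM_positive[where 'a="(real, 'n) vec"]
          by (simp add: card_Diff_singleton of_nat_diff field_simps del: DIM_cart)
        finally have "c = (2 * real j + 1) / (?r + 2 * real j) * sphere_moment ?r (2 * j)"
        proof -
          assume "sphere_moment ?r (2 * j) = c * (?r + 2 * real j) / (2 * real j + 1)"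
          moreover have "?r + 2 * real j > 0" using DIM_positive[where 'a="(real, 'n) vec"] by linarith
          ultimately show ?thesis by (simp del: DIM_cart)
        qed
        then show ?thesis by (simp add: c_def k del: DIM_cart)
      qed
    qed
  qed
  with total show ?thesis
    by unfold_locales simp
qed


section \<open>The Golay code\<close>

lemma of_nat_23_eq_iff: "(of_nat m :: 23) = of_nat n \<longleftrightarrow> m mod 23 = n mod 23"
proof (induction m n rule: linorder_wlog)
  case (le m n)
  have "(of_nat m :: 23) = of_nat n \<longleftrightarrow> of_nat (n - m) = (0 :: 23)"
    using le by (auto simp: of_nat_diff)
  also have "\<dots> \<longleftrightarrow> 23 dvd n - m"
    by (simp add: of_nat_eq_0_iff_char_dvd)
  also have "\<dots> \<longleftrightarrow> m mod 23 = n mod 23"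
    using le by (metis mod_eq_dvd_iff_nat)
  finally show ?case .
qed (auto simp: eq_commute)

lemma ex_of_nat_23: "\<exists>k<23. (x :: 23) = of_nat k"
proof (cases x)
  case (of_int z)
  then show ?thesis by (intro exI[of _ "nat z"]) auto
qed

text \<open>Numbering the coordinates by 0, ..., 23 turns statements about the code into checks on
  lists of Booleans that can be evaluated.\<close>

definition proj_point :: "nat \<Rightarrow> 23 option" where
  "proj_point k = (if k < 23 then Some (of_nat k) else None)"

lemma bij_betw_proj_point: "bij_betw proj_point {..<24} UNIV"
proof (rule bij_betw_imageI)
  show "inj_on proj_point {..<24}"
    by (rule inj_onI) (auto simp: proj_point_def of_nat_23_eq_iff split: if_splits)
  show "proj_point ` {..<24} = UNIV"
  proof (intro equalityI subsetI UNIV_I)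
    fix x :: "23 option"
    show "x \<in> proj_point ` {..<24}"
    proof (cases x)
      case None
      then show ?thesis by (intro image_eqI[of _ _ 23]) (auto simp: proj_point_def)
    next
      case (Some y)
      moreover obtain k where "k < 23" "y = of_nat k" using ex_of_nat_23 by blast
      ultimately show ?thesis by (intro image_eqI[of _ _ k]) (auto simp: proj_point_def)
    qed
  qed
qed

lemma ex_proj_point: "\<exists>k<24. x = proj_point k"
proof -
  have "x \<in> proj_point ` {..<24}" using bij_betw_proj_point by (simp add: bij_betw_def)
  then show ?thesis by auto
qed

definition squares_mod_23 :: "nat list" where
  "squares_mod_23 = [1, 2, 3, 4, 6, 8, 9, 12, 13, 16, 18]"

text \<open>Entry \<open>k\<close> of generator \<open>a\<close>; column 23 is the point at infinity.\<close>
definition golay_entry :: "nat \<Rightarrow> nat \<Rightarrow> bool" where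
  "golay_entry a k \<longleftrightarrow> k = 23 \<or> (if a \<le> k then k - a else k + 23 - a) \<in> set squares_mod_23"

definition golay_rows :: "bool list list" where
  "golay_rows = map (\<lambda>a. map (golay_entry a) [0..<24]) [0..<23]"

definition count_True :: "bool list \<Rightarrow> nat" where "count_True bs = length (filter id bs)"

definition orth_rows :: "bool list list \<Rightarrow> bool" where
  "orth_rows rs \<longleftrightarrow> list_all (\<lambda>r. list_all (\<lambda>s. even (count_True (map2 (\<and>) r s))) rs) rs"

text \<open>Self-orthogonality is evaluated on generators only;
  \<open>golay_even_Int_generator\<close> extends it to the span.\<close>

lemma golay_rows_orthogonal: "orth_rows golay_rows" by code_simp

text \<open>Columns of a parity check matrix, cut down to the first 12 generators: by
  self-orthogonality every codeword selects columns with sum 0.\<close>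

definition golay_cols :: "bool list list" where
  "golay_cols = map (\<lambda>k. map (\<lambda>a. golay_entry a k) [0..<12]) [0..<24]"

definition pair_sums :: "bool list list \<Rightarrow> bool list list" where
  "pair_sums cs = map (\<lambda>(i, j). map2 (\<noteq>) (cs ! i) (cs ! j)) (concat (map (\<lambda>i. map (Pair i) [Suc i..<24]) [0..<24]))"

text \<open>Comparing all pairs of the 277 words would be too slow by rewriting; this splits on the leading bit.\<close>
fun radix_distinct :: "nat \<Rightarrow> bool list list \<Rightarrow> bool" where
  "radix_distinct n [] = True"
| "radix_distinct 0 (x # xs) = (xs = [])"
| "radix_distinct (Suc n) (x # xs) =
    (radix_distinct n (map tl (filter hd (x # xs))) \<and> radix_distinct n (map tl (filter (\<lambda>y. \<not> hd y) (x # xs))))"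

lemma distinct_partition:
  "distinct (filter P xs) \<Longrightarrow> distinct (filter (\<lambda>x. \<not> P x) xs) \<Longrightarrow> distinct xs"
  by (induction xs) (auto split: if_splits)

lemma radix_distinct:
  assumes "radix_distinct n xs" "\<forall>x\<in>set xs. length x = n"
  shows "distinct xs"
  using assms
proof (induction n xs rule: radix_distinct.induct)
  case (3 n x xs)
  have "distinct (filter hd (x # xs))" "distinct (filter (\<lambda>y. \<not> hd y) (x # xs))"
    using 3 by (auto simp: distinct_map)
  then show ?case by (rule distinct_partition)
qed simp_all

text \<open>Distinctness of the 276 sums of two columns rules out four columns with sum 0, hence
  codewords of weight 4. The added zero word rules out equal columns, hence points that no codeword
  separates.\<close>

lemma golay_pair_sums_distinct: "radix_distinct 12 (replicate 12 False # pair_sums golay_cols)" by code_simp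

lemma proj_point_mem_generator:
  assumes "k < 24" "a < 23"
  shows "proj_point k \<in> golay_generator (of_nat a) \<longleftrightarrow> golay_entry a k"
proof (cases "k = 23")
  case True
  then show ?thesis by (simp add: proj_point_def golay_generator_def golay_entry_def)
next
  case False
  then have k: "k < 23" using assms by simp
  have sq: "(\<lambda>j. j\<^sup>2 mod 23) ` {1..<23} = set squares_mod_23"
    by code_simp
  have "proj_point k \<in> golay_generator (of_nat a) \<longleftrightarrow> (\<exists>b::23. b \<noteq> 0 \<and> of_nat k = of_nat a + b\<^sup>2)"
    using k by (auto simp: proj_point_def golay_generator_def)
  also have "\<dots> \<longleftrightarrow> (\<exists>j\<in>{1..<23}. (of_nat k :: 23) = of_nat (a + j\<^sup>2))"
  proof (intro iffI; elim exE bexE conjE)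
    fix b :: 23 assume b: "b \<noteq> 0" "of_nat k = of_nat a + b\<^sup>2"
    obtain j where "j < 23" "b = of_nat j" using ex_of_nat_23 by blast
    with b show "\<exists>j\<in>{1..<23}. (of_nat k :: 23) = of_nat (a + j\<^sup>2)"
      by (intro bexI[of _ j]) (auto intro!: Suc_leI gr0I)
  next
    fix j :: nat assume j: "j \<in> {1..<23}" "(of_nat k :: 23) = of_nat (a + j\<^sup>2)"
    then have "(of_nat j :: 23) \<noteq> 0"
      using of_nat_23_eq_iff[of j 0] by auto
    with j show "\<exists>b::23. b \<noteq> 0 \<and> of_nat k = of_nat a + b\<^sup>2"
      by (intro exI[of _ "of_nat j"]) auto
  qed
  also have "\<dots> \<longleftrightarrow> (\<exists>j\<in>{1..<23}. k = (a + j\<^sup>2 mod 23) mod 23)"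
    using k by (simp only: of_nat_23_eq_iff) (simp add: mod_add_right_eq)
  also have "\<dots> \<longleftrightarrow> (\<exists>q\<in>set squares_mod_23. k = (a + q) mod 23)"
    unfolding sq[symmetric] by blast
  also have "\<dots> \<longleftrightarrow> golay_entry a k"
  proof -
    have "k = (a + q) mod 23 \<longleftrightarrow> (if a \<le> k then k - a else k + 23 - a) = q" if "q < 23" for q
      using k assms that by (auto simp: mod_if)
    moreover have "\<forall>q\<in>set squares_mod_23. q < 23" by (simp add: squares_mod_23_def)
    ultimately show ?thesis using k by (auto simp: golay_entry_def)
  qed
  finally show ?thesis .
qed

lemma ex_generator_index: "\<exists>a<23. golay_generator x = golay_generator (of_nat a)"
  using ex_of_nat_23[of x] by blast

lemma card_proj_points: "card {x. P x} = length (filter (\<lambda>k. P (proj_point k)) [0..<24])"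
proof -
  have "card {x. P x} = card (proj_point ` {k\<in>{..<24}. P (proj_point k)})"
    using bij_betw_proj_point by (intro arg_cong[of _ _ card]) (auto simp: bij_betw_def)
  also have "\<dots> = card {k\<in>{..<24}. P (proj_point k)}"
    using bij_betw_proj_point by (intro card_image) (auto simp: bij_betw_def inj_on_def)
  also have "{k\<in>{..<24}. P (proj_point k)} = set (filter (\<lambda>k. P (proj_point k)) [0..<24])"
    by auto
  also have "card \<dots> = length (filter (\<lambda>k. P (proj_point k)) [0..<24])"
    by (intro distinct_card) simp
  finally show ?thesis .
qed

lemma even_card_generator_Int: "even (card (golay_generator x \<inter> golay_generator y))"
proof -
  obtain a b where ab: "a < 23" "golay_generator x = golay_generator (of_nat a)"
      "b < 23" "golay_generator y = golay_generator (of_nat b)"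
    using ex_generator_index by metis
  have "golay_generator x \<inter> golay_generator y = {p. p \<in> golay_generator (of_nat a) \<and> p \<in> golay_generator (of_nat b)}"
    using ab by auto
  then have "card (golay_generator x \<inter> golay_generator y) =
      length (filter (\<lambda>k. golay_entry a k \<and> golay_entry b k) [0..<24])"
    using ab by (simp only: card_proj_points) (intro arg_cong[of _ _ length] filter_cong refl, simp add: proj_point_mem_generator)
  also have "\<dots> = count_True (map2 (\<and>) (map (golay_entry a) [0..<24]) (map (golay_entry b) [0..<24]))"
    by (simp add: count_True_def zip_map_map zip_same_conv_map filter_map o_def)
  also have "even \<dots>"
  proof -
    have "map (golay_entry a) [0..<24] \<in> set golay_rows" "map (golay_entry b) [0..<24] \<in> set golay_rows"
      using ab by (auto simp: golay_rows_def simp del: upt.simps)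
    then show ?thesis using golay_rows_orthogonal unfolding orth_rows_def list_all_iff by blast
  qed
  finally show ?thesis .
qed

lemma card_generator: "card (golay_generator x) = 12"
proof -
  obtain a where a: "a < 23" "golay_generator x = golay_generator (of_nat a)"
    using ex_generator_index by metis
  have "list_all (\<lambda>r. count_True r = 12) golay_rows" by code_simp
  then have "count_True (map (golay_entry a) [0..<24]) = 12"
    using a unfolding list_all_iff golay_rows_def by auto
  moreover have "card (golay_generator x) = count_True (map (golay_entry a) [0..<24])"
  proof -
    have "card (golay_generator x) = card {p. p \<in> golay_generator (of_nat a)}" using a by simp
    also have "\<dots> = length (filter (golay_entry a) [0..<24])"
      using a by (simp only: card_proj_points) (intro arg_cong[of _ _ length] filter_cong refl, simp add: proj_point_mem_generator)
    finally show ?thesis by (simp add: count_True_def filter_map o_def del: upt.simps)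
  qed
  ultimately show ?thesis by simp
qed

section \<open>Parity of intersections and divisibility of weights by 4\<close>

lemma card_sym_diff:
  fixes A B :: "'a::finite set"
  shows "card (sym_diff A B) + 2 * card (A \<inter> B) = card A + card B"
proof -
  have "card (sym_diff A B) = card (A - B) + card (B - A)"
    by (intro card_Un_disjoint) auto
  moreover have "card A = card (A - B) + card (A \<inter> B)" "card B = card (B - A) + card (A \<inter> B)"
    using card_Diff_subset_Int[of A B] card_Diff_subset_Int[of B A] card_mono[of A "A \<inter> B"] card_mono[of B "A \<inter> B"]
    by (auto simp: Int_commute)
  ultimately show ?thesis by simp
qed

lemma even_card_sym_diff_Int:
  fixes A B C :: "'a::finite set"
  shows "even (card (sym_diff A B \<inter> C)) \<longleftrightarrow> (even (card (A \<inter> C)) \<longleftrightarrow> even (card (B \<inter> C)))"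
proof -
  have "sym_diff A B \<inter> C = sym_diff (A \<inter> C) (B \<inter> C)" by auto
  then have "card (sym_diff A B \<inter> C) + 2 * card (A \<inter> C \<inter> (B \<inter> C)) = card (A \<inter> C) + card (B \<inter> C)"
    using card_sym_diff[of "A \<inter> C" "B \<inter> C"] by simp
  then show ?thesis by presburger
qed

text \<open>The parity of an intersection is additive under symmetric difference.\<close>

lemma golay_even_Int_generator: "W \<in> golay_code \<Longrightarrow> even (card (W \<inter> golay_generator x))"
  by (induction rule: golay_code.induct) (simp_all only: even_card_sym_diff_Int even_card_generator_Int, simp)

text \<open>Adding a generator changes the weight by 12 minus twice the size of the intersection,
  and that size is even.\<close>

lemma golay_doubly_even: "W \<in> golay_code \<Longrightarrow> 4 dvd card W"
proof (induction rule: golay_code.induct)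
  case (add W a)
  have "even (card (W \<inter> golay_generator a))" using golay_even_Int_generator add by blast
  then obtain t where "card (W \<inter> golay_generator a) = 2 * t" by blast
  then show ?case
    using add card_sym_diff[of W "golay_generator a"] card_generator[of a] by presburger
qed simp

lemma golay_sym_diff:
  assumes "V \<in> golay_code" "W \<in> golay_code"
  shows "sym_diff V W \<in> golay_code"
  using assms(2)
proof (induction rule: golay_code.induct)
  case zero
  then show ?case using assms(1) by simp
next
  case (add W a)
  have "sym_diff V (sym_diff W (golay_generator a)) = sym_diff (sym_diff V W) (golay_generator a)" by auto
  then show ?case using golay_code.add[OF add.IH] by simp
qed

text \<open>Index lists make membership of a point a parity count, so that particular codewords can
  be produced by evaluation.\<close>

definition golay_combination :: "nat list \<Rightarrow> 23 option set" where
  "golay_combination as = fold (\<lambda>a W. sym_diff W (golay_generator (of_nat a))) as {}"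

lemma golay_combination_in: "golay_combination as \<in> golay_code"
proof -
  have "W \<in> golay_code \<Longrightarrow> fold (\<lambda>a W. sym_diff W (golay_generator (of_nat a))) as W \<in> golay_code" for W
    by (induction as arbitrary: W) (simp_all add: golay_code.add)
  then show ?thesis by (simp add: golay_combination_def golay_code.zero)
qed

lemma mem_golay_combination:
  assumes "k < 24" "\<forall>a\<in>set as. a < 23"
  shows "proj_point k \<in> golay_combination as \<longleftrightarrow> odd (length (filter (\<lambda>a. golay_entry a k) as))"
proof -
  have "proj_point k \<in> fold (\<lambda>a W. sym_diff W (golay_generator (of_nat a))) as W \<longleftrightarrow>
      (proj_point k \<in> W \<longleftrightarrow> even (length (filter (\<lambda>a. golay_entry a k) as)))" for W
    using assms(2)
    by (induction as arbitrary: W) (auto simp: proj_point_mem_generator[OF assms(1)])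
  then show ?thesis by (simp add: golay_combination_def)
qed

text \<open>This is the sum of all 23 generators: a finite coordinate lies in 11 of them and
  infinity in all 23, both odd numbers.\<close>

lemma UNIV_in_golay: "UNIV \<in> golay_code"
proof -
  have "list_all (\<lambda>k. odd (length (filter (\<lambda>a. golay_entry a k) [0..<23]))) [0..<24]"
    by code_simp
  then have "proj_point k \<in> golay_combination [0..<23]" if "k < 24" for k
    using that by (subst mem_golay_combination) (auto simp: list_all_iff simp del: upt.simps)
  then have "golay_combination [0..<23] = UNIV"
    using bij_betw_proj_point by (force simp: bij_betw_def)
  then show ?thesis using golay_combination_in by metis
qed

lemma golay_Compl: "W \<in> golay_code \<Longrightarrow> - W \<in> golay_code"
proof -
  assume "W \<in> golay_code"
  then have "sym_diff UNIV W \<in> golay_code" by (intro golay_sym_diff UNIV_in_golay)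
  moreover have "sym_diff UNIV W = - W" by auto
  ultimately show ?thesis by simp
qed

text \<open>Generator sets whose sums are a unit vector on the coordinates \<open>0, \<dots>, 11\<close>.\<close>
definition systematic_combinations :: "nat list list" where
  "systematic_combinations =
    [[0, 3, 22], [0, 1, 4], [0, 12, 16, 18], [1, 13, 17, 19], [0, 5, 10, 12], [2, 9, 13], [3, 10, 14],
     [4, 11, 15], [0, 1, 2, 18], [12, 17, 20], [0, 12, 17, 19], [2, 21, 22]]"

text \<open>Projection to the coordinates 0, ..., 11 is onto: explicit codewords project to the
  singletons, and symmetric differences then reach every subset.\<close>

lemma card_golay_ge: "card golay_code \<ge> 4096"
proof -
  define P where "P = proj_point ` {..<12}"
  have cardP: "card P = 12"
    using bij_betw_proj_point unfolding P_def
    by (subst card_image) (auto simp: bij_betw_def intro: inj_on_subset)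
  have unit: "golay_combination (systematic_combinations ! p) \<inter> P = {proj_point p}" if p: "p < 12" for p
  proof -
    have "list_all (\<lambda>p. list_all (\<lambda>k. odd (length (filter (\<lambda>a. golay_entry a k) (systematic_combinations ! p))) = (k = p)) [0..<12]) [0..<12]"
      "list_all (\<lambda>p. list_all (\<lambda>a. a < 23) (systematic_combinations ! p)) [0..<12]"
      by code_simp+
    then have c: "odd (length (filter (\<lambda>a. golay_entry a k) (systematic_combinations ! p))) \<longleftrightarrow> k = p"
      and b: "\<forall>a\<in>set (systematic_combinations ! p). a < 23" if "k < 12" for k
      using p that by (auto simp: list_all_iff simp del: upt.simps)
    have "proj_point k \<in> golay_combination (systematic_combinations ! p) \<longleftrightarrow> k = p" if "k < 12" for k
      using mem_golay_combination[OF _ b[OF that], of k] c[OF that] that by simp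
    then show ?thesis using p by (auto simp: P_def)
  qed
  have "\<exists>W\<in>golay_code. W \<inter> P = S" if "S \<subseteq> P" for S
    using finite[of S] that
  proof (induction S rule: finite_induct)
    case empty
    then show ?case using golay_code.zero by auto
  next
    case (insert x S)
    then obtain W p where W: "W \<in> golay_code" "W \<inter> P = S" and p: "p < 12" "x = proj_point p"
      by (auto simp: P_def)
    have "sym_diff W (golay_combination (systematic_combinations ! p)) \<in> golay_code"
      by (intro golay_sym_diff W golay_combination_in)
    moreover have "sym_diff W (golay_combination (systematic_combinations ! p)) \<inter> P = insert x S"
    proof -
      have "sym_diff A B \<inter> P = sym_diff (A \<inter> P) (B \<inter> P)" for A B :: "23 option set" by auto
      then show ?thesis using unit[OF p(1)] W(2) p(2) insert.hyps(2) by auto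
    qed
    ultimately show ?case by blast
  qed
  then have "Pow P \<subseteq> (\<lambda>W. W \<inter> P) ` golay_code" by blast
  then have "card (Pow P) \<le> card golay_code"
    by (intro surj_card_le) simp
  then show ?thesis by (simp add: card_Pow cardP)
qed

section \<open>Separation of points and the possible weights\<close>

definition incidence :: "nat \<Rightarrow> bool list" where
  "incidence k = map (\<lambda>a. golay_entry a k) [0..<12]"

lemma length_incidence: "length (incidence k) = 12"
  by (simp add: incidence_def)

lemma pairs_distinct:
  defines "I \<equiv> {(i, j). i < j \<and> j < 24}"
  defines "S \<equiv> \<lambda>(i, j). map2 (\<noteq>) (incidence i) (incidence j)"
  shows "inj_on S I" "replicate 12 False \<notin> S ` I"
proof -
  let ?l = "concat (map (\<lambda>i. map (Pair i) [Suc i..<24]) [0..<24])"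
  have I: "I = set ?l" by (force simp: I_def simp del: upt.simps)
  have "pair_sums golay_cols = map S ?l"
    unfolding pair_sums_def
  proof (rule map_cong[OF refl])
    fix x assume "x \<in> set ?l"
    then obtain i j where x: "x = (i, j)" "i < 24" "j < 24" by (auto simp del: upt.simps)
    then show "(case x of (i, j) \<Rightarrow> map2 (\<noteq>) (golay_cols ! i) (golay_cols ! j)) = S x"
      by (simp add: S_def incidence_def golay_cols_def del: upt.simps)
  qed
  moreover have "\<forall>x\<in>set (replicate 12 False # map S ?l). length x = 12"
    by (auto simp: S_def incidence_def simp del: upt.simps)
  ultimately have "distinct (replicate 12 False # map S ?l)"
    using radix_distinct[OF golay_pair_sums_distinct] by metis
  then show "inj_on S I" "replicate 12 False \<notin> S ` I"
    unfolding I by (auto simp only: distinct.simps distinct_map set_map)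
qed

text \<open>Points lying in the same codewords would have equal columns, but no pair sum is
  zero.\<close>

lemma golay_separates:
  assumes "x \<noteq> y"
  shows "\<exists>V\<in>golay_code. x \<in> V \<longleftrightarrow> y \<notin> V"
proof (rule ccontr)
  assume neg: "\<not> (\<exists>V\<in>golay_code. x \<in> V \<longleftrightarrow> y \<notin> V)"
  obtain i j where ij: "i < 24" "j < 24" "x = proj_point i" "y = proj_point j"
    using ex_proj_point by metis
  have entry: "golay_entry a i = golay_entry a j" if "a < 12" for a
  proof -
    have "golay_generator (of_nat a) \<in> golay_code"
      using golay_code.add[OF golay_code.zero, of "of_nat a"] by simp
    then show ?thesis
      using neg ij that proj_point_mem_generator[of i a] proj_point_mem_generator[of j a] by auto
  qed
  then have "incidence i = incidence j" by (simp add: incidence_def)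
  then have "map2 (\<noteq>) (incidence i) (incidence j) = replicate 12 False"
    "map2 (\<noteq>) (incidence j) (incidence i) = replicate 12 False"
    by (simp_all add: zip_same_conv_map o_def map_replicate_const length_incidence)
  moreover have "i < j \<or> j < i" using assms ij by (metis linorder_neqE_nat)
  ultimately show False
    using pairs_distinct(2) ij by force
qed

text \<open>Each of the first 12 generators meets the word evenly, so the columns of its two
  smallest points and those of its two largest points have the same sum, against distinctness of
  pair sums.\<close>

lemma golay_card_ne_4:
  assumes W: "W \<in> golay_code"
  shows "card W \<noteq> 4"
proof
  assume "card W = 4"
  define J where "J = {k\<in>{..<24}. proj_point k \<in> W}"
  have inj: "inj_on proj_point {..<24}" using bij_betw_proj_point by (simp add: bij_betw_def)
  have WJ: "W = proj_point ` J"
    using bij_betw_proj_point by (auto simp: J_def bij_betw_def)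
  have Jlt: "m < 24" if "m \<in> J" for m using that by (simp add: J_def)
  have "card J = 4"
    using \<open>card W = 4\<close> inj unfolding WJ by (subst (asm) card_image) (auto simp: J_def intro: inj_on_subset)
  then have "length (sorted_list_of_set J) = 4" by simp
  moreover have "\<exists>i j k l. xs = [i, j, k, l]" if "length xs = 4" for xs :: "nat list"
    using that by (auto simp: length_Suc_conv numeral_eq_Suc)
  ultimately obtain i j k l where sl: "sorted_list_of_set J = [i, j, k, l]" by blast
  have fin: "finite J" by (simp add: J_def)
  have J: "J = {i, j, k, l}" using set_sorted_list_of_set[OF fin] sl by simp
  have "sorted_wrt (<) [i, j, k, l]" using sorted_list_of_set.strict_sorted_key_list_of_set[of J] sl by simp
  then have less: "i < j" "j < k" "k < l" by auto
  have l: "l < 24" using J by (auto simp: J_def)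
  have "golay_entry a i = golay_entry a j \<longleftrightarrow> golay_entry a k = golay_entry a l" if a: "a < 12" for a
  proof -
    have "card (W \<inter> golay_generator (of_nat a)) = card {m\<in>J. golay_entry a m}"
    proof -
      have "W \<inter> golay_generator (of_nat a) = proj_point ` {m\<in>J. golay_entry a m}"
        using a Jlt unfolding WJ by (auto simp: proj_point_mem_generator)
      then show ?thesis
        using inj Jlt by (auto intro!: card_image intro: inj_on_subset)
    qed
    then have "even (card {m\<in>J. golay_entry a m})"
      using golay_even_Int_generator[OF W] by metis
    also have "card {m\<in>J. golay_entry a m} = (\<Sum>m\<in>J. if golay_entry a m then 1 else 0)"
      using fin by (simp add: sum.If_cases Int_def)
    also have "\<dots> = (if golay_entry a i then 1 else 0) + (if golay_entry a j then 1 else 0) +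
        (if golay_entry a k then 1 else 0) + (if golay_entry a l then 1 else (0::nat))"
      using less by (simp add: J)
    finally show ?thesis by (auto split: if_splits)
  qed
  then have "map2 (\<noteq>) (incidence i) (incidence j) = map2 (\<noteq>) (incidence k) (incidence l)"
    unfolding incidence_def map2_map_map by (intro map_cong refl) auto
  then have "(i, j) = (k, l)"
    using less l by (intro inj_onD[OF pairs_distinct(1)]) auto
  then show False using less by simp
qed

lemma card_Compl_24: "card (- W :: 23 option set) = 24 - card W"
  by (simp add: Compl_eq_Diff_UNIV card_Diff_subset card_UNIV_option)

text \<open>Among the multiples of 4, weight 4 is excluded directly and weight 20 by
  complementation.\<close>

lemma golay_weights:
  assumes W: "W \<in> golay_code"
  shows "card W \<in> {0, 8, 12, 16, 24}"
proof -
  have univ: "CARD(23 option) = 24" by (simp add: card_UNIV_option)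
  have "card W \<le> 24" using card_mono[of UNIV W] univ by simp
  moreover have "4 dvd card W" using golay_doubly_even W .
  then obtain t where "card W = 4 * t" by blast
  moreover have "card W \<noteq> 4" using golay_card_ne_4 W .
  moreover have "card (- W) \<noteq> 4" using golay_card_ne_4 golay_Compl W by blast
  then have "card W \<noteq> 20" using card_Compl_24[of W] by simp
  ultimately have "t \<in> {0, 2, 3, 4, 6}" by (auto simp: le_Suc_eq) 
  then show ?thesis using \<open>card W = 4 * t\<close> by auto
qed

definition "octads = {W\<in>golay_code. card W = 8}"

text \<open>Since codewords separate points, the second moment of \<open>24 - 2 |W|\<close> over the code is \<open>24 |code|\<close>.\<close>
lemma card_octads: "128 * card octads + 1152 = 24 * card golay_code"
proof -
  let ?G = golay_code
  define sg :: "23 option \<Rightarrow> 23 option set \<Rightarrow> int" where "sg i W = (if i \<in> W then -1 else 1)" for i W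
  have univ: "CARD(23 option) = 24" by (simp add: card_UNIV_option)
  \<comment> \<open>Adding a codeword that contains exactly one of \<open>i\<close> and
    \<open>j\<close> permutes the code and flips the sign of every product.\<close>
  have orth: "(\<Sum>W\<in>?G. sg i W * sg j W) = (if i = j then int (card ?G) else 0)" for i j
  proof (cases "i = j")
    case True
    then show ?thesis by (simp add: sg_def if_distrib cong: if_cong)
  next
    case False
    then obtain V where V: "V \<in> ?G" "i \<in> V \<longleftrightarrow> j \<notin> V" using golay_separates by blast
    have inv: "sym_diff (sym_diff W V) V = W" for W by auto
    have "(\<Sum>W\<in>?G. sg i W * sg j W) = (\<Sum>W\<in>?G. sg i (sym_diff W V) * sg j (sym_diff W V))"
      using V golay_sym_diff inv
      by (intro sum.reindex_bij_witness[of _ "\<lambda>W. sym_diff W V" "\<lambda>W. sym_diff W V"]) auto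
    also have "\<dots> = (\<Sum>W\<in>?G. - (sg i W * sg j W))"
      using V(2) by (intro sum.cong refl) (auto simp: sg_def)
    finally show ?thesis using False by (simp add: sum_negf)
  qed
  have row: "(\<Sum>i\<in>UNIV. sg i W) = 24 - 2 * int (card W)" for W
  proof -
    have "(\<Sum>i\<in>UNIV. sg i W) = (\<Sum>i\<in>UNIV. 1 - 2 * (if i \<in> W then 1 else 0))"
      by (intro sum.cong refl) (simp add: sg_def)
    then show ?thesis
      by (simp add: sum_subtractf sum_distrib_left[symmetric] univ sum.If_cases)
  qed
  have "(\<Sum>W\<in>?G. (24 - 2 * int (card W))\<^sup>2) = (\<Sum>W\<in>?G. \<Sum>i\<in>UNIV. \<Sum>j\<in>UNIV. sg i W * sg j W)"
    by (simp only: row[symmetric] power2_eq_square sum_product)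
  also have "\<dots> = (\<Sum>i\<in>UNIV. \<Sum>j\<in>UNIV. \<Sum>W\<in>?G. sg i W * sg j W)"
    by (subst sum.swap, intro sum.cong refl, subst sum.swap, rule refl)
  also have "\<dots> = 24 * int (card ?G)"
    by (simp only: orth) (simp add: univ)
  finally have total: "(\<Sum>W\<in>?G. (24 - 2 * int (card W))\<^sup>2) = 24 * int (card ?G)" .
  define N where "N w = {W\<in>?G. card W = w}" for w
  have split: "?G = N 0 \<union> (N 8 \<union> (N 12 \<union> (N 16 \<union> N 24)))"
    using golay_weights by (auto simp: N_def)
  have sumN: "(\<Sum>W\<in>N w. (24 - 2 * int (card W))\<^sup>2) = (24 - 2 * int w)\<^sup>2 * int (card (N w))" for w
    by (simp add: N_def)
  \<comment> \<open>Weight 12 drops out because 24 - 2 w is 0 there, and complementation pairs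
    weight 16 with weight 8, so the octads are the only unknown.\<close>
  have "(\<Sum>W\<in>?G. (24 - 2 * int (card W))\<^sup>2) =
      576 * int (card (N 0)) + 64 * int (card (N 8)) + 64 * int (card (N 16)) + 576 * int (card (N 24))"
  proof -
    have "(\<Sum>W\<in>?G. (24 - 2 * int (card W))\<^sup>2) = (\<Sum>W\<in>N 0. (24 - 2 * int (card W))\<^sup>2) +
      ((\<Sum>W\<in>N 8. (24 - 2 * int (card W))\<^sup>2) + ((\<Sum>W\<in>N 12. (24 - 2 * int (card W))\<^sup>2) +
      ((\<Sum>W\<in>N 16. (24 - 2 * int (card W))\<^sup>2) + (\<Sum>W\<in>N 24. (24 - 2 * int (card W))\<^sup>2))))"
      unfolding split by (intro trans[OF sum.union_disjoint] arg_cong2[of _ _ _ _ "(+)"] refl finite) (auto simp: N_def)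
    then show ?thesis by (simp only: sumN) simp
  qed
  moreover have "N 0 = {{}}" by (auto simp: N_def golay_code.zero)
  moreover have "N 24 = {UNIV}"
    using card_eq_UNIV_imp_eq_UNIV[where 'a="23 option"] univ UNIV_in_golay by (auto simp: N_def)
  moreover have "card (N 16) = card (N 8)"
    using golay_Compl univ
    by (intro bij_betw_same_card[of uminus] bij_betw_byWitness[of _ uminus])
       (auto simp: N_def card_Compl_24)
  moreover have "N 8 = octads" by (simp add: N_def octads_def)
  ultimately show ?thesis using total by simp
qed


section \<open>Minimal vectors of the Leech lattice\<close>

lemma card_UNIV_24: "CARD(23 option) = 24"
  by (simp add: card_UNIV_option)

text \<open>Integer coordinates before division by sqrt 8. The residue \<open>m\<close> is a
  parameter so that it can be tracked through sums and differences.\<close>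

definition leech_coords :: "(23 option \<Rightarrow> int) \<Rightarrow> int \<Rightarrow> bool" where
  "leech_coords x m \<longleftrightarrow> (\<forall>i. x i mod 2 = m mod 2) \<and> {i. x i mod 4 \<noteq> m mod 4} \<in> golay_code \<and>
     (\<Sum>i\<in>UNIV. x i) mod 8 = (4 * m) mod 8"

lemma leech_coords_0: "leech_coords (\<lambda>i. 0) 0"
  by (simp add: leech_coords_def golay_code.zero)

text \<open>An entry of the right parity deviates from \<open>m\<close> modulo 4 by 0 or 2, and such
  deviations add like bits; hence the deviation sets combine by symmetric difference.\<close>

lemma leech_coords_diff:
  assumes x: "leech_coords x m" and y: "leech_coords y n"
  shows "leech_coords (\<lambda>i. x i - y i) (m - n)"
  unfolding leech_coords_def
proof (intro conjI allI)
  show "(x i - y i) mod 2 = (m - n) mod 2" for i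
    using x y unfolding leech_coords_def by (metis mod_diff_cong)
  have "{i. (x i - y i) mod 4 \<noteq> (m - n) mod 4} = sym_diff {i. x i mod 4 \<noteq> m mod 4} {i. y i mod 4 \<noteq> n mod 4}"
  proof -
    have "(x i - y i) mod 4 \<noteq> (m - n) mod 4 \<longleftrightarrow> \<not> (x i mod 4 \<noteq> m mod 4 \<longleftrightarrow> y i mod 4 \<noteq> n mod 4)" for i
    proof -
      have "2 dvd x i - m" "2 dvd y i - n"
        using x y unfolding leech_coords_def by (auto simp: mod_eq_dvd_iff)
      then obtain s t where st: "x i - m = 2 * s" "y i - n = 2 * t" by blast
      then have "x i - y i - (m - n) = 2 * (s - t)" by simp
      with st show ?thesis
        by (simp add: mod_eq_dvd_iff) presburger
    qed
    then show ?thesis by auto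
  qed
  then show "{i. (x i - y i) mod 4 \<noteq> (m - n) mod 4} \<in> golay_code"
    using x y golay_sym_diff unfolding leech_coords_def by simp
  have "((\<Sum>i\<in>UNIV. x i) - (\<Sum>i\<in>UNIV. y i)) mod 8 = (4 * m - 4 * n) mod 8"
    using x y unfolding leech_coords_def by (metis mod_diff_cong)
  then show "(\<Sum>i\<in>UNIV. x i - y i) mod 8 = 4 * (m - n) mod 8"
    by (simp add: sum_subtractf right_diff_distrib)
qed

lemma leech_coords_uminus:
  assumes "leech_coords x m"
  shows "leech_coords (\<lambda>i. - x i) (- m)"
  using leech_coords_diff[OF leech_coords_0 assms] by simp

lemma leech_coords_add:
  assumes "leech_coords x m" "leech_coords y n"
  shows "leech_coords (\<lambda>i. x i + y i) (m + n)"
  using leech_coords_diff[OF assms(1) leech_coords_uminus[OF assms(2)]] by simp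

lemma leech_coords_even:
  assumes x: "leech_coords x m" and m: "even m"
  shows "\<And>i. even (x i)" "{i. x i mod 4 = 2} \<in> golay_code" "8 dvd (\<Sum>i\<in>UNIV. x i)"
proof -
  have par: "x i mod 2 = m mod 2" for i using x by (simp add: leech_coords_def)
  show ev: "even (x i)" for i using par[of i] m by presburger
  have "m mod 4 = 0 \<or> m mod 4 = 2" using m by presburger
  then consider "m mod 4 = 0" | "m mod 4 = 2" by blast
  then show "{i. x i mod 4 = 2} \<in> golay_code"
  proof cases
    case 1
    have "(x i mod 4 = 2) = (x i mod 4 \<noteq> m mod 4)" for i unfolding 1 using ev[of i] by presburger
    then show ?thesis using x unfolding leech_coords_def by simp
  next
    \<comment> \<open>Here the entries that deviate from \<open>m\<close> are the multiples of 4, so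
      a complement has to be taken.\<close>
    case 2
    have "{i. x i mod 4 = 2} = - {i. x i mod 4 \<noteq> m mod 4}" using 2 by auto
    then show ?thesis using x golay_Compl unfolding leech_coords_def by simp
  qed
  have "(\<Sum>i\<in>UNIV. x i) mod 8 = (4 * m) mod 8" using x by (simp add: leech_coords_def)
  moreover have "(4 * m) mod 8 = 0" using m by presburger
  ultimately show "8 dvd (\<Sum>i\<in>UNIV. x i)" by (simp add: dvd_eq_mod_eq_0)
qed

lemma leech_coords_odd:
  assumes x: "leech_coords x m" and m: "odd m"
  shows "\<And>i. odd (x i)" "{i. x i mod 4 = 3} \<in> golay_code" "(\<Sum>i\<in>UNIV. x i) mod 8 = 4"
proof -
  have par: "x i mod 2 = m mod 2" for i using x by (simp add: leech_coords_def)
  show od: "odd (x i)" for i using par[of i] m by presburger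
  have "m mod 4 = 1 \<or> m mod 4 = 3" using m by presburger
  then consider "m mod 4 = 1" | "m mod 4 = 3" by blast
  then show "{i. x i mod 4 = 3} \<in> golay_code"
  proof cases
    case 1
    have "(x i mod 4 = 3) = (x i mod 4 \<noteq> m mod 4)" for i unfolding 1 using od[of i] by presburger
    then show ?thesis using x unfolding leech_coords_def by simp
  next
    case 2
    have "{i. x i mod 4 = 3} = - {i. x i mod 4 \<noteq> m mod 4}" using 2 by auto
    then show ?thesis using x golay_Compl unfolding leech_coords_def by simp
  qed
  have "(\<Sum>i\<in>UNIV. x i) mod 8 = (4 * m) mod 8" using x by (simp add: leech_coords_def)
  moreover have "(4 * m) mod 8 = 4" using m by presburger
  ultimately show "(\<Sum>i\<in>UNIV. x i) mod 8 = 4" by simp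
qed

lemma sum_of_bool_int: "(\<Sum>i\<in>UNIV. if P i then 1 else (0::int)) = int (card {i::'a::finite. P i})"
  by (simp add: sum.If_cases)

text \<open>This says that the lattice is even, squared norms being one eighth of these sums. For
  even \<open>m\<close>, each entry congruent to 2 modulo 4 adds 4 modulo 16, and the number of such
  entries is a multiple of 4. For odd \<open>m\<close>, entries have the form +-1 + 4 k with square
  1 + 8 k modulo 16.\<close>

lemma leech_coords_sum_squares_dvd:
  assumes x: "leech_coords x m"
  shows "16 dvd (\<Sum>i\<in>UNIV. (x i)\<^sup>2)"
proof (cases "even m")
  case True
  define S where "S = {i. x i mod 4 = 2}"
  have "16 dvd (x i)\<^sup>2 - 4 * (if x i mod 4 = 2 then 1 else 0)" for i
  proof (cases "x i mod 4 = 2")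
    case True
    then obtain k where "x i = 4 * k + 2" by (metis mult_div_mod_eq)
    then have "(x i)\<^sup>2 - 4 * (if x i mod 4 = 2 then 1 else 0) = 16 * (k\<^sup>2 + k)"
      using True by (simp add: power2_eq_square algebra_simps)
    then show ?thesis by simp
  next
    case False
    then have "x i mod 4 = 0" using leech_coords_even(1)[OF x True, of i] by presburger
    then obtain k where "x i = 4 * k" by (auto elim: dvdE simp: dvd_eq_mod_eq_0[symmetric])
    with False show ?thesis by (simp add: power2_eq_square)
  qed
  then have "16 dvd (\<Sum>i\<in>UNIV. (x i)\<^sup>2 - 4 * (if x i mod 4 = 2 then 1 else 0))"
    by (intro dvd_sum) auto
  also have "\<dots> = (\<Sum>i\<in>UNIV. (x i)\<^sup>2) - 4 * int (card S)"
    unfolding S_def sum_of_bool_int[symmetric] by (simp add: sum_subtractf sum_distrib_left)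
  finally have "16 dvd (\<Sum>i\<in>UNIV. (x i)\<^sup>2) - 4 * int (card S)" .
  moreover have "4 dvd card S" using golay_doubly_even leech_coords_even(2)[OF x True] by (simp add: S_def)
  then have "4 dvd int (card S)" by presburger
  ultimately show ?thesis by presburger
next
  case False
  define W where "W = {i. x i mod 4 = 3}"
  define e where "e i = 1 - 2 * (if x i mod 4 = 3 then 1 else (0::int))" for i
  define k where "k i = (x i - e i) div 4" for i
  have xe: "x i = e i + 4 * k i" for i
  proof -
    have "x i mod 4 = 1 \<or> x i mod 4 = 3" using leech_coords_odd(1)[OF x False, of i] by presburger
    then have "4 dvd x i - e i" unfolding e_def by (auto; presburger)
    then show ?thesis by (simp add: k_def)
  qed
  have sume: "(\<Sum>i\<in>UNIV. e i) = 24 - 2 * int (card W)"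
    unfolding e_def W_def sum_of_bool_int[symmetric]
    by (simp add: sum_subtractf sum_distrib_left card_UNIV_24)
  have "4 dvd card W" using golay_doubly_even leech_coords_odd(2)[OF x False] by (simp add: W_def)
  then obtain c where c: "card W = 4 * c" by blast
  have "(\<Sum>i\<in>UNIV. x i) = (\<Sum>i\<in>UNIV. e i) + 4 * (\<Sum>i\<in>UNIV. k i)"
    by (simp add: xe sum.distrib sum_distrib_left)
  then have "(24 - 8 * int c + 4 * (\<Sum>i\<in>UNIV. k i)) mod 8 = 4"
    using leech_coords_odd(3)[OF x False] sume c by simp
  \<comment> \<open>The sum condition modulo 8 makes the total of \<open>k\<close> odd, which turns
    24 + 8 times this total into a multiple of 16.\<close>
  then have odd: "odd (\<Sum>i\<in>UNIV. k i)" by presburger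
  have "16 dvd (x i)\<^sup>2 - 1 - 8 * k i" for i
  proof (cases "x i mod 4 = 3")
    case True
    then have e: "e i = -1" by (simp add: e_def)
    then have xk: "x i = 4 * k i - 1" using xe[of i] e by linarith
    then have "(x i)\<^sup>2 - 1 - 8 * k i = 16 * ((k i)\<^sup>2 - k i)"
      unfolding xk by (simp add: power2_eq_square algebra_simps)
    then show ?thesis by (rule dvdI)
  next
    case False
    then have e: "e i = 1" by (simp add: e_def)
    then have xk: "x i = 4 * k i + 1" using xe[of i] e by linarith
    then have "(x i)\<^sup>2 - 1 - 8 * k i = 16 * (k i)\<^sup>2"
      unfolding xk by (simp add: power2_eq_square algebra_simps)
    then show ?thesis by (rule dvdI)
  qed
  then have "16 dvd (\<Sum>i\<in>UNIV. (x i)\<^sup>2 - 1 - 8 * k i)"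
    by (intro dvd_sum) auto
  also have "\<dots> = (\<Sum>i\<in>UNIV. (x i)\<^sup>2) - 24 - 8 * (\<Sum>i\<in>UNIV. k i)"
    by (simp add: sum_subtractf sum_distrib_left card_UNIV_24)
  finally show ?thesis using odd by presburger
qed

text \<open>Either some entries are 2 modulo 4, and then at least 8 of them; or all entries are
  multiples of 4, and the sum condition excludes a single entry of size 4; or all are odd, which
  gives at least 24 and, by divisibility by 16, at least 32.\<close>

lemma leech_coords_sum_squares_ge:
  assumes x: "leech_coords x m" and nz: "x \<noteq> (\<lambda>i. 0)"
  shows "32 \<le> (\<Sum>i\<in>UNIV. (x i)\<^sup>2)"
proof (cases "even m")
  case True
  define S where "S = {i. x i mod 4 = 2}"
  show ?thesis
  proof (cases "S = {}")
    case False
    then have "card S > 0" by (simp add: card_gt_0_iff)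
    then have "card S \<ge> 8"
      using golay_weights[OF leech_coords_even(2)[OF x True]] by (auto simp: S_def)
    then have "32 \<le> (\<Sum>i\<in>S. 4::int)" by simp
    also have "\<dots> \<le> (\<Sum>i\<in>S. (x i)\<^sup>2)"
    proof (rule sum_mono)
      fix i assume "i \<in> S"
      then have "\<bar>x i\<bar> \<ge> 2" unfolding S_def mem_Collect_eq by presburger
      then have "2\<^sup>2 \<le> \<bar>x i\<bar>\<^sup>2" by (intro power_mono) auto
      then show "4 \<le> (x i)\<^sup>2" by simp
    qed
    also have "\<dots> \<le> (\<Sum>i\<in>UNIV. (x i)\<^sup>2)" by (intro sum_mono2) auto
    finally show ?thesis .
  next
    case empty: True
    define k where "k i = x i div 4" for i
    have xk: "x i = 4 * k i" for i
    proof -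
      have "x i mod 4 \<noteq> 2" using empty by (auto simp: S_def)
      then have "x i mod 4 = 0" using leech_coords_even(1)[OF x True, of i] by presburger
      then show ?thesis unfolding k_def by presburger
    qed
    have "(\<Sum>i\<in>UNIV. x i) = 4 * (\<Sum>i\<in>UNIV. k i)"
      by (simp add: xk sum_distrib_left)
    then have "even (\<Sum>i\<in>UNIV. k i)" using leech_coords_even(3)[OF x True] by presburger
    moreover have "2 dvd (\<Sum>i\<in>UNIV. (k i)\<^sup>2 - k i)" by (intro dvd_sum) simp
    ultimately have ev: "even (\<Sum>i\<in>UNIV. (k i)\<^sup>2)" by (simp add: sum_subtractf)
    obtain i where "x i \<noteq> 0" using nz by auto
    then have "(k i)\<^sup>2 > 0" using xk[of i] by simp
    also have "(k i)\<^sup>2 \<le> (\<Sum>i\<in>UNIV. (k i)\<^sup>2)" by (intro member_le_sum) auto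
    finally have "2 \<le> (\<Sum>i\<in>UNIV. (k i)\<^sup>2)" using ev by presburger
    moreover have "(\<Sum>i\<in>UNIV. (x i)\<^sup>2) = 16 * (\<Sum>i\<in>UNIV. (k i)\<^sup>2)"
      by (simp add: xk power_mult_distrib sum_distrib_left)
    ultimately show ?thesis by simp
  qed
next
  case False
  have "1 \<le> (x i)\<^sup>2" for i
  proof -
    have "x i \<noteq> 0" using leech_coords_odd(1)[OF x False, of i] by auto
    then have "0 < (x i)\<^sup>2" by simp
    then show ?thesis by linarith
  qed
  then have "(\<Sum>i\<in>(UNIV :: 23 option set). 1) \<le> (\<Sum>i\<in>UNIV. (x i)\<^sup>2)" by (intro sum_mono)
  then have "24 \<le> (\<Sum>i\<in>UNIV. (x i)\<^sup>2)" by (simp add: card_UNIV_24)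
  with leech_coords_sum_squares_dvd[OF x] show ?thesis by presburger
qed

definition minimal_coords :: "(23 option \<Rightarrow> int) set" where
  "minimal_coords = {x. (\<exists>m. leech_coords x m) \<and> (\<Sum>i\<in>UNIV. (x i)\<^sup>2) = 32}"

text \<open>With \<open>a\<close> the integer inner product, x - y and x + y have squared sums 64 -
  2 a and 64 + 2 a, which are multiples of 16 and either 0 or at least 32.\<close>

lemma minimal_coords_inner:
  assumes "x \<in> minimal_coords" "y \<in> minimal_coords"
  obtains b where "b \<in> {-4, -2, -1, 0, 1, 2, 4}" "(\<Sum>i\<in>UNIV. x i * y i) = 8 * b"
proof -
  obtain m n where x: "leech_coords x m" "(\<Sum>i\<in>UNIV. (x i)\<^sup>2) = 32"
    and y: "leech_coords y n" "(\<Sum>i\<in>UNIV. (y i)\<^sup>2) = 32"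
    using assms by (auto simp: minimal_coords_def)
  define a where "a = (\<Sum>i\<in>UNIV. x i * y i)"
  have d: "(\<Sum>i\<in>UNIV. (x i - y i)\<^sup>2) = 64 - 2 * a" "(\<Sum>i\<in>UNIV. (x i + y i)\<^sup>2) = 64 + 2 * a"
    using x(2) y(2)
    by (simp_all add: a_def power2_diff power2_sum sum.distrib sum_subtractf sum_distrib_left mult.assoc)
  have "16 dvd 64 - 2 * a"
    using leech_coords_sum_squares_dvd[OF leech_coords_diff[OF x(1) y(1)]] d by simp
  then have "8 dvd a" by presburger
  then obtain b where b: "a = 8 * b" by blast
  have "64 - 2 * a = 0 \<or> 64 - 2 * a \<ge> 32"
    using leech_coords_sum_squares_ge[OF leech_coords_diff[OF x(1) y(1)]] unfolding d
    by (cases "(\<lambda>i. x i - y i) = (\<lambda>i. 0)") (use d(1) in \<open>auto simp: fun_eq_iff\<close>)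
  moreover have "64 + 2 * a = 0 \<or> 64 + 2 * a \<ge> 32"
    using leech_coords_sum_squares_ge[OF leech_coords_add[OF x(1) y(1)]] unfolding d
    by (cases "(\<lambda>i. x i + y i) = (\<lambda>i. 0)") (use d(2) in \<open>auto simp: fun_eq_iff\<close>)
  ultimately have "b = 4 \<or> b = -4 \<or> (-2 \<le> b \<and> b \<le> 2)" using b by linarith
  then have "b \<in> {-4, -2, -1, 0, 1, 2, 4}" by auto
  with b that show thesis by (simp add: a_def)
qed

lemma finite_minimal_coords: "finite minimal_coords"
proof (rule finite_subset)
  show "minimal_coords \<subseteq> PiE UNIV (\<lambda>_. {-32..32})"
  proof
    fix x assume "x \<in> minimal_coords"
    then have s: "(\<Sum>i\<in>UNIV. (x i)\<^sup>2) = 32" by (simp add: minimal_coords_def)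
    have "\<bar>x i\<bar> \<le> 32" for i
    proof -
      have "\<bar>x i\<bar> \<le> (x i)\<^sup>2"
        using mult_left_mono[of 1 "\<bar>x i\<bar>" "\<bar>x i\<bar>"] by (cases "x i = 0") (auto simp: power2_eq_square)
      also have "\<dots> \<le> 32" unfolding s[symmetric] by (intro member_le_sum) auto
      finally show ?thesis .
    qed
    then show "x \<in> PiE UNIV (\<lambda>_. {-32..32})" by (auto simp: abs_le_iff) (smt (verit))
  qed
qed (auto intro: finite_PiE)


section \<open>The three shapes of minimal vectors\<close>

definition signed_set :: "int \<Rightarrow> 'i set \<Rightarrow> 'i set \<Rightarrow> 'i \<Rightarrow> int" where
  "signed_set c P B i = (if i \<in> B then - c else if i \<in> P then c else 0)"

lemma signed_set_sums:
  fixes P B :: "'i::finite set"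
  assumes "B \<subseteq> P"
  shows "(\<Sum>i\<in>UNIV. signed_set c P B i) = c * int (card P) - 2 * c * int (card B)"
    and "(\<Sum>i\<in>UNIV. (signed_set c P B i)\<^sup>2) = c\<^sup>2 * int (card P)"
proof -
  have "(\<Sum>i\<in>UNIV. signed_set c P B i) =
      (\<Sum>i\<in>UNIV. c * (if i \<in> P then 1 else 0) - 2 * c * (if i \<in> B then 1 else 0))"
    using assms by (intro sum.cong refl) (auto simp: signed_set_def)
  then show "(\<Sum>i\<in>UNIV. signed_set c P B i) = c * int (card P) - 2 * c * int (card B)"
    by (simp add: sum_subtractf sum_distrib_left[symmetric] sum_of_bool_int)
  have "(\<Sum>i\<in>UNIV. (signed_set c P B i)\<^sup>2) = (\<Sum>i\<in>UNIV. c\<^sup>2 * (if i \<in> P then 1 else 0))"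
    using assms by (intro sum.cong refl) (auto simp: signed_set_def)
  then show "(\<Sum>i\<in>UNIV. (signed_set c P B i)\<^sup>2) = c\<^sup>2 * int (card P)"
    by (simp add: sum_distrib_left[symmetric] sum_of_bool_int)
qed

lemma signed_set_inject:
  assumes "c > 0" "B \<subseteq> P" "B' \<subseteq> P'" "signed_set c P B = signed_set c P' B'"
  shows "P = P' \<and> B = B'"
proof -
  have "P = {i. signed_set c P B i \<noteq> 0}" "B = {i. signed_set c P B i < 0}"
    "P' = {i. signed_set c P' B' i \<noteq> 0}" "B' = {i. signed_set c P' B' i < 0}"
    using assms(1-3) by (auto simp: signed_set_def)
  then show ?thesis using assms(4) by metis
qed

text \<open>One entry +-3 and all others +-1. The shift by 4 at \<open>j\<close> keeps residues
  modulo 4, so \<open>W\<close> is the set of entries congruent to 3.\<close>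

definition odd_shape :: "'i set \<Rightarrow> 'i \<Rightarrow> 'i \<Rightarrow> int" where
  "odd_shape W j i = (if i \<in> W then -1 else 1) + (if i = j then (if i \<in> W then 4 else -4) else 0)"

lemma odd_shape_inject:
  assumes "odd_shape W j = odd_shape W' j'"
  shows "W = W' \<and> j = j'"
proof -
  have "W = {i. odd_shape W j i \<in> {-1, 3}}" "{j} = {i. \<bar>odd_shape W j i\<bar> = 3}" for W :: "'a set" and j
    by (auto simp: odd_shape_def split: if_splits)
  then show ?thesis using assms by (metis singleton_inject)
qed

lemma odd_shape_sums:
  fixes W :: "'i::finite set"
  shows "(\<Sum>i\<in>UNIV. odd_shape W j i) = int CARD('i) - 2 * int (card W) + (if j \<in> W then 4 else -4)"
    and "(\<Sum>i\<in>UNIV. (odd_shape W j i)\<^sup>2) = int CARD('i) + 8"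
proof -
  have "(\<Sum>i\<in>UNIV. odd_shape W j i) =
      (\<Sum>i\<in>UNIV. (1 - 2 * (if i \<in> W then 1 else 0)) + (if i = j then (if j \<in> W then 4 else -4) else 0))"
    by (intro sum.cong refl) (auto simp: odd_shape_def)
  also have "\<dots> = int CARD('i) - 2 * int (card W) + (if j \<in> W then 4 else -4)"
    by (simp only: sum.distrib sum_subtractf sum_distrib_left[symmetric] sum_of_bool_int) simp
  finally show "(\<Sum>i\<in>UNIV. odd_shape W j i) = int CARD('i) - 2 * int (card W) + (if j \<in> W then 4 else -4)" .
  have "(\<Sum>i\<in>UNIV. (odd_shape W j i)\<^sup>2) = (\<Sum>i\<in>UNIV. 1 + (if i = j then 8 else 0))"
    by (intro sum.cong refl) (auto simp: odd_shape_def)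
  then show "(\<Sum>i\<in>UNIV. (odd_shape W j i)\<^sup>2) = int CARD('i) + 8"
    by (simp add: sum.distrib)
qed

text \<open>Toggling a fixed element exchanges the even and the odd subsets.\<close>

lemma card_even_subsets:
  assumes "finite A" "A \<noteq> {}"
  shows "2 * card {B. B \<subseteq> A \<and> even (card B)} = 2 ^ card A"
proof -
  obtain a where a: "a \<in> A" using assms by blast
  let ?t = "\<lambda>B. if a \<in> B then B - {a} else insert a B"
  have par: "even (card (?t B)) \<longleftrightarrow> odd (card B)" if "B \<subseteq> A" for B
  proof -
    have "finite B" using that assms finite_subset by blast
    then show ?thesis using card_Suc_Diff1[of B a] by (cases "a \<in> B") auto
  qed
  have "bij_betw ?t {B. B \<subseteq> A \<and> even (card B)} {B. B \<subseteq> A \<and> odd (card B)}"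
  proof (rule bij_betw_byWitness[of _ ?t])
    show "\<forall>B\<in>{B. B \<subseteq> A \<and> even (card B)}. ?t (?t B) = B" "\<forall>B\<in>{B. B \<subseteq> A \<and> odd (card B)}. ?t (?t B) = B"
      by auto
    have sub: "?t B \<subseteq> A" if "B \<subseteq> A" for B using a that by auto
    show "?t ` {B. B \<subseteq> A \<and> even (card B)} \<subseteq> {B. B \<subseteq> A \<and> odd (card B)}"
      "?t ` {B. B \<subseteq> A \<and> odd (card B)} \<subseteq> {B. B \<subseteq> A \<and> even (card B)}"
      using par sub by (intro image_subsetI CollectI conjI; simp only: mem_Collect_eq; blast)+
  qed
  then have "card {B. B \<subseteq> A \<and> even (card B)} = card {B. B \<subseteq> A \<and> odd (card B)}"
    by (rule bij_betw_same_card)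
  moreover have "Pow A = {B. B \<subseteq> A \<and> even (card B)} \<union> {B. B \<subseteq> A \<and> odd (card B)}" by auto
  then have "card (Pow A) = card {B. B \<subseteq> A \<and> even (card B)} + card {B. B \<subseteq> A \<and> odd (card B)}"
    using assms by (simp only:) (intro card_Un_disjoint, auto)
  ultimately show ?thesis using assms by (simp add: card_Pow)
qed

text \<open>The coordinate sum is 16 - 4 |B|, a multiple of 8 exactly when |B| is even.\<close>

lemma signed_octad_minimal:
  assumes P: "P \<in> octads" and B: "B \<subseteq> P" "even (card B)"
  shows "signed_set 2 P B \<in> minimal_coords"
proof -
  have P': "P \<in> golay_code" "card P = 8" using P by (auto simp: octads_def)
  have "leech_coords (signed_set 2 P B) 0"
    unfolding leech_coords_def
  proof (intro conjI allI)
    show "signed_set 2 P B i mod 2 = 0 mod 2" for i by (simp add: signed_set_def)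
    have "{i. signed_set 2 P B i mod 4 \<noteq> 0 mod 4} = P" using B(1) by (auto simp: signed_set_def)
    then show "{i. signed_set 2 P B i mod 4 \<noteq> 0 mod 4} \<in> golay_code" using P' by simp
    obtain t where "card B = 2 * t" using B(2) by blast
    then show "(\<Sum>i\<in>UNIV. signed_set 2 P B i) mod 8 = 4 * 0 mod 8"
      using P' by (simp add: signed_set_sums[OF B(1)])
  qed
  then show ?thesis
    using P' by (auto simp: minimal_coords_def signed_set_sums[OF B(1)])
qed

lemma signed_pair_minimal:
  assumes P: "card P = 2" and B: "B \<subseteq> P"
  shows "signed_set 4 P B \<in> minimal_coords"
proof -
  have "leech_coords (signed_set 4 P B) 0"
    unfolding leech_coords_def
  proof (intro conjI allI)
    show "signed_set 4 P B i mod 2 = 0 mod 2" for i by (simp add: signed_set_def)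
    have "{i. signed_set 4 P B i mod 4 \<noteq> 0 mod 4} = {}" by (auto simp: signed_set_def)
    then show "{i. signed_set 4 P B i mod 4 \<noteq> 0 mod 4} \<in> golay_code" using golay_code.zero by simp
    show "(\<Sum>i\<in>UNIV. signed_set 4 P B i) mod 8 = 4 * 0 mod 8"
      using P by (simp add: signed_set_sums[OF B])
  qed
  then show ?thesis
    using P by (auto simp: minimal_coords_def signed_set_sums[OF B])
qed

text \<open>The coordinate sum is 24 - 2 |W| plus or minus 4, and |W| is a multiple of 4.\<close>

lemma odd_shape_minimal:
  assumes W: "W \<in> golay_code"
  shows "odd_shape W j \<in> minimal_coords"
proof -
  have "leech_coords (odd_shape W j) 1"
    unfolding leech_coords_def
  proof (intro conjI allI)
    show "odd_shape W j i mod 2 = 1 mod 2" for i by (simp add: odd_shape_def)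
    have "{i. odd_shape W j i mod 4 \<noteq> 1 mod 4} = W" by (auto simp: odd_shape_def)
    then show "{i. odd_shape W j i mod 4 \<noteq> 1 mod 4} \<in> golay_code" using W by simp
    obtain t where "card W = 4 * t" using golay_doubly_even[OF W] by blast
    then show "(\<Sum>i\<in>UNIV. odd_shape W j i) mod 8 = 4 * 1 mod 8"
      by (cases "j \<in> W") (simp_all add: odd_shape_sums card_UNIV_24, presburger+)
  qed
  then show ?thesis
    by (auto simp: minimal_coords_def odd_shape_sums card_UNIV_24)
qed

text \<open>The octad, pair and odd shapes number 128 |octads|, 1104 and 24 |code|. By
  \<open>card_octads\<close> the total is 48 |code| - 48, so 4096 codewords give exactly this
  bound.\<close>

lemma card_minimal_coords_ge: "196560 \<le> card minimal_coords"
proof -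
  let ?I1 = "Sigma octads (\<lambda>P. {B. B \<subseteq> P \<and> even (card B)})"
  let ?I2 = "Sigma {P :: 23 option set. card P = 2} Pow"
  let ?I3 = "golay_code \<times> (UNIV :: 23 option set)"
  define F1 where "F1 = (\<lambda>(P, B). signed_set 2 P B) ` ?I1"
  define F2 where "F2 = (\<lambda>(P, B). signed_set 4 P B) ` ?I2"
  define F3 where "F3 = (\<lambda>(W, j). odd_shape W j) ` ?I3"
  have "card F1 = card ?I1"
    unfolding F1_def by (intro card_image inj_onI) (auto dest: signed_set_inject[rotated 3])
  also have "\<dots> = (\<Sum>P\<in>octads. card {B. B \<subseteq> P \<and> even (card B)})"
    by (intro card_SigmaI) auto
  also have "\<dots> = (\<Sum>P\<in>octads. 128)"
  proof (intro sum.cong refl)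
    fix P assume "P \<in> octads"
    then have "card P = 8" by (simp add: octads_def)
    moreover from this have "P \<noteq> {}" by auto
    ultimately show "card {B. B \<subseteq> P \<and> even (card B)} = 128"
      using card_even_subsets[of P] by simp
  qed
  finally have c1: "card F1 = 128 * card octads" by simp
  have "card F2 = card ?I2"
    unfolding F2_def by (intro card_image inj_onI) (auto dest: signed_set_inject[rotated 3])
  also have "\<dots> = (\<Sum>P\<in>{P :: 23 option set. card P = 2}. card (Pow P))"
    by (intro card_SigmaI) auto
  also have "\<dots> = (\<Sum>P\<in>{P :: 23 option set. card P = 2}. 4)"
    by (intro sum.cong refl) (simp add: card_Pow)
  also have "card {P :: 23 option set. card P = 2} = 24 choose 2"
    using n_subsets[of "UNIV :: 23 option set" 2] by (simp add: card_UNIV_24)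
  then have "(\<Sum>P\<in>{P :: 23 option set. card P = 2}. 4) = (1104::nat)"
    by (simp add: choose_two)
  finally have c2: "card F2 = 1104" .
  have "card F3 = card ?I3"
    unfolding F3_def by (intro card_image inj_onI) (auto dest: odd_shape_inject)
  then have c3: "card F3 = 24 * card golay_code"
    by (simp add: card_cartesian_product card_UNIV_24)
  have value1: "\<exists>i. x i = 2 \<or> x i = -2" and value1': "\<forall>i. x i \<in> {0, 2, -2}" if x: "x \<in> F1" for x
  proof -
    obtain P B where PB: "P \<in> octads" "B \<subseteq> P" "x = signed_set 2 P B" using x by (auto simp: F1_def)
    then have "P \<noteq> {}" by (auto simp: octads_def)
    then obtain i where "i \<in> P" by auto
    then show "\<exists>i. x i = 2 \<or> x i = -2"
      using PB by (intro exI[of _ i]) (auto simp: signed_set_def)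
    show "\<forall>i. x i \<in> {0, 2, -2}" using PB by (auto simp: signed_set_def)
  qed
  have value2: "\<forall>i. x i \<in> {0, 4, -4}" if "x \<in> F2" for x
    using that by (auto simp: F2_def signed_set_def split: if_splits)
  have value3: "\<forall>i. x i \<in> {1, -1, 3, -3}" if "x \<in> F3" for x
    using that by (auto simp: F3_def odd_shape_def split: if_splits)
  have "x \<notin> F2" if x: "x \<in> F1" for x
  proof
    assume "x \<in> F2"
    obtain i where i: "x i = 2 \<or> x i = -2" using value1[OF x] by blast
    have "x i \<in> {0, 4, -4}" using value2[OF \<open>x \<in> F2\<close>] by blast
    with i show False by auto
  qed
  then have "F1 \<inter> F2 = {}" by blast
  moreover have "x \<notin> F3" if x: "x \<in> F1 \<union> F2" for x
  proof
    assume "x \<in> F3"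
    fix i
    have "x i \<in> {1, -1, 3, -3}" using value3[OF \<open>x \<in> F3\<close>] by blast
    moreover have "x i \<in> {0, 2, -2} \<or> x i \<in> {0, 4, -4}" using x value1' value2 by blast
    ultimately show False by auto
  qed
  then have "(F1 \<union> F2) \<inter> F3 = {}" by blast
  moreover have "finite F1" "finite F2" "finite F3" by (auto simp: F1_def F2_def F3_def)
  ultimately have "card (F1 \<union> F2 \<union> F3) = card F1 + card F2 + card F3"
    by (simp add: card_Un_disjoint)
  then have "196560 \<le> card (F1 \<union> F2 \<union> F3)"
    using card_octads card_golay_ge c1 c2 c3 by linarith
  also have "F1 \<union> F2 \<union> F3 \<subseteq> minimal_coords"
    using signed_octad_minimal signed_pair_minimal odd_shape_minimal
    by (auto simp: F1_def F2_def F3_def)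
  then have "card (F1 \<union> F2 \<union> F3) \<le> card minimal_coords"
    by (intro card_mono finite_minimal_coords)
  finally show ?thesis .
qed

section \<open>Minimal vectors as points of the unit sphere\<close>

definition coords_vec :: "(23 option \<Rightarrow> int) \<Rightarrow> real ^ 23 option" where
  "coords_vec x = (\<chi> i. of_int (x i))"

lemma inner_coords_vec: "coords_vec x \<bullet> coords_vec y = of_int (\<Sum>i\<in>UNIV. x i * y i)"
  by (simp add: coords_vec_def inner_vec_def)

lemma norm_coords_vec: "(norm (coords_vec x))\<^sup>2 = of_int (\<Sum>i\<in>UNIV. (x i)\<^sup>2)"
  by (simp only: power2_norm_eq_inner inner_coords_vec) (simp add: power2_eq_square)

lemma coords_vec_inject: "coords_vec x = coords_vec y \<longleftrightarrow> x = y"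
  by (auto simp: coords_vec_def vec_eq_iff)

lemma leech_code_eq: "leech_code = (\<lambda>x. (1 / sqrt 32) *\<^sub>R coords_vec x) ` minimal_coords"
proof -
  have lattice: "leech_lattice = {(1 / sqrt 8) *\<^sub>R coords_vec x | x m. leech_coords x m}"
    by (simp add: leech_lattice_def leech_coords_def coords_vec_def)
  have "minimal_coords \<noteq> {}" using card_minimal_coords_ge by auto
  then obtain x0 m0 where x0: "leech_coords x0 m0" "(\<Sum>i\<in>UNIV. (x0 i)\<^sup>2) = 32"
    by (auto simp: minimal_coords_def)
  have nz: "(1 / sqrt 8) *\<^sub>R coords_vec x \<noteq> 0 \<longleftrightarrow> x \<noteq> (\<lambda>i. 0)" for x
    by (auto simp: coords_vec_def vec_eq_iff)
  have sq: "(norm ((1 / sqrt 8) *\<^sub>R coords_vec x))\<^sup>2 = of_int (\<Sum>i\<in>UNIV. (x i)\<^sup>2) / 8" for x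
    by (simp add: power_mult_distrib power_divide norm_coords_vec)
  have le: "norm ((1 / sqrt 8) *\<^sub>R coords_vec x) \<le> norm ((1 / sqrt 8) *\<^sub>R coords_vec y) \<longleftrightarrow>
      (\<Sum>i\<in>UNIV. (x i)\<^sup>2) \<le> (\<Sum>i\<in>UNIV. (y i)\<^sup>2)" for x y
  proof -
    have "norm ((1 / sqrt 8) *\<^sub>R coords_vec x) \<le> norm ((1 / sqrt 8) *\<^sub>R coords_vec y) \<longleftrightarrow>
        (norm ((1 / sqrt 8) *\<^sub>R coords_vec x))\<^sup>2 \<le> (norm ((1 / sqrt 8) *\<^sub>R coords_vec y))\<^sup>2"
      by (rule power_mono_iff[symmetric]) auto
    then show ?thesis unfolding sq by (simp del: of_int_sum add: divide_le_cancel)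
  qed
  have "minimal_vectors leech_lattice = (\<lambda>x. (1 / sqrt 8) *\<^sub>R coords_vec x) ` minimal_coords"
  proof (intro equalityI subsetI)
    fix v assume "v \<in> minimal_vectors leech_lattice"
    then obtain x m where v: "v = (1 / sqrt 8) *\<^sub>R coords_vec x" "leech_coords x m" "v \<noteq> 0"
      and min: "\<forall>w\<in>leech_lattice. w \<noteq> 0 \<longrightarrow> norm v \<le> norm w"
      unfolding minimal_vectors_def lattice by blast
    \<comment> \<open>Comparison with one known vector of squared sum 32 bounds every minimal vector
      from above.\<close>
    have "x0 \<noteq> (\<lambda>i. 0)" using x0(2) by auto
    then have "norm v \<le> norm ((1 / sqrt 8) *\<^sub>R coords_vec x0)"
      using min x0(1) nz unfolding lattice by blast
    then have "(\<Sum>i\<in>UNIV. (x i)\<^sup>2) \<le> 32" unfolding v(1) le x0(2) .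
    moreover have "32 \<le> (\<Sum>i\<in>UNIV. (x i)\<^sup>2)"
      using leech_coords_sum_squares_ge v nz by metis
    ultimately show "v \<in> (\<lambda>x. (1 / sqrt 8) *\<^sub>R coords_vec x) ` minimal_coords"
      using v by (auto simp: minimal_coords_def)
  next
    fix v assume "v \<in> (\<lambda>x. (1 / sqrt 8) *\<^sub>R coords_vec x) ` minimal_coords"
    then obtain x m where v: "v = (1 / sqrt 8) *\<^sub>R coords_vec x" "leech_coords x m"
        "(\<Sum>i\<in>UNIV. (x i)\<^sup>2) = 32"
      by (auto simp: minimal_coords_def)
    have "norm v \<le> norm w" if w: "w \<in> leech_lattice" "w \<noteq> 0" for w
    proof -
      obtain y n where y: "w = (1 / sqrt 8) *\<^sub>R coords_vec y" "leech_coords y n"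
        using w(1) unfolding lattice by blast
      show ?thesis
        using leech_coords_sum_squares_ge[OF y(2)] w(2) nz v unfolding y(1) v(1) le by metis
    qed
    moreover have "v \<in> leech_lattice" using v unfolding lattice by blast
    moreover have "v \<noteq> 0" using v(3) nz unfolding v(1) by fastforce
    ultimately show "v \<in> minimal_vectors leech_lattice" by (simp add: minimal_vectors_def)
  qed
  moreover have "sgn ((1 / sqrt 8) *\<^sub>R coords_vec x) = (1 / sqrt 32) *\<^sub>R coords_vec x" if "x \<in> minimal_coords" for x
  proof -
    have "(norm (coords_vec x))\<^sup>2 = 32" using that norm_coords_vec[of x] by (simp add: minimal_coords_def del: of_int_sum)
    then have "norm (coords_vec x) = sqrt 32" by (metis norm_ge_zero real_sqrt_unique)
    then show ?thesis by (simp add: sgn_scaleR sgn_div_norm divide_inverse)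
  qed
  ultimately show ?thesis
    unfolding leech_code_def by (auto simp: image_image)
qed

lemma finite_leech_code: "finite leech_code"
  unfolding leech_code_eq by (intro finite_imageI finite_minimal_coords)

lemma card_leech_code_ge: "196560 \<le> card leech_code"
proof -
  have "card leech_code = card minimal_coords"
    unfolding leech_code_eq by (intro card_image inj_onI) (simp add: coords_vec_inject)
  then show ?thesis using card_minimal_coords_ge by simp
qed

lemma leech_code_inner:
  assumes "x \<in> leech_code" "y \<in> leech_code"
  shows "x \<bullet> y \<in> {-1, -1/2, -1/4, 0, 1/4, 1/2, 1}"
proof -
  obtain x' y' where x: "x' \<in> minimal_coords" "x = (1 / sqrt 32) *\<^sub>R coords_vec x'"
    and y: "y' \<in> minimal_coords" "y = (1 / sqrt 32) *\<^sub>R coords_vec y'"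
    using assms unfolding leech_code_eq by blast
  obtain b where b: "b \<in> {-4, -2, -1, 0, 1, 2, 4}" "(\<Sum>i\<in>UNIV. x' i * y' i) = 8 * b"
    using minimal_coords_inner[OF x(1) y(1)] .
  have "x \<bullet> y = of_int (8 * b) / 32"
    unfolding x y by (simp add: inner_coords_vec b(2) del: of_int_sum)
  with b(1) show ?thesis by auto
qed

lemma leech_code_norm: "x \<in> leech_code \<Longrightarrow> norm x = 1"
proof -
  assume "x \<in> leech_code"
  then obtain x' where x: "x' \<in> minimal_coords" "x = (1 / sqrt 32) *\<^sub>R coords_vec x'"
    unfolding leech_code_eq by blast
  have "(norm x)\<^sup>2 = 1"
    using x(1) unfolding x(2) by (simp add: power_divide norm_coords_vec minimal_coords_def del: of_int_sum)
  then show ?thesis by (simp add: power2_eq_1_iff) (smt (verit) norm_ge_zero)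
qed

lemma leech_code_uminus: "x \<in> leech_code \<Longrightarrow> - x \<in> leech_code"
proof -
  assume "x \<in> leech_code"
  then obtain x' where x: "x' \<in> minimal_coords" "x = (1 / sqrt 32) *\<^sub>R coords_vec x'"
    unfolding leech_code_eq by blast
  have "(\<lambda>i. - x' i) \<in> minimal_coords"
    using x(1) leech_coords_uminus by (auto simp: minimal_coords_def)
  moreover have "- x = (1 / sqrt 32) *\<^sub>R coords_vec (\<lambda>i. - x' i)"
    unfolding x by (simp add: coords_vec_def vec_eq_iff)
  ultimately show ?thesis unfolding leech_code_eq by blast
qed


section \<open>The Leech code is an 11-design\<close>

text \<open>Unfolding a single step lets each row of the table below be computed from the two rows
  before it, so that the branching recursion is never fully expanded.\<close>

lemma zonal_moment_numeral:
  "zonal_moment r s (numeral n) b =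
     (real (pred_numeral n) * zonal_moment r s (pred_numeral n - 1) b +
      real b * s * zonal_moment r s (pred_numeral n) (b - 1)) / (r + real (pred_numeral n) + real b - 1)"
  by (simp only: numeral_eq_Suc zonal_moment.simps)

lemma sphere_moment_numeral:
  "sphere_moment r (numeral n) =
     real (pred_numeral n) / (r + real (pred_numeral n) - 1) * sphere_moment r (pred_numeral n - 1)"
  by (simp only: numeral_eq_Suc sphere_moment.simps)

lemma sphere_moment_24:
  "sphere_moment 24 2 = 1 / 24"
  "sphere_moment 24 4 = 1 / 208"
  "sphere_moment 24 6 = 5 / 5824"
  "sphere_moment 24 8 = 1 / 4992"
  "sphere_moment 24 10 = 3 / 53248"
  by (simp_all add: sphere_moment_numeral)

lemma zonal_moment_24_1:
  "zonal_moment 24 s (Suc 0) (Suc 0) = s / 24"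
  "zonal_moment 24 s (Suc 0) 3 = s / 208"
  "zonal_moment 24 s (Suc 0) 5 = 5 * s / 5824"
  "zonal_moment 24 s (Suc 0) 7 = s / 4992"
  "zonal_moment 24 s (Suc 0) 9 = 3 * s / 53248"
  by (simp_all add: sphere_moment_24)

lemma zonal_moment_24_2:
  "zonal_moment 24 s 2 2 = (1 + 2 * s ^ 2) / 624"
  "zonal_moment 24 s 2 4 = (1 + 4 * s ^ 2) / 5824"
  "zonal_moment 24 s 2 6 = (1 + 6 * s ^ 2) / 34944"
  "zonal_moment 24 s 2 8 = (1 + 8 * s ^ 2) / 159744"
  "zonal_moment 24 s 2 10 = (3 + 30 * s ^ 2) / 1810432"
  by (subst zonal_moment_numeral, simp add: sphere_moment_24 zonal_moment_24_1 power_numeral_reduce field_simps)+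

lemma zonal_moment_24_3:
  "zonal_moment 24 s 3 3 = (3 * s + 2 * s ^ 3) / 5824"
  "zonal_moment 24 s 3 5 = (3 * s + 4 * s ^ 3) / 34944"
  "zonal_moment 24 s 3 7 = (s + 2 * s ^ 3) / 53248"
  "zonal_moment 24 s 3 9 = (9 * s + 24 * s ^ 3) / 1810432"
  by (subst zonal_moment_numeral, simp add: sphere_moment_24 zonal_moment_24_1 zonal_moment_24_2 power_numeral_reduce field_simps)+

lemma zonal_moment_24_4:
  "zonal_moment 24 s 4 4 = (3 + 24 * s ^ 2 + 8 * s ^ 4) / 174720"
  "zonal_moment 24 s 4 6 = (1 + 12 * s ^ 2 + 8 * s ^ 4) / 372736"
  "zonal_moment 24 s 4 8 = (1 + 16 * s ^ 2 + 16 * s ^ 4) / 1810432"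
  "zonal_moment 24 s 4 10 = (3 + 60 * s ^ 2 + 80 * s ^ 4) / 21725184"
  by (subst zonal_moment_numeral, simp add: sphere_moment_24 zonal_moment_24_2 zonal_moment_24_3 power_numeral_reduce field_simps)+

lemma zonal_moment_24_5:
  "zonal_moment 24 s 5 5 = (15 * s + 40 * s ^ 3 + 8 * s ^ 5) / 1118208"
  "zonal_moment 24 s 5 7 = (5 * s + 20 * s ^ 3 + 8 * s ^ 5) / 1810432"
  "zonal_moment 24 s 5 9 = (15 * s + 80 * s ^ 3 + 48 * s ^ 5) / 21725184"
  by (subst zonal_moment_numeral, simp add: sphere_moment_24 zonal_moment_24_3 zonal_moment_24_4 power_numeral_reduce field_simps)+

lemma zonal_moment_24_6:
  "zonal_moment 24 s 6 6 = (5 + 90 * s ^ 2 + 120 * s ^ 4 + 16 * s ^ 6) / 12673024"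
  "zonal_moment 24 s 6 8 = (5 + 120 * s ^ 2 + 240 * s ^ 4 + 64 * s ^ 6) / 65175552"
  "zonal_moment 24 s 6 10 = (5 + 150 * s ^ 2 + 400 * s ^ 4 + 160 * s ^ 6) / 275185664"
  by (subst zonal_moment_numeral, simp add: sphere_moment_24 zonal_moment_24_4 zonal_moment_24_5 power_numeral_reduce field_simps)+

lemma zonal_moment_24_7:
  "zonal_moment 24 s 7 7 = (35 * s + 210 * s ^ 3 + 168 * s ^ 5 + 16 * s ^ 7) / 65175552"
  "zonal_moment 24 s 7 9 = (35 * s + 280 * s ^ 3 + 336 * s ^ 5 + 64 * s ^ 7) / 275185664"
  by (subst zonal_moment_numeral, simp add: sphere_moment_24 zonal_moment_24_5 zonal_moment_24_6 power_numeral_reduce field_simps)+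

lemma zonal_moment_24_8:
  "zonal_moment 24 s 8 8 = (35 + 1120 * s ^ 2 + 3360 * s ^ 4 + 1792 * s ^ 6 + 128 * s ^ 8) / 2476670976"
  "zonal_moment 24 s 8 10 = (7 + 280 * s ^ 2 + 1120 * s ^ 4 + 896 * s ^ 6 + 128 * s ^ 8) / 2201485312"
  by (subst zonal_moment_numeral, simp add: sphere_moment_24 zonal_moment_24_6 zonal_moment_24_7 power_numeral_reduce field_simps)+

lemma zonal_moment_24_9:
  "zonal_moment 24 s 9 9 = (315 * s + 3360 * s ^ 3 + 6048 * s ^ 5 + 2304 * s ^ 7 + 128 * s ^ 9) / 11007426560"
  by (subst zonal_moment_numeral, simp add: sphere_moment_24 zonal_moment_24_7 zonal_moment_24_8 power_numeral_reduce field_simps)+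

lemma zonal_moment_24_10:
  "zonal_moment 24 s 10 10 = (63 + 3150 * s ^ 2 + 16800 * s ^ 4 + 20160 * s ^ 6 + 5760 * s ^ 8 + 256 * s ^ 10) / 92462383104"
  by (subst zonal_moment_numeral, simp add: sphere_moment_24 zonal_moment_24_8 zonal_moment_24_9 power_numeral_reduce field_simps)+


text \<open>The average is unchanged when the two points are exchanged together with their
  exponents, so the table only lists pairs with \<open>a \<le> b\<close>.\<close>

definition zonal_moment_sym :: "real \<Rightarrow> real \<Rightarrow> nat \<Rightarrow> nat \<Rightarrow> real" where
  "zonal_moment_sym r s a b = zonal_moment r s (min a b) (max a b)"

lemma sphere_zonal_moment:
  fixes x y :: "real ^ 'n::{finite,wellorder}"
  assumes "norm x = 1" "norm y = 1"
  shows "integral\<^sup>L sphere_measure (\<lambda>z. (x \<bullet> z) ^ a * (y \<bullet> z) ^ b) = zonal_moment_sym (real CARD('n)) (x \<bullet> y) a b"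
proof -
  let ?S = "sphere_measure :: (real ^ 'n::_) measure"
  interpret design_functional "integral\<^sup>L ?S" "a + b" by (rule design_functional_sphere_measure)
  interpret prob_space ?S by (rule prob_space_sphere_measure)
  have one: "integral\<^sup>L ?S (\<lambda>z. 1 :: real) = 1" using prob_space by simp
  show ?thesis
  proof (cases "a \<le> b")
    case True
    then show ?thesis
      using zonal_moment[OF assms, of a b] one by (simp add: zonal_moment_sym_def)
  next
    case False
    then show ?thesis
      using zonal_moment[OF assms(2,1), of b a] one
      by (simp add: zonal_moment_sym_def mult.commute inner_commute)
  qed
qed

text \<open>Coefficient lists in \<open>t\<^sup>2\<close>, so that averages of products of two zonal
  polynomials unfold by list recursion into table entries.\<close>

fun even_poly :: "real list \<Rightarrow> real \<Rightarrow> real" where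
  "even_poly [] t = 0"
| "even_poly (c # cs) t = c + t\<^sup>2 * even_poly cs t"

lemma continuous_on_even_poly [continuous_intros]:
  "continuous_on A f \<Longrightarrow> continuous_on A (\<lambda>z. even_poly cs (f z))"
  by (induction cs) (auto intro!: continuous_intros)

fun even_poly_moment :: "real \<Rightarrow> real \<Rightarrow> nat \<Rightarrow> real list \<Rightarrow> nat \<Rightarrow> real" where
  "even_poly_moment r s a [] b = 0"
| "even_poly_moment r s a (c # cs) b = c * zonal_moment_sym r s a b + even_poly_moment r s (a + 2) cs b"

fun even_poly_convolution :: "real \<Rightarrow> real \<Rightarrow> real list \<Rightarrow> nat \<Rightarrow> real list \<Rightarrow> real" where
  "even_poly_convolution r s cs b [] = 0"
| "even_poly_convolution r s cs b (d # ds) = d * even_poly_moment r s 0 cs b + even_poly_convolution r s cs (b + 2) ds"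

lemma sphere_even_poly_moment:
  fixes x y :: "real ^ 'n::{finite,wellorder}"
  assumes "norm x = 1" "norm y = 1"
  shows "integral\<^sup>L sphere_measure (\<lambda>z. (x \<bullet> z) ^ a * even_poly cs (x \<bullet> z) * (y \<bullet> z) ^ b) =
    even_poly_moment (real CARD('n)) (x \<bullet> y) a cs b"
proof (induction cs arbitrary: a)
  case (Cons c cs)
  have "(x \<bullet> z) ^ a * even_poly (c # cs) (x \<bullet> z) * (y \<bullet> z) ^ b =
      c * ((x \<bullet> z) ^ a * (y \<bullet> z) ^ b) + (x \<bullet> z) ^ (a + 2) * even_poly cs (x \<bullet> z) * (y \<bullet> z) ^ b" for z
    by (simp add: algebra_simps power2_eq_square)
  then show ?case
    by (simp only: Cons.IH[symmetric] even_poly_moment.simps sphere_zonal_moment[OF assms, symmetric])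
       (subst Bochner_Integration.integral_add; simp add: integrable_sphere_measure continuous_intros)
qed simp

lemma sphere_even_poly_convolution:
  fixes x y :: "real ^ 'n::{finite,wellorder}"
  assumes "norm x = 1" "norm y = 1"
  shows "integral\<^sup>L sphere_measure (\<lambda>z. even_poly cs (x \<bullet> z) * ((y \<bullet> z) ^ b * even_poly ds (y \<bullet> z))) =
    even_poly_convolution (real CARD('n)) (x \<bullet> y) cs b ds"
proof (induction ds arbitrary: b)
  case (Cons d ds)
  have "even_poly cs (x \<bullet> z) * ((y \<bullet> z) ^ b * even_poly (d # ds) (y \<bullet> z)) =
      d * ((x \<bullet> z) ^ 0 * even_poly cs (x \<bullet> z) * (y \<bullet> z) ^ b) +
      even_poly cs (x \<bullet> z) * ((y \<bullet> z) ^ (b + 2) * even_poly ds (y \<bullet> z))" for z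
    by (simp add: algebra_simps power2_eq_square)
  then show ?case
    by (simp only: Cons.IH[symmetric] even_poly_convolution.simps sphere_even_poly_moment[OF assms, symmetric])
       (subst Bochner_Integration.integral_add; simp add: integrable_sphere_measure continuous_intros)
qed simp

lemmas zonal_moment_24 = zonal_moment_24_1 zonal_moment_24_2 zonal_moment_24_3 zonal_moment_24_4
  zonal_moment_24_5 zonal_moment_24_6 zonal_moment_24_7 zonal_moment_24_8 zonal_moment_24_9 zonal_moment_24_10

text \<open>The monic Gegenbauer polynomials of degrees 2, 4, 6, 8 and 10 in dimension 24, as coefficient
  lists in \<open>t\<^sup>2\<close>, with their eigenvalues under convolution on the sphere and their coefficients in
  the even part of the polynomial that is extremal for the kissing number in dimension 24.\<close>
definition gegen_24 :: "(real list \<times> real \<times> real) list" where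
  "gegen_24 =
    [([-1/24, 1], 1/312, 495/243712),
     ([3/728, -3/14, 1], 1/21840, 6927/139264),
     ([-1/1792, 3/64, -15/32, 1], 1/792064, 17747/43776),
     ([7/78336, -35/3264, 35/204, -7/9, 1], 1/19348992, 5/4),
     ([-21/1323008, 105/41344, -35/608, 63/152, -9/8, 1], 1/361181184, 1)]"

lemma gegen_24_pos: "(cs, a, c) \<in> set gegen_24 \<Longrightarrow> 0 < a \<and> 0 < c"
  by (auto simp: gegen_24_def)

text \<open>The Funk-Hecke formula for these five polynomials: convolving a zonal harmonic with
  itself reproduces it up to its eigenvalue. It is verified from the moment table.\<close>

lemma gegen_24_convolution:
  assumes "(cs, a, c) \<in> set gegen_24"
  shows "even_poly_convolution 24 s cs 0 cs = a * even_poly cs s"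
  using assms unfolding gegen_24_def list.set insert_iff empty_iff prod.inject
  by (elim disjE conjE FalseE; simp only:; simp add: zonal_moment_sym_def zonal_moment_24 sphere_moment_24
         distrib_left right_diff_distrib add_divide_distrib diff_divide_distrib power_add[symmetric]
       del: add_2_eq_Suc add_2_eq_Suc' zonal_moment.simps(2) sphere_moment.simps(2))

text \<open>The even part of (t + 1) (t + 1/2)^2 (t + 1/4)^2 t^2 (t - 1/4)^2 (t - 1/2); on an
  antipodal code the odd part cancels.\<close>

definition kissing_poly :: "real \<Rightarrow> real" where
  "kissing_poly t = t\<^sup>2 * (t\<^sup>2 + 1/2) * (t\<^sup>2 - 1/4) * (t\<^sup>2 - 1/16)\<^sup>2"

text \<open>The constant term is \<open>2 * kissing_poly 1 / 196560\<close>, which is what makes the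
  bound sharp.\<close>

lemma kissing_poly_expansion:
  "kissing_poly t = 15/1490944 + (\<Sum>(cs, a, c)\<leftarrow>gegen_24. c * even_poly cs t)"
  by (simp add: kissing_poly_def gegen_24_def field_simps power2_eq_square)

lemma leech_code_inner_1:
  assumes "x \<in> leech_code" "y \<in> leech_code"
  shows "x \<bullet> y = 1 \<longleftrightarrow> y = x" "x \<bullet> y = -1 \<longleftrightarrow> y = - x"
proof -
  have n: "x \<bullet> x = 1" "y \<bullet> y = 1" using assms leech_code_norm by (auto simp: norm_eq_1)
  have "(norm (x - y))\<^sup>2 = 2 - 2 * (x \<bullet> y)" "(norm (x + y))\<^sup>2 = 2 + 2 * (x \<bullet> y)"
    unfolding power2_norm_eq_inner using n by (simp_all add: inner_diff inner_add inner_commute algebra_simps)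
  then have "x \<bullet> y = 1 \<longleftrightarrow> (norm (x - y))\<^sup>2 = 0" "x \<bullet> y = -1 \<longleftrightarrow> (norm (x + y))\<^sup>2 = 0"
    by auto
  then show "x \<bullet> y = 1 \<longleftrightarrow> y = x" "x \<bullet> y = -1 \<longleftrightarrow> y = - x"
    by (auto simp: eq_neg_iff_add_eq_0 add.commute)
qed

text \<open>Serves twice: with constant \<open>g\<close> for the linear programming sum, and with
  powers of a linear form as \<open>g\<close> for the passage to the section.\<close>

lemma sum_leech_code_split:
  assumes x: "x \<in> leech_code" and f: "f (1/2) = 0" "f (-1/2) = 0" "f (1/4) = 0" "f (-1/4) = (0::real)"
  shows "(\<Sum>y\<in>leech_code. f (x \<bullet> y) * g y) = f 1 * g x + f (-1) * g (- x) + f 0 * (\<Sum>y\<in>leech_section x. g y)"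
proof -
  have xm: "- x \<in> leech_code" "x \<bullet> x = 1"
    using x leech_code_uminus leech_code_norm[of x] by (auto simp: norm_eq_1)
  have "x \<bullet> x \<noteq> x \<bullet> (- x)" using xm by simp
  then have ne: "x \<noteq> - x" by metis
  let ?R = "{y \<in> leech_code. x \<bullet> y \<notin> {1, -1, 0}}"
  have "leech_code = {x, -x} \<union> (leech_section x \<union> ?R)"
    using x xm leech_code_inner_1[OF x] by (auto simp: leech_section_def)
  moreover have "finite (leech_section x)" "finite ?R"
    using finite_leech_code by (auto simp: leech_section_def)
  moreover have "{x, -x} \<inter> (leech_section x \<union> ?R) = {}" "leech_section x \<inter> ?R = {}"
    using xm ne by (auto simp: leech_section_def)
  ultimately have "(\<Sum>y\<in>leech_code. f (x \<bullet> y) * g y) = (\<Sum>y\<in>{x, -x}. f (x \<bullet> y) * g y) +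
      ((\<Sum>y\<in>leech_section x. f (x \<bullet> y) * g y) + (\<Sum>y\<in>?R. f (x \<bullet> y) * g y))"
    by (metis (no_types, lifting) finite.emptyI finite_UnI finite_insert sum.union_disjoint)
  also have "(\<Sum>y\<in>?R. f (x \<bullet> y) * g y) = 0"
  proof (rule sum.neutral, rule ballI)
    fix y assume "y \<in> ?R"
    then have "x \<bullet> y \<in> {-1/2, -1/4, 1/4, 1/2}" using leech_code_inner[OF x, of y] by auto
    then show "f (x \<bullet> y) * g y = 0"
      by (elim insertE emptyE; simp only: f mult_zero_left)
  qed
  also have "(\<Sum>y\<in>leech_section x. f (x \<bullet> y) * g y) = f 0 * (\<Sum>y\<in>leech_section x. g y)"
    unfolding sum_distrib_left by (intro sum.cong refl) (simp add: leech_section_def)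
  also have "(\<Sum>y\<in>{x, -x}. f (x \<bullet> y) * g y) = f 1 * g x + f (-1) * g (- x)"
    using xm ne by simp
  finally show ?thesis by simp
qed

lemma leech_code_LP:
  shows "card leech_code = 196560"
    and "(cs, a, c) \<in> set gegen_24 \<Longrightarrow> norm z = 1 \<Longrightarrow> (\<Sum>x\<in>leech_code. even_poly cs (x \<bullet> z)) = 0"
proof -
  let ?L = leech_code
  let ?S = "sphere_measure :: (real ^ 23 option) measure"
  define N where "N = real (card ?L)"
  have N: "196560 \<le> N" using card_leech_code_ge by (simp add: N_def)
  define S where "S cs = (\<Sum>x\<in>?L. \<Sum>y\<in>?L. even_poly cs (x \<bullet> y))" for cs
  \<comment> \<open>The convolution formula turns the energy \<open>S cs\<close> into the integral
    of a square, which determines its sign.\<close>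
  have conv: "integral\<^sup>L ?S (\<lambda>z. (\<Sum>x\<in>?L. even_poly cs (x \<bullet> z))\<^sup>2) = a * S cs" if g: "(cs, a, c) \<in> set gegen_24" for cs a c
  proof -
    have "integral\<^sup>L ?S (\<lambda>z. (\<Sum>x\<in>?L. even_poly cs (x \<bullet> z))\<^sup>2) =
        integral\<^sup>L ?S (\<lambda>z. \<Sum>x\<in>?L. \<Sum>y\<in>?L. even_poly cs (x \<bullet> z) * ((y \<bullet> z) ^ 0 * even_poly cs (y \<bullet> z)))"
      by (simp add: power2_eq_square sum_product)
    also have "\<dots> = (\<Sum>x\<in>?L. \<Sum>y\<in>?L. integral\<^sup>L ?S (\<lambda>z. even_poly cs (x \<bullet> z) * ((y \<bullet> z) ^ 0 * even_poly cs (y \<bullet> z))))"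
      by (subst Bochner_Integration.integral_sum, intro integrable_sphere_measure continuous_intros,
          intro sum.cong refl Bochner_Integration.integral_sum integrable_sphere_measure continuous_intros)
    also have "\<dots> = (\<Sum>x\<in>?L. \<Sum>y\<in>?L. a * even_poly cs (x \<bullet> y))"
      using leech_code_norm gegen_24_convolution[OF g]
      by (intro sum.cong refl) (simp only: sphere_even_poly_convolution, simp add: card_UNIV_24)
    finally show ?thesis by (simp add: S_def sum_distrib_left)
  qed
  have S_nonneg: "0 \<le> S cs" if g: "(cs, a, c) \<in> set gegen_24" for cs a c
  proof -
    have "0 \<le> a * S cs" unfolding conv[OF g, symmetric] by (rule integral_nonneg_AE) simp
    then show ?thesis using gegen_24_pos[OF g] by (simp add: zero_le_mult_iff)
  qed
  \<comment> \<open>The double sum is evaluated twice: by inner products, where only y = x and y =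
    -x survive, and by the expansion.\<close>
  have "(\<Sum>x\<in>?L. \<Sum>y\<in>?L. kissing_poly (x \<bullet> y)) = (\<Sum>x\<in>?L. 2 * kissing_poly 1)"
  proof (intro sum.cong refl)
    fix x assume "x \<in> ?L"
    from sum_leech_code_split[OF this, of kissing_poly "\<lambda>_. 1"]
    show "(\<Sum>y\<in>?L. kissing_poly (x \<bullet> y)) = 2 * kissing_poly 1"
      by (simp add: kissing_poly_def power2_eq_square)
  qed
  also have "\<dots> = N * 2025 / 1024"
    by (simp add: kissing_poly_def N_def power2_eq_square)
  also have "(\<Sum>x\<in>?L. \<Sum>y\<in>?L. kissing_poly (x \<bullet> y)) =
      N\<^sup>2 * (15/1490944) + (\<Sum>(cs, a, c)\<leftarrow>gegen_24. c * S cs)"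
    by (simp add: kissing_poly_expansion gegen_24_def S_def N_def sum.distrib sum_distrib_left power2_eq_square
       del: even_poly.simps)
  finally have eq: "(\<Sum>(cs, a, c)\<leftarrow>gegen_24. c * S cs) = N * 15/1490944 * (196560 - N)"
    by (simp add: power2_eq_square field_simps)
  have nonneg: "0 \<le> (\<lambda>(cs, a, c). c * S cs) p" if "p \<in> set gegen_24" for p
  proof -
    obtain cs a c where "p = (cs, a, c)" by (cases p)
    then show ?thesis using that S_nonneg[of cs a c] gegen_24_pos[of cs a c] by simp
  qed
  have "0 \<le> (\<Sum>(cs, a, c)\<leftarrow>gegen_24. c * S cs)"
    by (intro sum_list_nonneg) (use nonneg in auto)
  then have "N \<le> 196560" using N unfolding eq by (simp add: zero_le_mult_iff)
  with N have N_eq: "N = 196560" by simp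
  then show "card leech_code = 196560" by (simp add: N_def)
  assume g: "(cs, a, c) \<in> set gegen_24" and z: "norm z = 1"
  have "(\<Sum>p\<leftarrow>gegen_24. (\<lambda>(cs, a, c). c * S cs) p) = 0" using eq N_eq by simp
  then have "\<forall>v\<in>set (map (\<lambda>(cs, a, c). c * S cs) gegen_24). v = 0"
    by (subst (asm) sum_list_nonneg_eq_0_iff) (use nonneg in auto)
  then have "c * S cs = 0" using g by force
  then have "S cs = 0" using gegen_24_pos[OF g] by simp
  then have "integral\<^sup>L ?S (\<lambda>z. (\<Sum>x\<in>?L. even_poly cs (x \<bullet> z))\<^sup>2) = 0"
    using conv[OF g] by simp
  moreover have "continuous_on UNIV (\<lambda>z. (\<Sum>x\<in>?L. even_poly cs (x \<bullet> z))\<^sup>2)"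
    by (intro continuous_intros)
  ultimately have "(\<Sum>x\<in>?L. even_poly cs (x \<bullet> z))\<^sup>2 = 0"
    using sphere_measure_integral_eq_0_imp[where h = "\<lambda>z. (\<Sum>x\<in>?L. even_poly cs (x \<bullet> z))\<^sup>2", OF _ _ _ z]
    by simp
  then show "(\<Sum>x\<in>?L. even_poly cs (x \<bullet> z)) = 0" by simp
qed

text \<open>Odd powers cancel in antipodal pairs, which includes degree 11. In even degrees the
  vanishing Gegenbauer sums form a triangular system for the power sums.\<close>

lemma leech_code_design: "design_functional (\<lambda>f. \<Sum>z\<in>leech_code. f z) 11"
proof -
  let ?L = leech_code
  interpret continuous_functional "\<lambda>f. \<Sum>z\<in>?L. f z"
    using continuous_functional_scaled_sum[of ?L 1] by simp
  have card: "real (card ?L) = 196560" using leech_code_LP(1) by simp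
  have "(\<Sum>z\<in>?L. (u \<bullet> z) ^ k) = sphere_moment 24 k * 196560" if k: "k \<le> 11" and u: "norm u = 1" for k u
  proof (cases "even k")
    case False
    have "(\<Sum>z\<in>?L. (u \<bullet> z) ^ k) = (\<Sum>z\<in>?L. (u \<bullet> (- z)) ^ k)"
      by (intro sum.reindex_bij_witness[of _ uminus uminus]) (auto simp: leech_code_uminus)
    also have "\<dots> = - (\<Sum>z\<in>?L. (u \<bullet> z) ^ k)"
      using False by (simp add: sum_negf)
    finally show ?thesis using False by (simp add: sphere_moment_odd)
  next
    case True
    define p where "p j = (\<Sum>z\<in>?L. (u \<bullet> z) ^ j)" for j
    have p0: "p 0 = 196560" by (simp add: p_def card)
    have expand: "(\<Sum>x\<in>?L. even_poly cs (x \<bullet> u)) = (\<Sum>(i, c)\<leftarrow>List.enumerate 0 cs. c * p (2 * i))" for cs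
    proof -
      have "(\<Sum>x\<in>?L. (x \<bullet> u) ^ (2 * n) * even_poly cs (x \<bullet> u)) = (\<Sum>(i, c)\<leftarrow>List.enumerate n cs. c * p (2 * i))" for n
      proof (induction cs arbitrary: n)
        case (Cons c cs)
        have "(x \<bullet> u) ^ (2 * n) * even_poly (c # cs) (x \<bullet> u) =
            c * (u \<bullet> x) ^ (2 * n) + (x \<bullet> u) ^ (2 * Suc n) * even_poly cs (x \<bullet> u)" for x
          by (simp add: inner_commute algebra_simps power2_eq_square)
        then show ?case
          using Cons.IH[of "Suc n"] by (simp add: sum.distrib p_def sum_distrib_left del: even_poly.simps)
      qed simp
      from this[of 0] show ?thesis by simp
    qed
    have "\<forall>(cs, a, c)\<in>set gegen_24. (\<Sum>(i, c)\<leftarrow>List.enumerate 0 cs. c * p (2 * i)) = 0"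
      using leech_code_LP(2)[OF _ u] unfolding expand by blast
    then have eqs: "- (1/24) * p 0 + p 2 = 0"
      "3/728 * p 0 - 3/14 * p 2 + p 4 = 0"
      "- (1/1792) * p 0 + 3/64 * p 2 - 15/32 * p 4 + p 6 = 0"
      "7/78336 * p 0 - 35/3264 * p 2 + 35/204 * p 4 - 7/9 * p 6 + p 8 = 0"
      "- (21/1323008) * p 0 + 105/41344 * p 2 - 35/608 * p 4 + 63/152 * p 6 - 9/8 * p 8 + p 10 = 0"
      unfolding gegen_24_def by (simp_all add: algebra_simps eval_nat_numeral)
    \<comment> \<open>Forward substitution from \<open>p 0\<close>; each value is 196560 times the
      sphere moment.\<close>
    have "p 2 = 8190" using eqs(1) p0 by linarith
    moreover from this have "p 4 = 945" using eqs(2) p0 by linarith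
    moreover from calculation have "p 6 = 675 / 4" using eqs(3) p0 by linarith
    moreover from calculation have "p 8 = 315 / 8" using eqs(4) p0 by linarith
    moreover from calculation have "p 10 = 3 / 53248 * 196560" using eqs(5) p0 by linarith
    moreover have "k = 0 \<or> k = 2 \<or> k = 4 \<or> k = 6 \<or> k = 8 \<or> k = 10" using k True by presburger
    ultimately have "p k = sphere_moment 24 k * 196560"
      using p0 by (elim disjE) (simp_all add: sphere_moment_24)
    then show ?thesis by (simp add: p_def)
  qed
  then show ?thesis
    by unfold_locales (simp add: card card_UNIV_24)
qed


section \<open>Gegenbauer polynomials\<close>

lemma poly_eq_sum_of_degrees:
  fixes P :: "nat \<Rightarrow> 'a::field poly"
  assumes P: "\<And>i. i < n \<Longrightarrow> degree (P i) = i \<and> P i \<noteq> 0"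
    and q: "degree q < n \<or> q = 0"
  shows "\<exists>c. q = (\<Sum>i<n. smult (c i) (P i))"
  using assms
proof (induction n arbitrary: q)
  case (Suc n)
  define b where "b = coeff q n / lead_coeff (P n)"
  have Pn: "degree (P n) = n" "coeff (P n) n \<noteq> 0"
    using Suc.prems(1)[of n] leading_coeff_0_iff[of "P n"] by auto
  have "degree (q - smult b (P n)) < n \<or> q - smult b (P n) = 0"
  proof -
    have "coeff (q - smult b (P n)) k = 0" if "k \<ge> n" for k
    proof (cases "k = n")
      case True
      then show ?thesis using Pn by (simp add: b_def)
    next
      case False
      then have "degree q < k \<or> q = 0" "degree (P n) < k" using that Suc.prems(2) Pn by auto
      then show ?thesis by (auto simp: coeff_eq_0)
    qed
    then show ?thesis by (metis leading_coeff_0_iff not_le)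
  qed
  then obtain c where c: "q - smult b (P n) = (\<Sum>i<n. smult (c i) (P i))"
    using Suc.IH[of "q - smult b (P n)"] Suc.prems(1) by auto
  have "q = (\<Sum>i<Suc n. smult ((c(n := b)) i) (P i))"
    using c by (simp add: diff_eq_eq)
  then show ?case by blast
qed simp

text \<open>Isolates the properties of the weighted integral on which existence and uniqueness of
  the normalized orthogonal sequence rest.\<close>

locale weighted_polys =
  fixes W :: "real poly \<Rightarrow> real"
  assumes W_add: "W (p + q) = W p + W q"
    and W_smult: "W (smult c p) = c * W p"
    and W_square_pos: "p \<noteq> 0 \<Longrightarrow> 0 < W (p * p)"
    and W_one_minus_square_pos: "p \<noteq> 0 \<Longrightarrow> 0 < W ([:1, -1:] * (p * p))"
begin

lemma W_0: "W 0 = 0"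
  using W_smult[of 0 0] by simp

lemma W_sum: "W (\<Sum>i\<in>A. f i) = (\<Sum>i\<in>A. W (f i))"
  by (induction A rule: infinite_finite_induct) (simp_all add: W_0 W_add)

lemma W_diff: "W (p - q) = W p - W q"
  using W_add[of p "smult (-1) q"] W_smult[of "-1" q] by simp

definition orthogonal_sequence :: "(nat \<Rightarrow> real poly) \<Rightarrow> bool" where
  "orthogonal_sequence P \<longleftrightarrow> (\<forall>i. degree (P i) = i \<and> poly (P i) 1 = 1) \<and> (\<forall>i j. i \<noteq> j \<longrightarrow> W (P i * P j) = 0)"

lemma orthogonal_sequenceD:
  assumes "orthogonal_sequence P"
  shows "degree (P i) = i" "poly (P i) 1 = 1" "P i \<noteq> 0" "i \<noteq> j \<Longrightarrow> W (P i * P j) = 0"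
proof -
  show "degree (P i) = i" "poly (P i) 1 = 1" "i \<noteq> j \<Longrightarrow> W (P i * P j) = 0"
    using assms unfolding orthogonal_sequence_def by blast+
  then show "P i \<noteq> 0" by auto
qed

lemma orthogonal_to_lower:
  assumes P: "\<And>i. i < n \<Longrightarrow> degree (P i) = i \<and> P i \<noteq> 0" and "\<And>j. j < n \<Longrightarrow> W (p * P j) = 0"
    and q: "degree q < n \<or> q = 0"
  shows "W (p * q) = 0"
proof -
  obtain c where "q = (\<Sum>i<n. smult (c i) (P i))"
    using poly_eq_sum_of_degrees[OF P q] by blast
  then show ?thesis
    using assms(2) by (simp add: sum_distrib_left W_sum W_smult)
qed

text \<open>Gram-Schmidt applied to the monomials.\<close>

lemma orthogonal_poly_exists:
  "\<exists>Q. degree Q = n \<and> Q \<noteq> 0 \<and> (\<forall>q. degree q < n \<or> q = 0 \<longrightarrow> W (Q * q) = 0)"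
proof (induction n rule: less_induct)
  case (less n)
  then obtain P where P: "\<And>i. i < n \<Longrightarrow> degree (P i) = i \<and> P i \<noteq> 0"
    and orth: "\<And>i q. i < n \<Longrightarrow> degree q < i \<or> q = 0 \<Longrightarrow> W (P i * q) = 0"
    by metis
  have orth2: "W (P i * P j) = 0" if "i < n" "j < n" "i \<noteq> j" for i j
    using orth[of i "P j"] orth[of j "P i"] P that by (metis linorder_neqE_nat mult.commute)
  define b where "b j = W (monom 1 n * P j) / W (P j * P j)" for j
  define Q where "Q = monom 1 n - (\<Sum>j<n. smult (b j) (P j))"
  have "coeff (\<Sum>j<n. smult (b j) (P j)) k = 0" if "k \<ge> n" for k
    using that P by (auto simp: coeff_sum intro!: sum.neutral coeff_eq_0)
  then have "coeff Q n = 1" "\<And>k. k > n \<Longrightarrow> coeff Q k = 0"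
    by (simp_all add: Q_def)
  then have "degree Q \<le> n" "n \<le> degree Q" "Q \<noteq> 0"
    by (auto intro: degree_le le_degree)
  then have "degree Q = n" "Q \<noteq> 0" by simp_all
  moreover have "W (Q * P i) = 0" if i: "i < n" for i
  proof -
    have "W (Q * P i) = W (monom 1 n * P i) - (\<Sum>j<n. b j * W (P j * P i))"
      by (simp add: Q_def left_diff_distrib W_diff sum_distrib_right W_sum W_smult)
    also have "(\<Sum>j<n. b j * W (P j * P i)) = (\<Sum>j<n. if j = i then b i * W (P i * P i) else 0)"
      using orth2 i by (intro sum.cong refl) auto
    also have "\<dots> = W (monom 1 n * P i)"
      using i W_square_pos[of "P i"] P[OF i] by (simp add: b_def)
    finally show ?thesis by simp
  qed
  then have "\<forall>q. degree q < n \<or> q = 0 \<longrightarrow> W (Q * q) = 0"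
    using orthogonal_to_lower[of n P] P by blast
  ultimately show ?case by blast
qed

text \<open>Cross-multiplying by leading coefficients gives a difference \<open>D\<close> of lower
  degree, which is therefore orthogonal to itself; the value at 1 then fixes the scale.\<close>

lemma orthogonal_sequence_unique:
  assumes P: "orthogonal_sequence P" and R: "orthogonal_sequence R"
  shows "P = R"
proof
  fix n
  have low: "W (S n * q) = 0" if "orthogonal_sequence S" "degree q < n \<or> q = 0" for S q
  proof (rule orthogonal_to_lower[of n S, OF _ _ that(2)])
    show "degree (S i) = i \<and> S i \<noteq> 0" for i using orthogonal_sequenceD(1,3)[OF that(1)] by blast
    show "W (S n * S j) = 0" if "j < n" for j
      using orthogonal_sequenceD(4)[OF \<open>orthogonal_sequence S\<close>, of n j] that by simp
  qed
  define D where "D = smult (lead_coeff (R n)) (P n) - smult (lead_coeff (P n)) (R n)"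
  have deg: "degree (P n) = n" "degree (R n) = n" using orthogonal_sequenceD(1) P R by blast+
  have "coeff D k = 0" if "k \<ge> n" for k
    using that deg by (cases "k = n") (auto simp: D_def coeff_eq_0)
  then have D: "degree D < n \<or> D = 0" by (metis leading_coeff_0_iff not_le)
  have "W (D * D) = lead_coeff (R n) * W (P n * D) - lead_coeff (P n) * W (R n * D)"
    by (subst (1) D_def) (simp add: left_diff_distrib W_diff W_smult)
  also have "\<dots> = 0" using low[OF P D] low[OF R D] by simp
  finally have "D = 0" using W_square_pos[of D] by fastforce
  then have eq: "smult (lead_coeff (R n)) (P n) = smult (lead_coeff (P n)) (R n)" by (simp add: D_def)
  then have "poly (smult (lead_coeff (R n)) (P n)) 1 = poly (smult (lead_coeff (P n)) (R n)) 1" by simp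
  then have "lead_coeff (R n) = lead_coeff (P n)" using orthogonal_sequenceD(2) P R by simp
  moreover have "lead_coeff (P n) \<noteq> 0" using orthogonal_sequenceD(3)[OF P] by simp
  ultimately show "P n = R n" using eq
    by (metis diff_eq_diff_eq diff_self smult_diff_right smult_eq_0_iff)
qed

text \<open>A polynomial orthogonal to all lower degrees cannot vanish at 1: otherwise it is orthogonal to
  its quotient \<open>g\<close> by \<open>1 - t\<close>, so that \<open>(1 - t) g\<^sup>2\<close> has integral 0.\<close>
lemma orthogonal_sequence_exists: "\<exists>P. orthogonal_sequence P"
proof -
  obtain Q where Q: "\<And>n. degree (Q n) = n" "\<And>n. Q n \<noteq> 0"
    and orth: "\<And>n q. degree q < n \<or> q = 0 \<Longrightarrow> W (Q n * q) = 0"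
    using orthogonal_poly_exists by metis
  have nz: "poly (Q n) 1 \<noteq> 0" for n
  proof
    assume "poly (Q n) 1 = 0"
    then obtain h where h: "Q n = [:-1, 1:] * h" by (metis dvdE poly_eq_0_iff_dvd)
    define g where "g = - h"
    have g: "Q n = [:1, -1:] * g" using h by (simp add: g_def)
    then have "g \<noteq> 0" using Q(2)[of n] by auto
    then have "degree (Q n) = Suc (degree g)" unfolding g by (subst degree_mult_eq) auto
    then have "W (Q n * g) = 0" using Q(1)[of n] by (intro orth) auto
    moreover have "[:1, -1:] * (g * g) = Q n * g" by (simp only: g mult.assoc)
    ultimately show False using W_one_minus_square_pos[OF \<open>g \<noteq> 0\<close>] by simp
  qed
  define P where "P n = smult (1 / poly (Q n) 1) (Q n)" for n
  have "W (P i * P j) = 0" if "i \<noteq> j" for i j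
  proof -
    have "W (Q i * Q j) = 0" using that orth[of "Q j" i] orth[of "Q i" j] Q(1)
      by (metis linorder_neqE_nat mult.commute)
    then show ?thesis by (simp add: P_def W_smult)
  qed
  then have "orthogonal_sequence P"
    using Q nz by (simp add: orthogonal_sequence_def P_def)
  then show ?thesis by blast
qed

lemma THE_orthogonal_sequence: "orthogonal_sequence (THE P. orthogonal_sequence P)"
  using orthogonal_sequence_exists orthogonal_sequence_unique by (metis theI)

end

text \<open>For dimension 23 the exponent (n - 3) / 2 is the integer 10, so the weight is a
  polynomial.\<close>

definition gegen_weight_23 :: "real poly \<Rightarrow> real" where
  "gegen_weight_23 p = integral {-1..1} (\<lambda>t. poly p t * (1 - t\<^sup>2) ^ 10)"

lemma one_minus_square_nonneg: "t \<in> {-1..1} \<Longrightarrow> 0 \<le> 1 - (t::real)\<^sup>2"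
  using abs_square_le_1[of t] by (auto simp: abs_le_iff)

lemma gegen_weight_23_integrable: "(\<lambda>t::real. poly p t * (1 - t\<^sup>2) ^ 10) integrable_on {-1..1}"
  by (intro integrable_continuous_real continuous_intros)

lemma gegen_weight_23_pos:
  assumes q: "q \<noteq> 0" and nonneg: "\<And>t. t \<in> {-1..1} \<Longrightarrow> 0 \<le> poly q t"
  shows "0 < gegen_weight_23 q"
proof -
  let ?f = "\<lambda>t. poly q t * (1 - t\<^sup>2) ^ 10"
  have f: "0 \<le> ?f t" if "t \<in> {-1..1}" for t
    using that nonneg one_minus_square_nonneg by (intro mult_nonneg_nonneg zero_le_power) auto
  have "gegen_weight_23 q \<ge> 0"
    unfolding gegen_weight_23_def by (rule integral_nonneg[OF gegen_weight_23_integrable f])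
  moreover have "gegen_weight_23 q \<noteq> 0"
  proof
    assume "gegen_weight_23 q = 0"
    then have hi: "(?f has_integral 0) (cbox (-1) 1)"
      using gegen_weight_23_integrable[of q] unfolding gegen_weight_23_def by (simp add: has_integral_integral)
    have "?f t = 0" if "t \<in> {-1..1}" for t
    proof (rule has_integral_0_cbox_imp_0[OF _ _ hi])
      show "continuous_on (cbox (-1) 1) ?f" by (intro continuous_intros)
    qed (use f that in \<open>auto simp: box_real\<close>)
    then have "poly q t = 0" if "t \<in> {-1<..<1}" for t
    proof -
      have "t\<^sup>2 < 1" using that by (simp add: abs_square_less_1 abs_less_iff)
      then have "(1 - t\<^sup>2) ^ 10 \<noteq> 0" by simp
      then show ?thesis using \<open>\<And>t. t \<in> {-1..1} \<Longrightarrow> ?f t = 0\<close>[of t] that by auto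
    qed
    then have "{-1<..<1} \<subseteq> {t. poly q t = 0}" by auto
    moreover have "infinite {-1<..<1::real}" by simp
    ultimately show False using poly_roots_finite[OF q] finite_subset by blast
  qed
  ultimately show ?thesis by simp
qed

interpretation gegen_23: weighted_polys gegen_weight_23
proof
  show "gegen_weight_23 (p + q) = gegen_weight_23 p + gegen_weight_23 q" for p q
    using gegen_weight_23_integrable[of p] gegen_weight_23_integrable[of q]
    by (simp add: gegen_weight_23_def distrib_right integral_add)
  show "gegen_weight_23 (smult c p) = c * gegen_weight_23 p" for c p
    by (simp add: gegen_weight_23_def mult.assoc)
  show "0 < gegen_weight_23 (p * p)" if "p \<noteq> 0" for p
    using that by (intro gegen_weight_23_pos) auto
  show "0 < gegen_weight_23 ([:1, -1:] * (p * p))" if "p \<noteq> 0" for p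
  proof (rule gegen_weight_23_pos)
    show "[:1, -1:] * (p * p) \<noteq> 0" using that by (simp only: mult_eq_0_iff) simp
    show "0 \<le> poly ([:1, -1:] * (p * p)) t" if "t \<in> {-1..1}" for t
    proof -
      have "poly ([:1, -1:] * (p * p)) t = (1 - t) * (poly p t)\<^sup>2"
        by (simp only: poly_mult power2_eq_square) simp
      then show ?thesis using that by simp
    qed
  qed
qed

lemma gegenbauer_23: "gegen_23.orthogonal_sequence (gegenbauer 23)"
proof -
  have "integral {-1..1} (\<lambda>t. poly (P i) t * poly (P j) t * (1 - t\<^sup>2) powr ((real 23 - 3) / 2)) =
      gegen_weight_23 (P i * P j)" for P :: "nat \<Rightarrow> real poly" and i j
    unfolding gegen_weight_23_def
  proof (rule integral_cong)
    fix t :: real assume "t \<in> {-1..1}"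
    then have "0 \<le> 1 - t\<^sup>2" by (rule one_minus_square_nonneg)
    \<comment> \<open>At the end points both powers are 0; elsewhere the base is positive and
      \<open>powr\<close> agrees with the natural power.\<close>
    then have "(1 - t\<^sup>2) powr ((real 23 - 3) / 2) = (1 - t\<^sup>2) ^ 10"
      by (cases "1 - t\<^sup>2 = 0") (simp_all add: powr_numeral)
    then show "poly (P i) t * poly (P j) t * (1 - t\<^sup>2) powr ((real 23 - 3) / 2) = poly (P i * P j) t * (1 - t\<^sup>2) ^ 10"
      by simp
  qed
  then have "gegenbauer 23 = (THE P. gegen_23.orthogonal_sequence P)"
    unfolding gegenbauer_def gegen_23.orthogonal_sequence_def by presburger
  then show ?thesis using gegen_23.THE_orthogonal_sequence by simp
qed

text \<open>Integrating the derivative of t^k (1 - t^2)^11, which vanishes at both ends, gives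
  exactly the recursion of \<open>sphere_moment\<close> in dimension 23.\<close>

lemma gegen_weight_23_monom:
  "gegen_weight_23 (monom 1 k) = sphere_moment 23 k * gegen_weight_23 1"
proof -
  define I where "I k = gegen_weight_23 (monom 1 k)" for k
  have ftc: "real k * I (k - 1) = (real k + 22) * I (k + 1)" for k
  proof -
    have "((\<lambda>t::real. real k * t ^ (k - 1) * (1 - t\<^sup>2) ^ 11 - 22 * t ^ (k + 1) * (1 - t\<^sup>2) ^ 10) has_integral
        (1 ^ k * (1 - 1\<^sup>2) ^ 11 - (-1) ^ k * (1 - (-1)\<^sup>2) ^ 11)) {-1..1}"
      by (rule fundamental_theorem_of_calculus)
         (auto intro!: derivative_eq_intros simp: has_real_derivative_iff_has_vector_derivative[symmetric] algebra_simps)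
    then have "((\<lambda>t::real. real k * t ^ (k - 1) * (1 - t\<^sup>2) ^ 11 - 22 * t ^ (k + 1) * (1 - t\<^sup>2) ^ 10) has_integral 0) {-1..1}"
      by simp
    moreover have "real k * t ^ (k - 1) * (1 - t\<^sup>2) ^ 11 - 22 * t ^ (k + 1) * (1 - t\<^sup>2) ^ 10 =
        real k * (poly (monom 1 (k - 1)) t * (1 - t\<^sup>2) ^ 10) - (real k + 22) * (poly (monom 1 (k + 1)) t * (1 - t\<^sup>2) ^ 10)" for t
    proof -
      have "real k * t ^ (k - 1) * ((1 - t\<^sup>2) * A) - 22 * t ^ (k + 1) * A =
          real k * (t ^ (k - 1) * A) - (real k + 22) * (t ^ (k + 1) * A)" for A
        by (cases k) (simp_all add: algebra_simps power2_eq_square)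
      moreover have "(1 - t\<^sup>2) ^ 11 = (1 - t\<^sup>2) * (1 - t\<^sup>2) ^ 10" by (simp add: power_numeral_reduce)
      ultimately show ?thesis by (simp only: poly_monom mult_1)
    qed
    ultimately have zero: "((\<lambda>t. real k * (poly (monom 1 (k - 1)) t * (1 - t\<^sup>2) ^ 10) - (real k + 22) * (poly (monom 1 (k + 1)) t * (1 - t\<^sup>2) ^ 10)) has_integral 0) {-1..1}"
      by simp
    have "((\<lambda>t. real k * (poly (monom 1 (k - 1)) t * (1 - t\<^sup>2) ^ 10) - (real k + 22) * (poly (monom 1 (k + 1)) t * (1 - t\<^sup>2) ^ 10)) has_integral
        (real k * I (k - 1) - (real k + 22) * I (k + 1))) {-1..1}"
      unfolding I_def gegen_weight_23_def
      by (intro has_integral_diff has_integral_mult_right integrable_integral gegen_weight_23_integrable)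
    from has_integral_unique[OF zero this] show ?thesis by simp
  qed
  have "I k = sphere_moment 23 k * I 0"
  proof (induction k rule: less_induct)
    case (less k)
    show ?case
    proof (cases k)
      case (Suc j)
      then have "I k = real j / (real j + 22) * I (j - 1)"
        using ftc[of j] by (simp add: field_simps)
      then show ?thesis using less[of "j - 1"] Suc by (simp add: add.commute)
    qed simp
  qed
  then show ?thesis by (simp add: I_def monom_0 one_pCons)
qed

text \<open>Integration against the weight kills every term but the constant one, and the moments of
  the weight turn the result into the spherical average of \<open>f\<close>.\<close>

lemma gegenbauer_expansion_23:
  "\<exists>c. gegenbauer_expansion 23 f c \<and> c 0 = (\<Sum>k\<le>degree f. coeff f k * sphere_moment 23 k)"
proof -
  let ?G = "gegenbauer 23"
  note G = gegen_23.orthogonal_sequenceD[OF gegenbauer_23]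
  have "degree f < Suc (degree f) \<or> f = 0" by simp
  then obtain b where b: "f = (\<Sum>i<Suc (degree f). smult (b i) (?G i))"
    using poly_eq_sum_of_degrees[of "Suc (degree f)" ?G f] G(1,3) by blast
  define c where "c i = (if i \<le> degree f then b i else 0)" for i
  have f: "f = (\<Sum>i\<le>degree f. smult (c i) (?G i))"
    using b by (simp add: c_def lessThan_Suc_atMost)
  have G0: "?G 0 = 1"
  proof -
    obtain a where "?G 0 = [:a:]" using G(1)[of 0] by (metis degree_eq_zeroE)
    then show ?thesis using G(2)[of 0] by (simp add: one_pCons)
  qed
  have "gegen_weight_23 f = (\<Sum>i\<le>degree f. c i * gegen_weight_23 (?G i))"
    by (subst f) (simp add: gegen_23.W_sum gegen_23.W_smult)
  also have "\<dots> = (\<Sum>i\<le>degree f. if i = 0 then c 0 * gegen_weight_23 1 else 0)"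
  proof (intro sum.cong refl)
    fix i show "c i * gegen_weight_23 (?G i) = (if i = 0 then c 0 * gegen_weight_23 1 else 0)"
      using G(4)[of i 0] G0 by auto
  qed
  also have "\<dots> = c 0 * gegen_weight_23 1" by simp
  finally have "c 0 * gegen_weight_23 1 = gegen_weight_23 f" ..
  also have "gegen_weight_23 f = gegen_weight_23 (\<Sum>k\<le>degree f. smult (coeff f k) (monom 1 k))"
    by (simp add: smult_monom poly_as_sum_of_monoms)
  also have "\<dots> = (\<Sum>k\<le>degree f. coeff f k * sphere_moment 23 k) * gegen_weight_23 1"
    by (simp add: gegen_23.W_sum gegen_23.W_smult gegen_weight_23_monom sum_distrib_right mult.assoc)
  finally have "c 0 = (\<Sum>k\<le>degree f. coeff f k * sphere_moment 23 k)"
    using gegen_23.W_square_pos[of 1] by simp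
  moreover have "gegenbauer_expansion 23 f c"
    using f by (auto simp: gegenbauer_expansion_def c_def)
  ultimately show ?thesis by blast
qed


section \<open>The derived design and the linear programming bound\<close>

lemma poly_fun_sum:
  assumes "\<And>j. j \<in> J \<Longrightarrow> poly_fun_total_degree_le d (p j)"
  shows "poly_fun_total_degree_le d (\<lambda>x. \<Sum>j\<in>J. r j * p j x)"
proof -
  have "\<forall>j\<in>J. \<exists>c. \<forall>x. p j x = (\<Sum>a\<in>{a. (\<Sum>i\<in>UNIV. a i) \<le> d}. c a * (\<Prod>i\<in>UNIV. (x $ i) ^ a i))"
    using assms unfolding poly_fun_total_degree_le_def by blast
  then obtain c where c: "\<forall>j\<in>J. \<forall>x. p j x = (\<Sum>a\<in>{a. (\<Sum>i\<in>UNIV. a i) \<le> d}. c j a * (\<Prod>i\<in>UNIV. (x $ i) ^ a i))"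
    by (rule bchoice[THEN exE])
  have "(\<Sum>j\<in>J. r j * p j x) =
      (\<Sum>a\<in>{a. (\<Sum>i\<in>UNIV. a i) \<le> d}. (\<Sum>j\<in>J. r j * c j a) * (\<Prod>i\<in>UNIV. (x $ i) ^ a i))" for x
  proof -
    have "(\<Sum>j\<in>J. r j * p j x) = (\<Sum>j\<in>J. \<Sum>a\<in>{a. (\<Sum>i\<in>UNIV. a i) \<le> d}. r j * (c j a * (\<Prod>i\<in>UNIV. (x $ i) ^ a i)))"
      by (intro sum.cong refl) (simp add: c sum_distrib_left)
    also have "\<dots> = (\<Sum>a\<in>{a. (\<Sum>i\<in>UNIV. a i) \<le> d}. \<Sum>j\<in>J. r j * (c j a * (\<Prod>i\<in>UNIV. (x $ i) ^ a i)))"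
      by (rule sum.swap)
    finally show ?thesis by (simp add: sum_distrib_right mult.assoc)
  qed
  then show ?thesis
    unfolding poly_fun_total_degree_le_def by (intro exI[of _ "\<lambda>a. \<Sum>j\<in>J. r j * c j a"] allI)
qed

lemma poly_fun_monomial:
  fixes a :: "'n::finite \<Rightarrow> nat"
  assumes "(\<Sum>i\<in>UNIV. a i) \<le> d"
  shows "poly_fun_total_degree_le d (\<lambda>x. \<Prod>i\<in>UNIV. (x $ i) ^ a i)"
  unfolding poly_fun_total_degree_le_def
proof (intro exI allI)
  fix x :: "real ^ 'n"
  show "(\<Prod>i\<in>UNIV. (x $ i) ^ a i) =
      (\<Sum>b\<in>{b. (\<Sum>i\<in>UNIV. b i) \<le> d}. (if b = a then 1 else 0) * (\<Prod>i\<in>UNIV. (x $ i) ^ b i))"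
    using assms finite_exponents[of d, where 'n='n] by (simp add: if_distrib[of "\<lambda>c. c * _"] cong: if_cong)
qed

lemma poly_fun_mult_coordinate:
  fixes p :: "real ^ 'n \<Rightarrow> real"
  assumes "poly_fun_total_degree_le d p"
  shows "poly_fun_total_degree_le (Suc d) (\<lambda>x. x $ i * p x)"
proof -
  let ?A = "{a :: 'n \<Rightarrow> nat. (\<Sum>i\<in>UNIV. a i) \<le> d}"
  obtain c where c: "\<And>x. p x = (\<Sum>a\<in>?A. c a * (\<Prod>i\<in>UNIV. (x $ i) ^ a i))"
    using assms unfolding poly_fun_total_degree_le_def by blast
  have "x $ i * (\<Prod>k\<in>UNIV. (x $ k) ^ a k) = (\<Prod>k\<in>UNIV. (x $ k) ^ (a(i := Suc (a i))) k)" for a and x :: "real ^ 'n"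
    by (subst (1 2) prod.remove[of UNIV i]) auto
  then have eq: "(\<lambda>x. x $ i * p x) = (\<lambda>x. \<Sum>a\<in>?A. c a * (\<Prod>k\<in>UNIV. (x $ k) ^ (a(i := Suc (a i))) k))"
    by (simp only: c sum_distrib_left mult.left_commute)
  have "(\<Sum>k\<in>UNIV. (a(i := Suc (a i))) k) \<le> Suc d" if "a \<in> ?A" for a
  proof -
    have "(\<Sum>k\<in>UNIV. (a(i := Suc (a i))) k) = Suc (\<Sum>k\<in>UNIV. a k)"
      by (subst (1 2) sum.remove[of UNIV i]) auto
    then show ?thesis using that by simp
  qed
  then show ?thesis
    unfolding eq by (intro poly_fun_sum poly_fun_monomial)
qed

lemma poly_fun_inner_power:
  fixes x :: "real ^ 'n"
  assumes "k \<le> d"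
  shows "poly_fun_total_degree_le d (\<lambda>z. (x \<bullet> z) ^ k)"
  using assms
proof (induction k arbitrary: d)
  case 0
  show ?case using poly_fun_monomial[of "\<lambda>_. 0" d] by simp
next
  case (Suc k)
  then obtain e where e: "d = Suc e" "k \<le> e" by (cases d) auto
  have "(\<lambda>z. (x \<bullet> z) ^ Suc k) = (\<lambda>z. \<Sum>i\<in>UNIV. x $ i * (z $ i * (x \<bullet> z) ^ k))"
    by (simp add: inner_vec_def sum_distrib_right mult.assoc)
  then show ?case
    unfolding e(1) by (simp only:) (intro poly_fun_sum poly_fun_mult_coordinate Suc.IH e)
qed

lemma spherical_design_moment:
  fixes C :: "(real ^ 'n::{finite,wellorder}) set"
  assumes C: "spherical_design \<tau> C" and k: "k \<le> \<tau>" and u: "norm u = 1"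
  shows "(\<Sum>z\<in>C. (u \<bullet> z) ^ k) = real (card C) * sphere_moment (real CARD('n)) k"
    and "card C > 0"
proof -
  let ?S = "sphere_measure :: (real ^ 'n::_) measure"
  interpret design_functional "integral\<^sup>L ?S" k by (rule design_functional_sphere_measure)
  interpret prob_space ?S by (rule prob_space_sphere_measure)
  have one: "integral\<^sup>L ?S (\<lambda>z. 1 :: real) = 1" using prob_space by simp
  have avg: "(\<Sum>z\<in>C. (u \<bullet> z) ^ j) / real (card C) = integral\<^sup>L ?S (\<lambda>z. (u \<bullet> z) ^ j)" if "j \<le> \<tau>" for j
    using C poly_fun_inner_power[OF that] unfolding spherical_design_def by blast
  from avg[of 0] one show pos: "card C > 0"
    by (cases "card C = 0") auto
  have "(\<Sum>z\<in>C. (u \<bullet> z) ^ k) / real (card C) = sphere_moment (real CARD('n)) k"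
    using avg[OF k] moment[of k u] u one by simp
  then show "(\<Sum>z\<in>C. (u \<bullet> z) ^ k) = real (card C) * sphere_moment (real CARD('n)) k"
    using pos by (simp add: field_simps)
qed

text \<open>The sum of f(x . z) over the design is exact because the degree is at most the strength;
  dropping the nonnegative terms with z distinct from x leaves f(1).\<close>

lemma avoiding_design_LP_bound:
  fixes C :: "(real ^ 'n::{finite,wellorder}) set"
  assumes C: "spherical_design \<tau> C" "avoiding T C" and f: "degree f \<le> \<tau>"
    and nonneg: "\<And>t. t \<in> {-1..1} - T \<Longrightarrow> 0 \<le> poly f t"
  shows "poly f 1 \<le> real (card C) * (\<Sum>k\<le>degree f. coeff f k * sphere_moment (real CARD('n)) k)"
proof -
  have "card C > 0"
    by (rule spherical_design_moment(2)[OF C(1) le0, of "axis undefined 1"]) simp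
  then obtain x where x: "x \<in> C" and fin: "finite C" by (metis card_gt_0_iff ex_in_conv)
  have unit: "norm z = 1" if "z \<in> C" for z
    using C(1) that by (auto simp: spherical_design_def spherical_code_def)
  have "poly f 1 = poly f (x \<bullet> x)" using unit[OF x] by (simp add: norm_eq_1)
  also have "\<dots> \<le> (\<Sum>z\<in>C. poly f (x \<bullet> z))"
  proof (rule member_le_sum[OF x _ fin])
    fix z assume z: "z \<in> C - {x}"
    then have "x \<bullet> z \<notin> T" using C(2) x unfolding avoiding_def inner_products_def by blast
    moreover have "\<bar>x \<bullet> z\<bar> \<le> 1"
      using Cauchy_Schwarz_ineq2[of x z] unit[OF x] unit[of z] z by simp
    ultimately show "0 \<le> poly f (x \<bullet> z)" by (intro nonneg) (auto simp: abs_le_iff)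
  qed
  also have "\<dots> = (\<Sum>k\<le>degree f. coeff f k * (\<Sum>z\<in>C. (x \<bullet> z) ^ k))"
    unfolding poly_altdef sum_distrib_left by (rule sum.swap)
  also have "\<dots> = (\<Sum>k\<le>degree f. coeff f k * (real (card C) * sphere_moment (real CARD('n)) k))"
    using spherical_design_moment(1)[OF C(1) _ unit[OF x]] f by (intro sum.cong refl) simp
  finally show ?thesis by (simp add: sum_distrib_left mult_ac)
qed

lemma product_nonneg_outside:
  fixes t a b :: real
  assumes "t \<notin> {a<..<b}" "a \<le> b"
  shows "0 \<le> (t - a) * (t - b)"
  using assms by (cases "t \<le> a") (auto simp: mult_nonneg_nonneg mult_nonpos_nonpos)

lemma product_of_four_nonneg:
  "\<lbrakk>0 \<le> a; 0 \<le> b; 0 \<le> c; 0 \<le> d\<rbrakk> \<Longrightarrow> 0 \<le> a * b * c * (d::real)"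
  by simp

lemma coeff_pCons_numeral: "coeff (pCons a p) (numeral n) = coeff p (pred_numeral n)"
  by (simp only: numeral_eq_Suc coeff_pCons_Suc)

text \<open>Each polynomial is t + 1, times a simple factor for each of the four end points of
  \<open>T\<close>, times the square of the factor for the remaining value among 0, +-1/4, +-1/2.
  Sign changes at simple zeros are then confined to the intervals of \<open>T\<close>.\<close>

lemma extremal_poly_exists:
  fixes T :: "real set"
  assumes "T \<in> {{-1/2<..<-1/4} \<union> {1/4<..<1/2},
                {-1/4<..<0} \<union> {1/4<..<1/2},
                {-1/2<..<-1/4} \<union> {0<..<1/4}}"
  obtains f where "degree f = 7" "\<And>t. t \<in> {-1..1} - T \<Longrightarrow> 0 \<le> poly f t"
    "0 < (\<Sum>k\<le>degree f. coeff f k * sphere_moment 23 k)"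
    "poly f 1 = 93150 * (\<Sum>k\<le>degree f. coeff f k * sphere_moment 23 k)"
proof -
  have T: "T = {-1/2<..<-1/4} \<union> {1/4<..<1/2} \<or> T = {-1/4<..<0} \<union> {1/4<..<1/2} \<or>
      T = {-1/2<..<-1/4} \<union> {0<..<1/4}" using assms by simp
  have atMost_7: "{..7::nat} = {0, 1, 2, 3, 4, 5, 6, 7}" by auto
  from T show thesis
  proof (elim disjE)
    assume T: "T = {-1/2<..<-1/4} \<union> {1/4<..<1/2}"
    let ?f = "[:0, 0, 1/64, 1/64, -5/16, -5/16, 1, 1:] :: real poly"
    show thesis
    proof (rule that[of ?f])
      show "degree ?f = 7" by simp
      show "0 \<le> poly ?f t" if "t \<in> {-1..1} - T" for t
      proof -
        have "poly ?f t = (t + 1) * t\<^sup>2 * ((t - (-1/2)) * (t - (-1/4))) * ((t - 1/4) * (t - 1/2))"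
          by (simp add: field_simps power2_eq_square)
        moreover have "0 \<le> \<dots>"
          using that product_nonneg_outside[of t "-1/2" "-1/4"] product_nonneg_outside[of t "1/4" "1/2"]
          unfolding T by (intro product_of_four_nonneg) auto
        ultimately show ?thesis by (simp only:)
      qed
    qed (simp_all add: atMost_7 sphere_moment_numeral coeff_pCons_numeral)
  next
    assume T: "T = {-1/4<..<0} \<union> {1/4<..<1/2}"
    let ?f = "[:0, 1/128, 3/128, -9/64, -15/32, 3/16, 3/2, 1:] :: real poly"
    show thesis
    proof (rule that[of ?f])
      show "degree ?f = 7" by simp
      show "0 \<le> poly ?f t" if "t \<in> {-1..1} - T" for t
      proof -
        have "poly ?f t = (t + 1) * (t + 1/2)\<^sup>2 * ((t - (-1/4)) * (t - 0)) * ((t - 1/4) * (t - 1/2))"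
          by (simp add: field_simps power2_eq_square)
        moreover have "0 \<le> \<dots>"
          using that product_nonneg_outside[of t "-1/4" 0] product_nonneg_outside[of t "1/4" "1/2"]
          unfolding T by (intro product_of_four_nonneg) auto
        ultimately show ?thesis by (simp only:)
      qed
    qed (simp_all add: atMost_7 sphere_moment_numeral coeff_pCons_numeral)
  next
    assume T: "T = {-1/2<..<-1/4} \<union> {0<..<1/4}"
    let ?f = "[:0, -1/128, 1/128, 11/64, -5/32, -13/16, 1/2, 1:] :: real poly"
    show thesis
    proof (rule that[of ?f])
      show "degree ?f = 7" by simp
      show "0 \<le> poly ?f t" if "t \<in> {-1..1} - T" for t
      proof -
        have "poly ?f t = (t + 1) * (t - 1/2)\<^sup>2 * ((t - (-1/2)) * (t - (-1/4))) * ((t - 0) * (t - 1/4))"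
          by (simp add: field_simps power2_eq_square)
        moreover have "0 \<le> \<dots>"
          using that product_nonneg_outside[of t "-1/2" "-1/4"] product_nonneg_outside[of t 0 "1/4"]
          unfolding T by (intro product_of_four_nonneg) auto
        ultimately show ?thesis by (simp only:)
      qed
    qed (simp_all add: atMost_7 sphere_moment_numeral coeff_pCons_numeral)
  qed
qed

text \<open>Multiplying by \<open>p (x \<bullet> z)\<close>, where \<open>p\<close> has degree 4, is 1 at 0 and vanishes at the inner products
  1/2, -1/2, 1/4 and -1/4, restricts sums over the Leech code to the section; the points \<open>x\<close> and
  \<open>-x\<close>, where \<open>p = 45\<close>, contribute only to the cardinality. Hence the strength drops from 11 to 7.\<close>
lemma leech_section_moment:
  assumes x: "x \<in> leech_code" and v: "norm v = 1" "x \<bullet> v = 0" and k: "k \<le> 7"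
  shows "(\<Sum>y\<in>leech_section x. (v \<bullet> y) ^ k) = 93150 * sphere_moment 23 k"
proof -
  interpret design_functional "\<lambda>f. \<Sum>z\<in>leech_code. f z" 11 by (rule leech_code_design)
  \<comment> \<open>This is (1 - 4 t^2) (1 - 16 t^2).\<close>
  let ?p = "\<lambda>t::real. 64 * t ^ 4 - 20 * t\<^sup>2 + 1"
  have moment: "(\<Sum>z\<in>leech_code. (x \<bullet> z) ^ a * (v \<bullet> z) ^ k) = zonal_moment 24 0 a k * 196560" if "a \<le> 4" for a
    using zonal_moment[OF leech_code_norm[OF x] v(1), of a k] that k v(2)
    by (simp add: leech_code_LP(1) card_UNIV_24)
  have "(\<Sum>y\<in>leech_code. ?p (x \<bullet> y) * (v \<bullet> y) ^ k) =
      64 * (\<Sum>z\<in>leech_code. (x \<bullet> z) ^ 4 * (v \<bullet> z) ^ k) - 20 * (\<Sum>z\<in>leech_code. (x \<bullet> z)\<^sup>2 * (v \<bullet> z) ^ k) +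
      (\<Sum>z\<in>leech_code. (x \<bullet> z) ^ 0 * (v \<bullet> z) ^ k)"
    by (simp add: sum_distrib_left sum.distrib sum_subtractf algebra_simps)
  also have "\<dots> = (64 * zonal_moment 24 0 4 k - 20 * zonal_moment 24 0 2 k + zonal_moment 24 0 0 k) * 196560"
    by (simp only: moment) simp
  finally have eq: "(\<Sum>y\<in>leech_code. ?p (x \<bullet> y) * (v \<bullet> y) ^ k) =
      (64 * zonal_moment 24 0 4 k - 20 * zonal_moment 24 0 2 k + zonal_moment 24 0 0 k) * 196560" .
  have "(\<Sum>y\<in>leech_code. ?p (x \<bullet> y) * (v \<bullet> y) ^ k) =
      45 * (v \<bullet> x) ^ k + 45 * (v \<bullet> (- x)) ^ k + (\<Sum>y\<in>leech_section x. (v \<bullet> y) ^ k)"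
    using sum_leech_code_split[OF x, of ?p "\<lambda>y. (v \<bullet> y) ^ k"]
    by (simp add: power_divide)
  \<comment> \<open>Since \<open>v\<close> is orthogonal to \<open>x\<close>, the correction is 90
    for \<open>k = 0\<close> and 0 otherwise.\<close>
  then have "(\<Sum>y\<in>leech_section x. (v \<bullet> y) ^ k) =
      (64 * zonal_moment 24 0 4 k - 20 * zonal_moment 24 0 2 k + zonal_moment 24 0 0 k) * 196560 - 90 * 0 ^ k"
    using eq v(2) by (simp add: inner_commute)
  moreover have "k = 0 \<or> k = 1 \<or> k = 2 \<or> k = 3 \<or> k = 4 \<or> k = 5 \<or> k = 6 \<or> k = 7" using k by linarith
  then have "(64 * zonal_moment 24 0 4 k - 20 * zonal_moment 24 0 2 k + zonal_moment 24 0 0 k) * 196560 - 90 * 0 ^ k =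
      93150 * sphere_moment 23 k"
    by (elim disjE) (simp_all add: zonal_moment_numeral sphere_moment_numeral)
  ultimately show ?thesis by simp
qed

text \<open>Norms are preserved on the hyperplane, which is closed under sums, so polarization
  applies there.\<close>

lemma hyperplane_identification_inner:
  assumes \<phi>: "hyperplane_identification x \<phi>" and v: "x \<bullet> v = 0" and w: "x \<bullet> w = 0"
  shows "\<phi> v \<bullet> \<phi> w = v \<bullet> w"
proof -
  have "norm (\<phi> (v + w)) = norm (v + w)" "norm (\<phi> v) = norm v" "norm (\<phi> w) = norm w"
    using \<phi> v w unfolding hyperplane_identification_def by (auto simp: inner_add_right)
  moreover have "\<phi> (v + w) = \<phi> v + \<phi> w"
    using \<phi> by (simp add: hyperplane_identification_def linear_add)
  ultimately show ?thesis by (simp add: dot_norm)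
qed

text \<open>Every unit vector of the target is the image of a unit vector orthogonal to
  \<open>x\<close>, so the moments of the section transfer to all directions.\<close>

lemma leech_section_design:
  assumes x: "x \<in> leech_code" and \<phi>: "hyperplane_identification x \<phi>"
  shows "card (\<phi> ` leech_section x) = 93150"
    and "spherical_design 7 (\<phi> ` leech_section x)"
    and "inner_products (\<phi> ` leech_section x) \<subseteq> {-1, -1/2, -1/4, 0, 1/4, 1/2}"
proof -
  let ?C = "\<phi> ` leech_section x"
  have perp: "y \<in> leech_code" "x \<bullet> y = 0" if "y \<in> leech_section x" for y
    using that by (auto simp: leech_section_def)
  note inner = hyperplane_identification_inner[OF \<phi>]
  have lin: "linear \<phi>" and surj: "\<phi> ` {v. x \<bullet> v = 0} = UNIV"
    and nrm: "\<And>v. x \<bullet> v = 0 \<Longrightarrow> norm (\<phi> v) = norm v"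
    using \<phi> by (auto simp: hyperplane_identification_def)
  have inj: "inj_on \<phi> (leech_section x)"
  proof (rule inj_onI)
    fix y z assume yz: "y \<in> leech_section x" "z \<in> leech_section x" "\<phi> y = \<phi> z"
    then have "norm (\<phi> (y - z)) = norm (y - z)" using perp by (intro nrm) (simp add: inner_diff_right)
    then show "y = z" using yz(3) lin by (simp add: linear_diff)
  qed
  have mom: "(\<Sum>c\<in>?C. (u \<bullet> c) ^ k) = 93150 * sphere_moment 23 k" if "norm u = 1" "k \<le> 7" for u k
  proof -
    have "u \<in> \<phi> ` {v. x \<bullet> v = 0}" using surj by simp
    then obtain v where v: "x \<bullet> v = 0" "u = \<phi> v" by auto
    have "(\<Sum>c\<in>?C. (u \<bullet> c) ^ k) = (\<Sum>y\<in>leech_section x. (\<phi> v \<bullet> \<phi> y) ^ k)"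
      unfolding v(2) by (simp add: sum.reindex[OF inj])
    also have "\<dots> = (\<Sum>y\<in>leech_section x. (v \<bullet> y) ^ k)"
      using inner[OF v(1)] perp by (intro sum.cong refl) simp
    also have "\<dots> = 93150 * sphere_moment 23 k"
      using x v(1) that nrm[OF v(1)] by (intro leech_section_moment) (simp_all add: v(2))
    finally show ?thesis .
  qed
  \<comment> \<open>The moment of degree 0 is the cardinality.\<close>
  from mom[of "axis 0 1" 0] show card: "card ?C = 93150" by simp
  have unit: "norm c = 1" if "c \<in> ?C" for c
    using that perp nrm leech_code_norm by auto
  let ?E = "\<lambda>f. (\<Sum>z\<in>?C. f z) / real (card ?C)"
  interpret continuous_functional ?E by (rule continuous_functional_scaled_sum)
  have E: "design_functional ?E 7"
    by unfold_locales (simp add: mom card)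
  let ?S = "sphere_measure :: (real ^ 23) measure"
  interpret prob_space ?S by (rule prob_space_sphere_measure)
  have "integral\<^sup>L ?S (\<lambda>z. 1 :: real) = 1" using prob_space by simp
  then have "?E p = integral\<^sup>L ?S p" if "poly_fun_total_degree_le 7 p" for p
    using design_functionals_agree[OF E design_functional_sphere_measure _ that] card by simp
  moreover have "spherical_code ?C"
    using unit finite_leech_code by (auto simp: spherical_code_def leech_section_def)
  ultimately show "spherical_design 7 ?C"
    unfolding spherical_design_def by blast
  show "inner_products ?C \<subseteq> {-1, -1/2, -1/4, 0, 1/4, 1/2}"
  proof
    fix t assume "t \<in> inner_products ?C"
    then obtain y z where yz: "y \<in> leech_section x" "z \<in> leech_section x" "\<phi> y \<noteq> \<phi> z" "t = \<phi> y \<bullet> \<phi> z"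
      unfolding inner_products_def by auto
    then have t: "t = y \<bullet> z" using inner perp by simp
    have "y \<noteq> z" using yz(3) by auto
    then have "t \<noteq> 1" unfolding t using leech_code_inner_1(1)[of y z] perp yz by auto
    moreover have "t \<in> {-1, -1/2, -1/4, 0, 1/4, 1/2, 1}"
      unfolding t using leech_code_inner perp yz by blast
    ultimately show "t \<in> {-1, -1/2, -1/4, 0, 1/4, 1/2}" by blast
  qed
qed


theorem theorem6p3:
  fixes T :: "real set"
  assumes "T \<in> {{-1/2<..<-1/4} \<union> {1/4<..<1/2},
                {-1/4<..<0} \<union> {1/4<..<1/2},
                {-1/2<..<-1/4} \<union> {0<..<1/4}}"
  shows "min_design_size TYPE(23) 7 T = 93150 \<and>
         (\<forall>x \<in> leech_code. \<forall>\<phi>. hyperplane_identification x \<phi> \<longrightarrow>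
            tight_avoiding_design 7 T (\<phi> ` leech_section x))"
proof -
  obtain f where f: "degree f = 7" "\<And>t. t \<in> {-1..1} - T \<Longrightarrow> 0 \<le> poly f t"
    and f0: "0 < (\<Sum>k\<le>degree f. coeff f k * sphere_moment 23 k)"
    and f1: "poly f 1 = 93150 * (\<Sum>k\<le>degree f. coeff f k * sphere_moment 23 k)"
    using extremal_poly_exists[OF assms] by blast
  obtain c where c: "gegenbauer_expansion 23 f c" "c 0 = (\<Sum>k\<le>degree f. coeff f k * sphere_moment 23 k)"
    using gegenbauer_expansion_23 by blast
  have "{-1, -1/2, -1/4, 0, 1/4, 1/2} \<inter> T = {}" using assms by auto
  then have avoids: "avoiding T (\<phi> ` leech_section x)" if "x \<in> leech_code" "hyperplane_identification x \<phi>" for x \<phi>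
    using leech_section_design(3)[OF that] unfolding avoiding_def by blast
  have ge: "93150 \<le> card C" if C: "spherical_design 7 C" "avoiding T C" for C :: "(real ^ 23) set"
  proof -
    have "poly f 1 \<le> real (card C) * (\<Sum>k\<le>degree f. coeff f k * sphere_moment 23 k)"
      using avoiding_design_LP_bound[OF C _ f(2)] f(1) by simp
    then have "93150 \<le> real (card C)" unfolding f1 using f0 by (simp add: mult_le_cancel_right)
    then show ?thesis by simp
  qed
  have "min_design_size TYPE(23) 7 T = enat 93150"
  proof (rule antisym)
    obtain x where x: "x \<in> leech_code" using leech_code_LP(1) by fastforce
    then have "x \<noteq> 0" using leech_code_norm by force
    then obtain \<phi> where \<phi>: "hyperplane_identification x \<phi>" using hyperplane_identification_exists by blast
    show "min_design_size TYPE(23) 7 T \<le> enat 93150"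
      unfolding min_design_size_def leech_section_design(1)[OF x \<phi>, symmetric]
      using leech_section_design(2)[OF x \<phi>] avoids[OF x \<phi>] by (intro INF_lower) simp
    show "enat 93150 \<le> min_design_size TYPE(23) 7 T"
      unfolding min_design_size_def using ge by (intro INF_greatest) simp
  qed
  moreover have "tight_avoiding_design 7 T (\<phi> ` leech_section x)"
    if x: "x \<in> leech_code" and \<phi>: "hyperplane_identification x \<phi>" for x \<phi>
    unfolding tight_avoiding_design_def
  proof (intro conjI exI)
    show "spherical_design 7 (\<phi> ` leech_section x)" by (rule leech_section_design(2)[OF x \<phi>])
    show "avoiding T (\<phi> ` leech_section x)" by (rule avoids[OF x \<phi>])
    show "gegenbauer_expansion CARD(23) f c" using c(1) by simp
    show "\<forall>t\<in>{-1..1} - T. 0 \<le> poly f t" using f(2) by blast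
    show "0 < c 0" using c(2) f0 by simp
    \<comment> \<open>\<open>f\<close> has degree 7, so all these coefficients are 0.\<close>
    show "\<forall>i\<ge>7 + 1. c i \<le> 0" using c(1) f(1) by (simp add: gegenbauer_expansion_def)
    show "real (card (\<phi> ` leech_section x)) = poly f 1 / c 0"
      using f0 unfolding f1 c(2) leech_section_design(1)[OF x \<phi>] by simp
  qed
  ultimately show ?thesis by (simp add: numeral_eq_enat)
qed

end
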